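(* Let $H$ be an infinite-dimensional separable Hilbert space. There exists a positive operator $0\leq A\in\mathcal{L}_{1,\infty}$ such that the set ${\rm PM}(A,\mathcal{L}_{1,\infty})$ strictly contains the set $\overline{\rm Catal}(A,\mathcal{L}_{1,\infty})$, where $${\rm PM}(A,\mathcal{L}_{1,\infty})=\Big\{0\leq B\in\mathcal{L}_{1,\infty}:\ {\rm Tr}(B^p)\leq{\rm Tr}(A^p)\ \text{ for all real } p>1\Big\},$$ $${\rm Catal}(A,\mathcal{L}_{1,\infty})=\Big\{0\leq B\in\mathcal{L}_{1,\infty}:\ \exists\, 0\leq C\in\mathcal{L}_1,\ C\neq 0,\ B\otimes C\prec\prec A\otimes C\Big\},$$ and $\overline{\rm Catal}(A,\mathcal{L}_{1,\infty})$ is the closure of ${\rm Catal}(A,\mathcal{L}_{1,\infty})$ with respect to the quasi-norm $\|\cdot\|_{1,\infty}$.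
   Context: $H$ is an infinite-dimensional separable Hilbert space. For a compact operator $A$, $\mu(A)=\{\mu(k,A)\}_{k\geq0}$ denotes the sequence of singular values of $A$ (eigenvalues of $|A|$) in decreasing order, counted with multiplicity. $\mathcal{L}_1$ denotes the ideal of trace class operators on $H$. $\mathcal{L}_{1,\infty}$ is the ideal of compact operators $A$ on $H$ with $\sup_{k\geq0}(k+1)\mu(k,A)<+\infty$, equipped with the quasi-norm $\|A\|_{1,\infty}=\sup_{k\geq0}(k+1)\mu(k,A)$ (under which it is a quasi-Banach space). For compact operators $A,B$ (possibly acting on different separable Hilbert spaces), $B\prec\prec A$ (Hardy--Littlewood submajorization) means $\sum_{k=0}^{n}\mu(k,B)\leq\sum_{k=0}^{n}\mu(k,A)$ for every integer $n\geq0$. The tensor product $A\otimes C$ is an operator on the Hilbert space tensor product $H\otimes H$; its singular value sequence is the decreasing rearrangement of the family $(\mu(i,A)\mu(j,C))_{i,j\geq0}$. *)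

theory Defs
  imports "HOL-Analysis.Analysis"
begin

section \<open>Complex Hilbert spaces\<close>

text \<open>The inner product is conjugate-linear in the first argument. The triangle inequality
  inherited from the class of Banach spaces is redundant.\<close>

class complex_hilbert = banach +
  fixes scaleC :: "complex \<Rightarrow> 'a \<Rightarrow> 'a" (infixr "*\<^sub>C" 75)
    and cinner :: "'a \<Rightarrow> 'a \<Rightarrow> complex"
  assumes scaleC_add_right: "c *\<^sub>C (x + y) = c *\<^sub>C x + c *\<^sub>C y"
    and scaleC_add_left: "(c + d) *\<^sub>C x = c *\<^sub>C x + d *\<^sub>C x"
    and scaleC_scaleC: "c *\<^sub>C d *\<^sub>C x = (c * d) *\<^sub>C x"
    and scaleC_of_real: "complex_of_real r *\<^sub>C x = r *\<^sub>R x"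
    and cinner_commute: "cinner x y = cnj (cinner y x)"
    and cinner_add_right: "cinner x (y + z) = cinner x y + cinner x z"
    and cinner_scaleC_right: "cinner x (c *\<^sub>C y) = c * cinner x y"
    and cinner_self: "cinner x x = complex_of_real ((norm x)\<^sup>2)"

global_interpretation complex_vector:
  vector_space "scaleC :: complex \<Rightarrow> 'a \<Rightarrow> 'a::complex_hilbert"
  defines cspan = complex_vector.span
    and cdim = complex_vector.dim
proof
  show "1 *\<^sub>C x = x" for x :: 'a
    using scaleC_of_real[of 1 x] by simp
qed (rule scaleC_add_right scaleC_add_left scaleC_scaleC)+

definition onb :: "'a::complex_hilbert set \<Rightarrow> bool" where
  "onb E \<longleftrightarrow>
     (\<forall>e\<in>E. \<forall>f\<in>E. cinner e f = (if e = f then 1 else 0)) \<and> closure (cspan E) = UNIV"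


section \<open>Operators\<close>

definition bounded_clinear :: "('a::complex_hilbert \<Rightarrow> 'b::complex_hilbert) \<Rightarrow> bool" where
  "bounded_clinear T \<longleftrightarrow> bounded_linear T \<and> (\<forall>c x. T (c *\<^sub>C x) = c *\<^sub>C T x)"

definition compact_op :: "('a::complex_hilbert \<Rightarrow> 'b::complex_hilbert) \<Rightarrow> bool" where
  "compact_op T \<longleftrightarrow> bounded_clinear T \<and> compact (closure (T ` cball 0 1))"

definition positive_op :: "('a::complex_hilbert \<Rightarrow> 'a) \<Rightarrow> bool" where
  "positive_op T \<longleftrightarrow> bounded_clinear T \<and> (\<forall>x. cinner x (T x) \<in> \<real>\<^sub>\<ge>\<^sub>0)"

definition adj :: "('a::complex_hilbert \<Rightarrow> 'b::complex_hilbert) \<Rightarrow> 'b \<Rightarrow> 'a" where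
  "adj T = (THE S. \<forall>x y. cinner (S y) x = cinner y (T x))"

definition abs_op :: "('a::complex_hilbert \<Rightarrow> 'b::complex_hilbert) \<Rightarrow> 'a \<Rightarrow> 'a" where
  "abs_op T = (THE P. positive_op P \<and> P \<circ> P = adj T \<circ> T)"

definition eigenspace :: "('a::complex_hilbert \<Rightarrow> 'a) \<Rightarrow> complex \<Rightarrow> 'a set" where
  "eigenspace T l = {x. T x = l *\<^sub>C x}"

text \<open>Real powers of a positive compact operator: the eigenvectors span a dense subspace, so the
  operator below is the one given by the functional calculus (for \<open>p > 0\<close>; note \<open>0 powr p = 0\<close>).\<close>

definition op_powr :: "('a::complex_hilbert \<Rightarrow> 'a) \<Rightarrow> real \<Rightarrow> 'a \<Rightarrow> 'a" where
  "op_powr B p =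
     (THE T. bounded_clinear T \<and>
        (\<forall>l\<ge>0. \<forall>x\<in>eigenspace B (complex_of_real l). T x = complex_of_real (l powr p) *\<^sub>C x))"

text \<open>The trace of a positive operator, with values in \<open>[0, \<infinity>]\<close>; it does not depend on the
  orthonormal basis.\<close>

definition op_trace :: "('a::complex_hilbert \<Rightarrow> 'a) \<Rightarrow> ennreal" where
  "op_trace T = (\<Sum>\<^sub>\<infinity>e\<in>(SOME E. onb E). ennreal (Re (cinner e (T e))))"


section \<open>Singular values and operator ideals\<close>

text \<open>The eigenvalues of the absolute value of a compact operator, in decreasing order and counted
  with multiplicity. As usual the sequence is padded with zeros if the operator has finite rank, and
  contains no zero otherwise; this is why only \<open>l > 0\<close> is counted.\<close>

definition sing_val :: "('a::complex_hilbert \<Rightarrow> 'b::complex_hilbert) \<Rightarrow> nat \<Rightarrow> real" where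
  "sing_val T =
     (THE s. decseq s \<and> s \<longlonglongrightarrow> 0 \<and>
        (\<forall>l>0. card {k. s k = l} = cdim (eigenspace (abs_op T) (complex_of_real l))))"

definition submaj ::
  "('a::complex_hilbert \<Rightarrow> 'a) \<Rightarrow> ('b::complex_hilbert \<Rightarrow> 'b) \<Rightarrow> bool" (infix "\<prec>\<prec>" 50) where
  "B \<prec>\<prec> A \<longleftrightarrow> (\<forall>n. (\<Sum>k\<le>n. sing_val B k) \<le> (\<Sum>k\<le>n. sing_val A k))"

definition trace_class :: "('a::complex_hilbert \<Rightarrow> 'a) set" where
  "trace_class = {A. compact_op A \<and> op_trace (abs_op A) < \<infinity>}"

definition weak_L1 :: "('a::complex_hilbert \<Rightarrow> 'a) set" where
  "weak_L1 = {A. compact_op A \<and> bdd_above (range (\<lambda>k. (real k + 1) * sing_val A k))}"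

definition weak_L1_norm :: "('a::complex_hilbert \<Rightarrow> 'a) \<Rightarrow> real" where
  "weak_L1_norm A = (SUP k. (real k + 1) * sing_val A k)"

definition weak_L1_closure ::
  "('a::complex_hilbert \<Rightarrow> 'a) set \<Rightarrow> ('a \<Rightarrow> 'a) set" where
  "weak_L1_closure S =
     {B \<in> weak_L1. \<forall>e>0. \<exists>B'\<in>S. weak_L1_norm (\<lambda>x. B x - B' x) < e}"


section \<open>Tensor products\<close>

text \<open>\<open>hilbert_tensor t\<close> says that \<open>'c\<close> together with the bilinear map \<open>t\<close> of elementary tensors
  is a Hilbert space tensor product of \<open>'a\<close> and \<open>'b\<close>, i.e. a completion of the algebraic tensor
  product with respect to the product inner product. This determines it up to a unique unitary
  isomorphism.\<close>

definition hilbert_tensor ::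
  "('a::complex_hilbert \<Rightarrow> 'b::complex_hilbert \<Rightarrow> 'c::complex_hilbert) \<Rightarrow> bool" where
  "hilbert_tensor t \<longleftrightarrow>
     (\<forall>x x' y. t (x + x') y = t x y + t x' y) \<and>
     (\<forall>x y y'. t x (y + y') = t x y + t x y') \<and>
     (\<forall>c x y. t (c *\<^sub>C x) y = c *\<^sub>C t x y) \<and>
     (\<forall>c x y. t x (c *\<^sub>C y) = c *\<^sub>C t x y) \<and>
     (\<forall>x y x' y'. cinner (t x y) (t x' y') = cinner x x' * cinner y y') \<and>
     closure (cspan {t x y |x y. True}) = UNIV"

definition tensor_op ::
  "('a::complex_hilbert \<Rightarrow> 'b::complex_hilbert \<Rightarrow> 'c::complex_hilbert) \<Rightarrow>
   ('a \<Rightarrow> 'a) \<Rightarrow> ('b \<Rightarrow> 'b) \<Rightarrow> 'c \<Rightarrow> 'c" where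
  "tensor_op t A C = (THE T. bounded_clinear T \<and> (\<forall>x y. T (t x y) = t (A x) (C y)))"


section \<open>Power majorization and catalytic majorization\<close>

definition PM :: "('a::complex_hilbert \<Rightarrow> 'a) \<Rightarrow> ('a \<Rightarrow> 'a) set" where
  "PM A = {B. positive_op B \<and> B \<in> weak_L1 \<and>
     (\<forall>p>1. op_trace (op_powr B p) \<le> op_trace (op_powr A p))}"

definition Catal ::
  "('a::complex_hilbert \<Rightarrow> 'a \<Rightarrow> 'c::complex_hilbert) \<Rightarrow> ('a \<Rightarrow> 'a) \<Rightarrow> ('a \<Rightarrow> 'a) set" where
  "Catal t A = {B. positive_op B \<and> B \<in> weak_L1 \<and>
     (\<exists>C. positive_op C \<and> C \<in> trace_class \<and> C \<noteq> (\<lambda>x. 0) \<and>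
        tensor_op t B C \<prec>\<prec> tensor_op t A C)}"

end

theory Submission
  imports Defs "HOL-Real_Asymp.Real_Asymp"
begin

text \<open>
  Why the inclusion is strict. Let a positive operator have the eigenvalues \<open>x i\<close>, and consider the
  excess sums \<open>\<Sum>i. max 0 (x i - r)\<close> for small thresholds \<open>r = 1 / N\<close>. For operators in the weak
  \<open>L1\<close> ideal they grow at most like \<open>ln N\<close>, and submajorization orders them. Tensoring with a catalyst
  with eigenvalues \<open>c j\<close> turns them into averages with weights \<open>c j\<close> of excess sums at the thresholds
  \<open>r / c j\<close>. On the logarithmic scale these thresholds are only translated by constants, so
  to leading order in \<open>ln N\<close> a trace class catalyst contributes nothing but the factor \<open>\<Sum>j. c j\<close>,
  which cancels. Hence catalytic submajorization, and any approximation of it in the quasi-norm,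
  constrains the logarithmic means at every scale \<open>N\<close>. Power majorization constrains only their
  Laplace type averages over all scales, and an operator may violate the constraint on a sparse sequence
  of scales while respecting it on average.

  The example. The operator \<open>A\<close> has the eigenvalues \<open>1 / (9 i + 1)\<close>, with logarithmic mass \<open>ln N / 9\<close>
  up to \<open>N\<close> and \<open>Tr (A powr (s + 1)) \<ge> 1 / (9 s)\<close>. The operator \<open>B\<close> has the eigenvalues \<open>1 / m\<close> for \<open>m\<close> in
  the blocks \<open>{M ^ 3<..M ^ 4}\<close>, where \<open>M\<close> runs through the numbers \<open>2 ^ (10000 ^ j)\<close>. Up to \<open>N = M ^ 4\<close>
  it has the mass \<open>ln N / 4\<close>. Passing to a nearby operator by Ky Fan's inequality costs a factor of
  at most \<open>2\<close> and a small error, and \<open>1 / 8 > 1 / 9\<close> (\<open>sparse_harmonic_not_in_closure\<close>). On the other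
  hand a block contributes at most \<open>(x ^ 3 - x ^ 4) / s\<close> to \<open>Tr (B powr (s + 1))\<close>, where \<open>x = M powr - s\<close>.
  This is at most \<open>27 / (256 s)\<close>, less than \<open>1 / (9 s)\<close>, and for each \<open>s\<close> all blocks but one are
  negligible (\<open>sparse_harmonic_power_sum_le\<close>). So \<open>B\<close> belongs to \<open>PM A\<close>.

  The inclusion itself holds because powers are convex, because the trace of a power is multiplicative
  under tensor products (\<open>Catal_power_sums\<close>), and because it is lower semicontinuous
  (\<open>closure_Catal_subset_PM\<close>).

  All operators involved are handled through their diagonal form. Compact positive operators have one
  by the singular value decomposition (\<open>positive_compact_diagonal\<close>), powers, traces and tensor products
  of diagonal operators are diagonal sums and products, and singular values are
  accessible through the minimax principle (\<open>sing_val_le\<close>) and as rearranged coefficients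
  (\<open>infsum_sing_val_diagonal\<close>).
\<close>



section \<open>Unordered sums in \<open>[0, \<infinity>]\<close>\<close>

lemma sum_le_infsum_ennreal:
  fixes f :: "'a \<Rightarrow> ennreal"
  assumes "finite F" and "F \<subseteq> A"
  shows "sum f F \<le> infsum f A"
  unfolding nonneg_infsum_complete[OF zero_le] by (rule SUP_upper) (use assms in simp)

lemma infsum_le_ennreal:
  fixes f :: "'a \<Rightarrow> ennreal"
  assumes "\<And>F. finite F \<Longrightarrow> F \<subseteq> A \<Longrightarrow> sum f F \<le> b"
  shows "infsum f A \<le> b"
  by (rule infsum_le_finite_sums) (auto intro: assms nonneg_summable_on_complete)

lemma infsum_cmult_ennreal:
  fixes f :: "'a \<Rightarrow> ennreal"
  shows "(\<Sum>\<^sub>\<infinity>x\<in>A. c * f x) = c * infsum f A"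
  by (simp add: nonneg_infsum_complete SUP_mult_left_ennreal flip: sum_distrib_left)

lemma sum_infsum_ennreal:
  fixes f :: "'a \<Rightarrow> 'b \<Rightarrow> ennreal"
  shows "(\<Sum>x\<in>F. \<Sum>\<^sub>\<infinity>y\<in>B. f x y) = (\<Sum>\<^sub>\<infinity>y\<in>B. \<Sum>x\<in>F. f x y)"
  by (induction F rule: infinite_finite_induct)
     (auto simp: infsum_add nonneg_summable_on_complete)

lemma infsum_Times_ennreal:
  fixes f :: "'a \<Rightarrow> 'b \<Rightarrow> ennreal"
  shows "(\<Sum>\<^sub>\<infinity>(x, y)\<in>A \<times> B. f x y) = (\<Sum>\<^sub>\<infinity>x\<in>A. \<Sum>\<^sub>\<infinity>y\<in>B. f x y)"
proof (rule antisym)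
  show "(\<Sum>\<^sub>\<infinity>(x, y)\<in>A \<times> B. f x y) \<le> (\<Sum>\<^sub>\<infinity>x\<in>A. \<Sum>\<^sub>\<infinity>y\<in>B. f x y)"
  proof (rule infsum_le_ennreal)
    fix F assume F: "finite F" "F \<subseteq> A \<times> B"
    have "(\<Sum>(x, y)\<in>F. f x y) \<le> (\<Sum>(x, y)\<in>fst ` F \<times> snd ` F. f x y)"
      using F by (intro sum_mono2) (auto intro: rev_image_eqI)
    also have "\<dots> = (\<Sum>x\<in>fst ` F. \<Sum>y\<in>snd ` F. f x y)"
      by (simp add: sum.cartesian_product)
    also have "\<dots> \<le> (\<Sum>x\<in>fst ` F. \<Sum>\<^sub>\<infinity>y\<in>B. f x y)"
      using F by (intro sum_mono sum_le_infsum_ennreal) auto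
    also have "\<dots> \<le> (\<Sum>\<^sub>\<infinity>x\<in>A. \<Sum>\<^sub>\<infinity>y\<in>B. f x y)"
      using F by (intro sum_le_infsum_ennreal) auto
    finally show "(\<Sum>(x, y)\<in>F. f x y) \<le> (\<Sum>\<^sub>\<infinity>x\<in>A. \<Sum>\<^sub>\<infinity>y\<in>B. f x y)" .
  qed
  show "(\<Sum>\<^sub>\<infinity>x\<in>A. \<Sum>\<^sub>\<infinity>y\<in>B. f x y) \<le> (\<Sum>\<^sub>\<infinity>(x, y)\<in>A \<times> B. f x y)"
  proof (rule infsum_le_ennreal)
    fix F assume F: "finite F" "F \<subseteq> A"
    have "(\<Sum>x\<in>F. \<Sum>\<^sub>\<infinity>y\<in>B. f x y) = (\<Sum>\<^sub>\<infinity>y\<in>B. \<Sum>x\<in>F. f x y)"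
      by (rule sum_infsum_ennreal)
    also have "\<dots> \<le> (\<Sum>\<^sub>\<infinity>(x, y)\<in>A \<times> B. f x y)"
    proof (rule infsum_le_ennreal)
      fix G assume G: "finite G" "G \<subseteq> B"
      have "(\<Sum>y\<in>G. \<Sum>x\<in>F. f x y) = (\<Sum>(x, y)\<in>F \<times> G. f x y)"
        by (subst sum.swap) (simp add: sum.cartesian_product)
      also have "\<dots> \<le> (\<Sum>\<^sub>\<infinity>(x, y)\<in>A \<times> B. f x y)"
        using F G by (intro sum_le_infsum_ennreal) auto
      finally show "(\<Sum>y\<in>G. \<Sum>x\<in>F. f x y) \<le> (\<Sum>\<^sub>\<infinity>(x, y)\<in>A \<times> B. f x y)" .
    qed
    finally show "(\<Sum>x\<in>F. \<Sum>\<^sub>\<infinity>y\<in>B. f x y) \<le> (\<Sum>\<^sub>\<infinity>(x, y)\<in>A \<times> B. f x y)" .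
  qed
qed

lemma infsum_swap_ennreal:
  fixes f :: "'a \<Rightarrow> 'b \<Rightarrow> ennreal"
  shows "(\<Sum>\<^sub>\<infinity>x\<in>A. \<Sum>\<^sub>\<infinity>y\<in>B. f x y) = (\<Sum>\<^sub>\<infinity>y\<in>B. \<Sum>\<^sub>\<infinity>x\<in>A. f x y)"
proof -
  have "(\<Sum>\<^sub>\<infinity>(x, y)\<in>A \<times> B. f x y) = (\<Sum>\<^sub>\<infinity>(y, x)\<in>B \<times> A. f x y)"
    by (rule infsum_reindex_bij_witness[where i = prod.swap and j = prod.swap]) auto
  thus ?thesis
    by (simp add: infsum_Times_ennreal)
qed

lemma infsum_times_ennreal:
  fixes f :: "'a \<Rightarrow> ennreal" and g :: "'b \<Rightarrow> ennreal"
  shows "(\<Sum>\<^sub>\<infinity>(x, y)\<in>A \<times> B. f x * g y) = infsum f A * infsum g B"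
proof -
  have "(\<Sum>\<^sub>\<infinity>(x, y)\<in>A \<times> B. f x * g y) = (\<Sum>\<^sub>\<infinity>x\<in>A. infsum g B * f x)"
    by (simp add: infsum_Times_ennreal[where f = "\<lambda>x y. f x * g y"] infsum_cmult_ennreal mult.commute)
  also have "\<dots> = infsum g B * infsum f A"
    by (rule infsum_cmult_ennreal)
  finally show ?thesis
    by (simp only: mult.commute)
qed

text \<open>A convergent nonnegative real sum agrees with its \<open>[0, \<infinity>]\<close>-valued version.\<close>

lemma infsum_ennreal_has_sum:
  assumes s: "(f has_sum S) A" and nn: "\<And>x. x \<in> A \<Longrightarrow> f x \<ge> 0"
  shows "(\<Sum>\<^sub>\<infinity>x\<in>A. ennreal (f x)) = ennreal S"
proof -
  have "f summable_on A" and S: "infsum f A = S"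
    using s by (simp_all add: has_sum_iff)
  hence "ennreal S = (SUP F\<in>{F. finite F \<and> F \<subseteq> A}. ennreal (sum f F))"
    using infsum_nonneg_is_SUPREMUM_ennreal[OF _ nn] by force
  also have "\<dots> = (SUP F\<in>{F. finite F \<and> F \<subseteq> A}. \<Sum>x\<in>F. ennreal (f x))"
    using nn by (intro SUP_cong refl) (auto simp: subset_iff)
  finally show ?thesis
    by (simp add: nonneg_infsum_complete)
qed


section \<open>Complex inner products\<close>

lemma cinner_add_left: "cinner (x + y) z = cinner x z + cinner y z"
  by (metis cinner_add_right cinner_commute complex_cnj_add)

lemma cinner_scaleC_left: "cinner (c *\<^sub>C x) y = cnj c * cinner x y"
  by (metis cinner_scaleC_right cinner_commute complex_cnj_mult)

lemma scaleR_conv_scaleC: "r *\<^sub>R x = complex_of_real r *\<^sub>C x"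
  by (simp add: scaleC_of_real)

lemma scaleC_one [simp]: "1 *\<^sub>C x = x"
  using scaleC_of_real[of 1 x] by simp

lemma scaleC_zero_left [simp]: "0 *\<^sub>C x = 0"
  using scaleC_of_real[of 0 x] by simp

lemma scaleC_zero_right [simp]: "c *\<^sub>C 0 = 0"
  by (metis scaleC_add_right add_cancel_right_right)

lemma scaleC_minus_right: "c *\<^sub>C (- x) = - (c *\<^sub>C x)"
  by (metis add_eq_0_iff2 scaleC_add_right scaleC_zero_right ab_left_minus)

lemma scaleC_diff_right: "c *\<^sub>C (x - y) = c *\<^sub>C x - c *\<^sub>C y"
  by (metis diff_conv_add_uminus scaleC_add_right scaleC_minus_right)



lemma cinner_zero_right [simp]: "cinner x 0 = 0"
  by (metis cinner_add_right add_cancel_right_right)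

lemma cinner_zero_left [simp]: "cinner 0 x = 0"
  by (metis cinner_add_left add_cancel_right_right)

lemma cinner_minus_right: "cinner x (- y) = - cinner x y"
  by (metis add_eq_0_iff2 cinner_add_right cinner_zero_right ab_left_minus)

lemma cinner_minus_left: "cinner (- x) y = - cinner x y"
  by (metis add_eq_0_iff2 cinner_add_left cinner_zero_left ab_left_minus)

lemma cinner_diff_right: "cinner x (y - z) = cinner x y - cinner x z"
  by (metis diff_conv_add_uminus cinner_add_right cinner_minus_right)

lemma cinner_diff_left: "cinner (x - y) z = cinner x z - cinner y z"
  by (metis diff_conv_add_uminus cinner_add_left cinner_minus_left)

lemma cinner_sum_right: "cinner x (\<Sum>i\<in>F. f i) = (\<Sum>i\<in>F. cinner x (f i))"
  by (induction F rule: infinite_finite_induct) (auto simp: cinner_add_right)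

lemma cinner_sum_left: "cinner (\<Sum>i\<in>F. f i) x = (\<Sum>i\<in>F. cinner (f i) x)"
  by (induction F rule: infinite_finite_induct) (auto simp: cinner_add_left)

lemma cinner_eq_0_sym: "cinner x y = 0 \<Longrightarrow> cinner y x = 0"
  using cinner_commute[of y x] by simp

lemmas cinner_simps = cinner_add_left cinner_add_right cinner_diff_left cinner_diff_right
  cinner_scaleC_left cinner_scaleC_right

lemma cinner_self_eq_0_iff [simp]: "cinner x x = 0 \<longleftrightarrow> x = 0"
  by (simp add: cinner_self)

lemma Re_cinner_self: "Re (cinner x x) = (norm x)\<^sup>2"
  by (simp add: cinner_self)

lemma norm_scaleC [simp]: "norm (c *\<^sub>C x) = cmod c * norm x"
proof -
  have "complex_of_real ((norm (c *\<^sub>C x))\<^sup>2) = cnj c * c * complex_of_real ((norm x)\<^sup>2)"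
    by (simp only: cinner_self[symmetric] cinner_simps mult_ac)
  also have "\<dots> = complex_of_real ((cmod c * norm x)\<^sup>2)"
    by (metis complex_norm_square mult.commute of_real_mult power_mult_distrib)
  finally have "(norm (c *\<^sub>C x))\<^sup>2 = (cmod c * norm x)\<^sup>2"
    using of_real_eq_iff by blast
  thus ?thesis
    by (simp add: power2_eq_iff_nonneg)
qed

lemma norm_diff_sq: "(norm (x - y))\<^sup>2 = (norm x)\<^sup>2 - 2 * Re (cinner x y) + (norm y)\<^sup>2"
proof -
  have "Re (cinner y x) = Re (cinner x y)"
    by (subst cinner_commute) simp
  thus ?thesis
    by (simp add: Re_cinner_self[symmetric] cinner_simps)
qed

lemma norm_add_sq: "(norm (x + y))\<^sup>2 = (norm x)\<^sup>2 + 2 * Re (cinner x y) + (norm y)\<^sup>2"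
  using norm_diff_sq[of x "- y"] by (simp add: cinner_minus_right)

lemma Cauchy_Schwarz_cinner: "cmod (cinner x y) \<le> norm x * norm y"
proof (cases "y = 0")
  case False
  define c where "c = cinner y x / complex_of_real ((norm y)\<^sup>2)"
  have n: "(norm y)\<^sup>2 > 0"
    using False by simp
  have xy: "cinner x y = cnj (cinner y x)"
    by (rule cinner_commute)
  have sq: "cinner y x * cnj (cinner y x) = complex_of_real ((cmod (cinner y x))\<^sup>2)"
    by (rule complex_norm_square[symmetric])
  have "0 \<le> (norm (x - c *\<^sub>C y))\<^sup>2"
    by simp
  also have "\<dots> = (norm x)\<^sup>2 - 2 * Re (c * cinner x y) + (cmod c)\<^sup>2 * (norm y)\<^sup>2"
    by (simp add: norm_diff_sq cinner_simps power_mult_distrib)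
  also have "c * cinner x y = complex_of_real ((cmod (cinner y x))\<^sup>2 / (norm y)\<^sup>2)"
    unfolding c_def xy by (simp add: sq)
  also have "(cmod c)\<^sup>2 * (norm y)\<^sup>2 = (cmod (cinner y x))\<^sup>2 / (norm y)\<^sup>2"
    using n by (simp add: c_def norm_divide power_divide power2_eq_square norm_mult field_simps)
  finally have "(cmod (cinner y x))\<^sup>2 / (norm y)\<^sup>2 \<le> (norm x)\<^sup>2"
    by simp
  hence "(cmod (cinner y x))\<^sup>2 \<le> (norm x * norm y)\<^sup>2"
    using n by (simp add: field_simps)
  hence "cmod (cinner y x) \<le> norm x * norm y"
    by (rule power2_le_imp_le) simp
  thus ?thesis
    by (simp add: xy)
qed simp

lemma bounded_linear_cinner_right: "bounded_linear (cinner x)"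
  by (rule bounded_linear_intro[where K = "norm x"])
     (auto simp: cinner_simps scaleR_conv_scaleC scaleR_conv_of_real
        intro: order.trans[OF Cauchy_Schwarz_cinner])



lemma bounded_linear_scaleC_right: "bounded_linear (\<lambda>x. c *\<^sub>C x)"
  by (rule bounded_linear_intro[where K = "cmod c"])
     (auto simp: scaleC_add_right scaleR_conv_scaleC scaleC_scaleC mult_ac)

lemma bounded_linear_scaleC_left: "bounded_linear (\<lambda>c. c *\<^sub>C x)"
  by (rule bounded_linear_intro[where K = "norm x"])
     (auto simp: scaleC_add_left scaleR_conv_scaleC scaleC_scaleC scaleR_conv_of_real)

lemmas tendsto_scaleC_right = bounded_linear.tendsto[OF bounded_linear_scaleC_right]

lemma cinner_ext: "(\<And>x. cinner x y = cinner x z) \<Longrightarrow> y = z"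
  by (metis cinner_diff_right cinner_self_eq_0_iff right_minus_eq)


section \<open>Orthonormal families\<close>

definition orthonormal_on :: "'i set \<Rightarrow> ('i \<Rightarrow> 'a::complex_hilbert) \<Rightarrow> bool" where
  "orthonormal_on I e \<longleftrightarrow> (\<forall>i\<in>I. \<forall>j\<in>I. cinner (e i) (e j) = (if i = j then 1 else 0))"

abbreviation orthonormal :: "('i \<Rightarrow> 'a::complex_hilbert) \<Rightarrow> bool" where
  "orthonormal \<equiv> orthonormal_on UNIV"

lemma orthonormalD: "orthonormal e \<Longrightarrow> cinner (e i) (e j) = (if i = j then 1 else 0)"
  by (simp add: orthonormal_on_def)

lemma orthonormal_on_subset: "orthonormal_on I e \<Longrightarrow> J \<subseteq> I \<Longrightarrow> orthonormal_on J e"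
  unfolding orthonormal_on_def by blast

lemma orthonormal_on_norm:
  assumes "orthonormal_on I e" and "i \<in> I"
  shows "norm (e i) = 1"
proof -
  have "complex_of_real ((norm (e i))\<^sup>2) = 1"
    unfolding cinner_self[symmetric] using assms by (simp add: orthonormal_on_def)
  hence "(norm (e i))\<^sup>2 = 1"
    using of_real_eq_1_iff by blast
  thus ?thesis
    by (simp add: power2_eq_1_iff) (smt (verit) norm_ge_zero)
qed

lemma orthonormal_on_inj:
  assumes "orthonormal_on I e" shows "inj_on e I"
proof (rule inj_onI)
  fix i j assume ij: "i \<in> I" "j \<in> I" "e i = e j"
  hence "cinner (e i) (e i) = (if i = j then 1 else 0)"
    using assms by (metis orthonormal_on_def)
  moreover have "cinner (e i) (e i) = 1"
    using assms ij by (auto simp: orthonormal_on_def)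
  ultimately show "i = j"
    by (auto split: if_splits)
qed

lemma orthonormal_onI_less:
  fixes e :: "nat \<Rightarrow> 'a::complex_hilbert"
  assumes "\<And>i. i \<in> I \<Longrightarrow> norm (e i) = 1"
    and "\<And>i j. i < j \<Longrightarrow> j \<in> I \<Longrightarrow> cinner (e i) (e j) = 0"
  shows "orthonormal_on I e"
  unfolding orthonormal_on_def
proof (intro ballI)
  fix i j assume "i \<in> I" "j \<in> I"
  thus "cinner (e i) (e j) = (if i = j then 1 else 0)"
    using assms(1)[of i] assms(2)[of i j] assms(2)[of j i, THEN cinner_eq_0_sym]
    by (cases i j rule: linorder_cases) (auto simp: cinner_self)
qed

lemma cinner_orthonormal_sum:
  assumes "orthonormal_on I e" and "finite F" and "F \<subseteq> I" and "j \<in> I"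
  shows "cinner (e j) (\<Sum>i\<in>F. c i *\<^sub>C e i) = (if j \<in> F then c j else 0)"
proof -
  have "cinner (e j) (\<Sum>i\<in>F. c i *\<^sub>C e i) = (\<Sum>i\<in>F. c i * cinner (e j) (e i))"
    by (simp add: cinner_sum_right cinner_simps)
  also have "\<dots> = (\<Sum>i\<in>F. if i = j then c i else 0)"
    using assms by (intro sum.cong) (auto simp: orthonormal_on_def)
  also have "\<dots> = (if j \<in> F then c j else 0)"
    using assms by simp
  finally show ?thesis .
qed

lemma norm_orthonormal_sum:
  assumes "orthonormal_on I e" and "finite F" and "F \<subseteq> I"
  shows "(norm (\<Sum>i\<in>F. c i *\<^sub>C e i))\<^sup>2 = (\<Sum>i\<in>F. (cmod (c i))\<^sup>2)"
proof -
  have "cinner (\<Sum>i\<in>F. c i *\<^sub>C e i) (\<Sum>i\<in>F. c i *\<^sub>C e i)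
      = (\<Sum>i\<in>F. cnj (c i) * cinner (e i) (\<Sum>i\<in>F. c i *\<^sub>C e i))"
    by (subst cinner_sum_left) (simp add: cinner_simps)
  also have "\<dots> = (\<Sum>i\<in>F. cnj (c i) * c i)"
    using assms(3) by (intro sum.cong refl) (subst cinner_orthonormal_sum[OF assms], auto)
  also have "\<dots> = complex_of_real (\<Sum>i\<in>F. (cmod (c i))\<^sup>2)"
    by (simp add: complex_norm_square mult.commute del: of_real_power)
  finally show ?thesis
    unfolding cinner_self using of_real_eq_iff by blast
qed

lemma norm_residual:
  assumes "orthonormal_on I e" and "finite F" and "F \<subseteq> I"
  shows "(norm (x - (\<Sum>i\<in>F. cinner (e i) x *\<^sub>C e i)))\<^sup>2
           = (norm x)\<^sup>2 - (\<Sum>i\<in>F. (cmod (cinner (e i) x))\<^sup>2)"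
proof -
  have "cinner x (\<Sum>i\<in>F. cinner (e i) x *\<^sub>C e i) = (\<Sum>i\<in>F. cinner (e i) x * cinner x (e i))"
    by (simp add: cinner_sum_right cinner_simps)
  also have "\<dots> = (\<Sum>i\<in>F. complex_of_real ((cmod (cinner (e i) x))\<^sup>2))"
    by (intro sum.cong refl) (metis cinner_commute complex_norm_square)
  finally have "Re (cinner x (\<Sum>i\<in>F. cinner (e i) x *\<^sub>C e i))
      = (\<Sum>i\<in>F. (cmod (cinner (e i) x))\<^sup>2)"
    by simp
  thus ?thesis
    by (simp add: norm_diff_sq norm_orthonormal_sum[OF assms])
qed

lemma Bessel_finite:
  assumes "orthonormal_on I e" and "finite F" and "F \<subseteq> I"
  shows "(\<Sum>i\<in>F. (cmod (cinner (e i) x))\<^sup>2) \<le> (norm x)\<^sup>2"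
  using norm_residual[OF assms, of x] by (smt (verit) zero_le_power2)

lemma Bessel_summable:
  assumes "orthonormal_on I e"
  shows "(\<lambda>i. (cmod (cinner (e i) x))\<^sup>2) summable_on I"
  by (rule nonneg_bdd_above_summable_on)
     (auto intro!: bdd_aboveI[where M = "(norm x)\<^sup>2"] Bessel_finite[OF assms])

lemma residual_orthogonal:
  assumes "orthonormal_on I e" and "finite F" and "F \<subseteq> I" and "j \<in> F"
  shows "cinner (e j) (x - (\<Sum>i\<in>F. cinner (e i) x *\<^sub>C e i)) = 0"
proof -
  have "j \<in> I"
    using assms by blast
  thus ?thesis
    using assms by (simp add: cinner_diff_right cinner_orthonormal_sum[OF assms(1)])
qed

text \<open>Orthogonality turns square summability of the coefficients into the Cauchy property of the
  partial sums.\<close>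

lemma orthonormal_summable:
  assumes e: "orthonormal_on I e" and c: "(\<lambda>i. (cmod (c i))\<^sup>2) summable_on I"
  shows "(\<lambda>i. c i *\<^sub>C e i) summable_on I"
proof -
  define f where "f = (\<lambda>i. c i *\<^sub>C e i)"
  define q where "q = (\<lambda>i. (cmod (c i))\<^sup>2)"
  have "\<exists>P. eventually P (finite_subsets_at_top I) \<and>
            (\<forall>F F'. P F \<and> P F' \<longrightarrow> dist (sum f F) (sum f F') < d)" if "d > 0" for d
  proof -
    from that have d2: "(d/2)\<^sup>2 > 0"
      by simp
    have "\<forall>\<^sub>F F in finite_subsets_at_top I. dist (sum q F) (infsum q I) < (d/2)\<^sup>2"
      using infsum_tendsto[OF c] d2 unfolding tendsto_iff q_def by blast
    then obtain F0 where F0: "finite F0" "F0 \<subseteq> I" "dist (sum q F0) (infsum q I) < (d/2)\<^sup>2"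
      unfolding eventually_finite_subsets_at_top by blast
    define P where "P F \<longleftrightarrow> finite F \<and> F0 \<subseteq> F \<and> F \<subseteq> I" for F
    have "eventually P (finite_subsets_at_top I)"
      unfolding eventually_finite_subsets_at_top P_def using F0 by blast
    moreover have near: "norm (sum f F - sum f F0) < d / 2" if "P F" for F
    proof -
      have F: "finite F" "F0 \<subseteq> F" "F \<subseteq> I"
        using that by (auto simp: P_def)
      have "(norm (sum f F - sum f F0))\<^sup>2 = (norm (sum f (F - F0)))\<^sup>2"
        using F F0 by (simp add: sum_diff)
      also have "\<dots> = sum q (F - F0)"
        unfolding f_def q_def using F by (intro norm_orthonormal_sum[OF e]) auto
      also have "\<dots> = sum q F - sum q F0"
        using F F0 by (simp add: sum_diff)
      also have "sum q F \<le> infsum q I"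
        using F c by (intro finite_sum_le_infsum) (auto simp: q_def)
      also have "infsum q I - sum q F0 < (d/2)\<^sup>2"
        using F0 by (simp add: dist_real_def)
      finally have "(norm (sum f F - sum f F0))\<^sup>2 < (d/2)\<^sup>2"
        by simp
      thus ?thesis
        by (rule power_less_imp_less_base) (use \<open>d > 0\<close> in simp)
    qed
    hence "dist (sum f F) (sum f F') < d" if "P F" "P F'" for F F'
      using near[OF that(1)] near[OF that(2)]
        dist_triangle2[of "sum f F" "sum f F'" "sum f F0"] unfolding dist_norm by linarith
    ultimately show ?thesis
      by blast
  qed
  hence "cauchy_filter (filtermap (sum f) (finite_subsets_at_top I))"
    by (simp add: cauchy_filter_metric_filtermap)
  moreover have "complete (UNIV::'b set)"
    by (meson Cauchy_convergent UNIV_I complete_def convergent_def)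
  ultimately obtain L where "(sum f \<longlongrightarrow> L) (finite_subsets_at_top I)"
    using complete_uniform[where S=UNIV] by (force simp add: filterlim_def)
  thus ?thesis
    unfolding f_def using summable_on_def has_sum_def by blast
qed

lemma cinner_orthonormal_has_sum:
  assumes e: "orthonormal e" and s: "((\<lambda>i. c i *\<^sub>C e i) has_sum z) UNIV"
  shows "cinner (e j) z = c j"
proof -
  have "((\<lambda>i. cinner (e j) (c i *\<^sub>C e i)) has_sum cinner (e j) z) UNIV"
    by (rule has_sum_bounded_linear[OF bounded_linear_cinner_right s])
  moreover have "((\<lambda>i. cinner (e j) (c i *\<^sub>C e i)) has_sum c j) UNIV"
    by (rule has_sum_finite_neutralI[where B = "{j}"])
       (auto simp: cinner_scaleC_right orthonormalD[OF e])
  ultimately show ?thesis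
    by (rule has_sum_unique)
qed

lemma norm_orthonormal_has_sum:
  assumes e: "orthonormal e" and s: "((\<lambda>i. c i *\<^sub>C e i) has_sum z) UNIV"
  shows "((\<lambda>i. (cmod (c i))\<^sup>2) has_sum (norm z)\<^sup>2) UNIV"
proof -
  have "((\<lambda>i. cinner z (c i *\<^sub>C e i)) has_sum cinner z z) UNIV"
    by (rule has_sum_bounded_linear[OF bounded_linear_cinner_right s])
  moreover have "cinner z (c i *\<^sub>C e i) = complex_of_real ((cmod (c i))\<^sup>2)" for i
    using cinner_orthonormal_has_sum[OF e s, of i]
    by (metis cinner_commute cinner_scaleC_right complex_norm_square)
  ultimately have "((\<lambda>i. complex_of_real ((cmod (c i))\<^sup>2)) has_sum complex_of_real ((norm z)\<^sup>2)) UNIV"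
    by (simp add: cinner_self)
  thus ?thesis
    using has_sum_of_real_iff by blast
qed


section \<open>Orthogonal projection, the adjoint and orthonormal bases\<close>

lemma parallelogram:
  fixes x y :: "'a::complex_hilbert"
  shows "(norm (x + y))\<^sup>2 + (norm (x - y))\<^sup>2 = 2 * (norm x)\<^sup>2 + 2 * (norm y)\<^sup>2"
  by (simp add: norm_add_sq norm_diff_sq)

text \<open>The parallelogram law makes a distance minimising sequence Cauchy. The minimal difference is
  orthogonal to the subspace, since otherwise subtracting a suitable multiple would shorten it.\<close>

lemma closed_subspace_projection:
  fixes S :: "'a::complex_hilbert set"
  assumes closed: "closed S" and ne: "S \<noteq> {}"
    and add: "\<And>x y. x \<in> S \<Longrightarrow> y \<in> S \<Longrightarrow> x + y \<in> S"
    and sc: "\<And>c x. x \<in> S \<Longrightarrow> c *\<^sub>C x \<in> S"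
  shows "\<exists>y\<in>S. \<forall>z\<in>S. cinner z (x - y) = 0"
proof -
  define d where "d = (INF y\<in>S. norm (x - y))"
  have bdd: "bdd_below ((\<lambda>y. norm (x - y)) ` S)"
    by (rule bdd_belowI[where m = 0]) auto
  have d0: "d \<ge> 0"
    unfolding d_def using ne by (intro cINF_greatest) auto
  have dle: "d \<le> norm (x - y)" if "y \<in> S" for y
    unfolding d_def using that by (intro cINF_lower[OF bdd])
  have "\<exists>y\<in>S. norm (x - y) < d + 1 / real (Suc n)" for n
    using cINF_less_iff[OF ne bdd, of "d + 1 / real (Suc n)"] by (simp add: d_def)
  then obtain Y where Y: "\<And>n. Y n \<in> S" "\<And>n. norm (x - Y n) < d + 1 / real (Suc n)"
    by metis
  have lim: "(\<lambda>n. norm (x - Y n)) \<longlonglongrightarrow> d"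
  proof (rule tendsto_sandwich[of "\<lambda>_. d"])
    show "(\<lambda>n. d + 1 / real (Suc n)) \<longlonglongrightarrow> d"
      using tendsto_add[OF tendsto_const LIMSEQ_Suc[OF lim_1_over_n], of d] by simp
  qed (use dle Y in \<open>auto intro!: always_eventually less_imp_le\<close>)
  have close: "(norm (Y m - Y n))\<^sup>2 \<le> 2 * ((norm (x - Y m))\<^sup>2 - d\<^sup>2) + 2 * ((norm (x - Y n))\<^sup>2 - d\<^sup>2)"
    for m n
  proof -
    have "(1/2) *\<^sub>C (Y m + Y n) \<in> S"
      using Y add sc by blast
    hence "d \<le> norm (x - (1/2) *\<^sub>C (Y m + Y n))"
      by (rule dle)
    moreover have "(x - Y m) + (x - Y n) = 2 *\<^sub>C (x - (1/2) *\<^sub>C (Y m + Y n))"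
      using scaleC_add_left[of 1 1 x]
      by (simp add: scaleC_diff_right scaleC_add_right scaleC_scaleC)
    hence "norm ((x - Y m) + (x - Y n)) = 2 * norm (x - (1/2) *\<^sub>C (Y m + Y n))"
      by simp
    ultimately have "(2 * d)\<^sup>2 \<le> (norm ((x - Y m) + (x - Y n)))\<^sup>2"
      using d0 by (intro power_mono) auto
    thus ?thesis
      using parallelogram[of "x - Y m" "x - Y n"] by (simp add: norm_minus_commute)
  qed
  have "Cauchy Y"
  proof (rule metric_CauchyI)
    fix r :: real assume r: "r > 0"
    have "(\<lambda>n. (norm (x - Y n))\<^sup>2 - d\<^sup>2) \<longlonglongrightarrow> d\<^sup>2 - d\<^sup>2"
      by (intro tendsto_intros lim)
    hence "\<forall>\<^sub>F n in sequentially. (norm (x - Y n))\<^sup>2 - d\<^sup>2 < r\<^sup>2 / 4"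
      using r by (intro order_tendstoD) auto
    then obtain N where N: "\<And>n. n \<ge> N \<Longrightarrow> (norm (x - Y n))\<^sup>2 - d\<^sup>2 < r\<^sup>2 / 4"
      by (auto simp: eventually_sequentially)
    have "dist (Y m) (Y n) < r" if "m \<ge> N" "n \<ge> N" for m n
    proof -
      have "2 * (r\<^sup>2 / 4) + 2 * (r\<^sup>2 / 4) = r\<^sup>2"
        by simp
      hence "(norm (Y m - Y n))\<^sup>2 < r\<^sup>2"
        using close[of m n] N[OF that(1)] N[OF that(2)] by argo
      thus ?thesis
        using r by (simp add: dist_norm power_less_imp_less_base)
    qed
    thus "\<exists>N. \<forall>m\<ge>N. \<forall>n\<ge>N. dist (Y m) (Y n) < r"
      by blast
  qed
  then obtain y where y: "Y \<longlonglongrightarrow> y"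
    using Cauchy_convergent convergent_def by blast
  have yS: "y \<in> S"
    using closed_sequentially[OF closed Y(1) y] .
  have "(\<lambda>n. norm (x - Y n)) \<longlonglongrightarrow> norm (x - y)"
    by (intro tendsto_intros y)
  hence ny: "norm (x - y) = d"
    using lim LIMSEQ_unique by blast
  have "cinner z (x - y) = 0" if z: "z \<in> S" for z
  proof (cases "z = 0")
    case False
    define c where "c = cinner z (x - y) / complex_of_real ((norm z)\<^sup>2)"
    have n: "(norm z)\<^sup>2 > 0"
      using False by simp
    have "y + c *\<^sub>C z \<in> S"
      using add sc yS z by blast
    hence "d\<^sup>2 \<le> (norm (x - (y + c *\<^sub>C z)))\<^sup>2"
      using d0 by (intro power_mono dle)
    also have "x - (y + c *\<^sub>C z) = (x - y) - c *\<^sub>C z"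
      by simp
    also have "(norm ((x - y) - c *\<^sub>C z))\<^sup>2
        = d\<^sup>2 - 2 * Re (c * cinner (x - y) z) + (cmod c)\<^sup>2 * (norm z)\<^sup>2"
      by (simp only: norm_diff_sq cinner_scaleC_right norm_scaleC power_mult_distrib ny)
    also have "c * cinner (x - y) z = complex_of_real ((cmod (cinner z (x - y)))\<^sup>2 / (norm z)\<^sup>2)"
      unfolding c_def
      by (subst cinner_commute[of "x - y" z]) (simp add: complex_norm_square del: of_real_power)
    also have "(cmod c)\<^sup>2 * (norm z)\<^sup>2 = (cmod (cinner z (x - y)))\<^sup>2 / (norm z)\<^sup>2"
      using n by (simp add: c_def norm_divide power_divide power2_eq_square norm_mult field_simps)
    finally have "(cmod (cinner z (x - y)))\<^sup>2 / (norm z)\<^sup>2 \<le> 0"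
      by simp
    thus ?thesis
      using n by (simp add: divide_le_0_iff)
  qed simp
  thus ?thesis
    using yS by blast
qed

text \<open>The representing vector is a multiple of any vector \<open>u\<close> orthogonal to the kernel, because
  subtracting \<open>(f x / f u) *\<^sub>C u\<close> from \<open>x\<close> lands in the kernel.\<close>

lemma Riesz_representation:
  fixes f :: "'a::complex_hilbert \<Rightarrow> complex"
  assumes f: "bounded_linear f" and fC: "\<And>c x. f (c *\<^sub>C x) = c * f x"
  shows "\<exists>z. \<forall>x. f x = cinner z x"
proof (cases "\<forall>x. f x = 0")
  case True
  thus ?thesis
    by (intro exI[of _ 0]) simp
next
  case False
  then obtain x0 where x0: "f x0 \<noteq> 0"
    by blast
  interpret bounded_linear f
    by fact
  define K where "K = {x. f x = 0}"
  have "closed K"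
    unfolding K_def by (intro closed_Collect_eq continuous_on continuous_on_const continuous_on_id)
  then obtain y where y: "y \<in> K" "\<And>z. z \<in> K \<Longrightarrow> cinner z (x0 - y) = 0"
    using closed_subspace_projection[of K x0]
    by (force simp: K_def add fC intro: exI[of _ 0])
  define u where "u = x0 - y"
  have fu: "f u \<noteq> 0"
    using y(1) x0 by (simp add: u_def K_def diff)
  hence u: "u \<noteq> 0"
    using zero by auto
  have "f x = cinner ((cnj (f u) / complex_of_real ((norm u)\<^sup>2)) *\<^sub>C u) x" for x
  proof -
    have "f (x - (f x / f u) *\<^sub>C u) = 0"
      using fu by (simp add: diff fC)
    hence "cinner (x - (f x / f u) *\<^sub>C u) u = 0"
      using y(2) by (auto simp: K_def u_def)
    hence "cinner u (x - (f x / f u) *\<^sub>C u) = 0"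
      by (rule cinner_eq_0_sym)
    hence "cinner u x = f x / f u * complex_of_real ((norm u)\<^sup>2)"
      by (simp add: cinner_simps cinner_self)
    thus ?thesis
      using fu u by (simp add: cinner_simps)
  qed
  thus ?thesis
    by blast
qed

lemma bounded_clinearD:
  assumes "bounded_clinear T"
  shows "bounded_linear T" and "T (c *\<^sub>C x) = c *\<^sub>C T x"
  using assms by (auto simp: bounded_clinear_def)

lemma
  assumes "bounded_clinear T"
  shows bounded_clinear_add: "T (x + y) = T x + T y"
    and bounded_clinear_diff: "T (x - y) = T x - T y"
    and bounded_clinear_zero: "T 0 = 0"
    and bounded_clinear_sum: "T (\<Sum>i\<in>F. f i) = (\<Sum>i\<in>F. T (f i))"
proof -
  interpret bounded_linear T
    using assms by (rule bounded_clinearD)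
  show "T (x + y) = T x + T y" "T (x - y) = T x - T y" "T 0 = 0"
    "T (\<Sum>i\<in>F. f i) = (\<Sum>i\<in>F. T (f i))"
    by (fact add diff zero sum)+
qed

lemma adj_exists:
  assumes T: "bounded_clinear T"
  shows "\<exists>S. \<forall>x y. cinner (S y) x = cinner y (T x)"
proof -
  have "\<exists>z. \<forall>x. cinner y (T x) = cinner z x" for y
  proof (rule Riesz_representation)
    show "bounded_linear (\<lambda>x. cinner y (T x))"
      by (rule bounded_linear_compose[OF bounded_linear_cinner_right bounded_clinearD(1)[OF T]])
  qed (simp add: bounded_clinearD(2)[OF T] cinner_scaleC_right)
  thus ?thesis
    by metis
qed

lemma adj_eqI:
  assumes "\<And>x y. cinner (S y) x = cinner y (T x)"
  shows "adj T = S"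
  unfolding adj_def
proof (rule the_equality)
  fix S' assume S': "\<forall>x y. cinner (S' y) x = cinner y (T x)"
  show "S' = S"
  proof
    fix y
    show "S' y = S y"
    proof (rule cinner_ext)
      fix x
      have "cinner (S' y) x = cinner (S y) x"
        using S' assms by simp
      thus "cinner x (S' y) = cinner x (S y)"
        by (simp add: cinner_commute[of x])
    qed
  qed
qed (use assms in blast)

lemma cinner_adj_left:
  assumes "bounded_clinear T" shows "cinner (adj T y) x = cinner y (T x)"
  using adj_exists[OF assms] adj_eqI by metis

lemma cinner_adj_right:
  assumes "bounded_clinear T" shows "cinner x (adj T y) = cinner (T x) y"
  by (metis assms cinner_adj_left cinner_commute)

lemma bounded_clinear_adj:
  assumes T: "bounded_clinear T" shows "bounded_clinear (adj T)"
proof -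
  obtain K where K: "\<And>x. norm (T x) \<le> norm x * K" "K \<ge> 0"
    using bounded_linear.nonneg_bounded[OF bounded_clinearD(1)[OF T]] by blast
  have C: "adj T (c *\<^sub>C x) = c *\<^sub>C adj T x" for c x
    by (rule cinner_ext) (simp add: cinner_adj_right[OF T] cinner_simps)
  have "bounded_linear (adj T)"
  proof (rule bounded_linear_intro[where K = K])
    show "adj T (x + y) = adj T x + adj T y" for x y
      by (rule cinner_ext) (simp add: cinner_adj_right[OF T] cinner_simps)
    show "adj T (r *\<^sub>R x) = r *\<^sub>R adj T x" for r x
      by (simp add: scaleR_conv_scaleC C)
    show "norm (adj T x) \<le> norm x * K" for x
    proof -
      have "(norm (adj T x))\<^sup>2 = cmod (cinner (adj T x) (adj T x))"
        by (simp add: cinner_self norm_power)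
      also have "\<dots> = cmod (cinner x (T (adj T x)))"
        by (simp add: cinner_adj_left[OF T])
      also have "\<dots> \<le> norm x * (norm (adj T x) * K)"
        by (rule order.trans[OF Cauchy_Schwarz_cinner mult_left_mono[OF K(1)]]) simp
      finally show ?thesis
        using K(2) by (cases "norm (adj T x) = 0") (auto simp: power2_eq_square mult_ac)
    qed
  qed
  thus ?thesis
    by (simp add: bounded_clinear_def C)
qed

lemma closure_cspan_eqI:
  fixes E :: "'a::complex_hilbert set"
  assumes "\<And>x. (\<And>e. e \<in> E \<Longrightarrow> cinner e x = 0) \<Longrightarrow> x = 0"
  shows "closure (cspan E) = UNIV"
proof -
  define S where "S = closure (cspan E)"
  have sub: "cspan E \<subseteq> S" "E \<subseteq> S"
    unfolding S_def using closure_subset complex_vector.span_superset by blast+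
  have "\<exists>y\<in>S. \<forall>z\<in>S. cinner z (x - y) = 0" for x
  proof (rule closed_subspace_projection)
    show "closed S"
      by (simp add: S_def)
    show "S \<noteq> {}"
      using sub complex_vector.span_zero by blast
    show "u + v \<in> S" if uv: "u \<in> S" "v \<in> S" for u v
    proof -
      obtain U V where UV: "\<And>n. U n \<in> cspan E" "\<And>n. V n \<in> cspan E" "U \<longlonglongrightarrow> u" "V \<longlonglongrightarrow> v"
        using uv unfolding S_def closure_sequential by metis
      have "(\<lambda>n. U n + V n) \<longlonglongrightarrow> u + v"
        by (intro tendsto_add UV)
      thus ?thesis
        unfolding S_def closure_sequential using UV
        by (intro exI[of _ "\<lambda>n. U n + V n"]) (auto intro: complex_vector.span_add)
    qed
    show "c *\<^sub>C u \<in> S" if u: "u \<in> S" for c u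
    proof -
      obtain U where U: "\<And>n. U n \<in> cspan E" "U \<longlonglongrightarrow> u"
        using u unfolding S_def closure_sequential by metis
      have "(\<lambda>n. c *\<^sub>C U n) \<longlonglongrightarrow> c *\<^sub>C u"
        by (intro tendsto_scaleC_right U)
      thus ?thesis
        unfolding S_def closure_sequential using U
        by (intro exI[of _ "\<lambda>n. c *\<^sub>C U n"]) (auto intro: complex_vector.span_scale)
    qed
  qed
  hence "x \<in> S" for x
    by (metis assms sub(2) subsetD right_minus_eq)
  thus ?thesis
    by (auto simp: S_def)
qed

text \<open>A maximal orthonormal set, given by Zorn's lemma, has a trivial orthogonal complement, since a
  unit vector in the complement would extend it.\<close>

lemma onb_exists: "\<exists>E :: 'a::complex_hilbert set. onb E"
proof -
  define \<E> where "\<E> = {E :: 'a set. orthonormal_on E (\<lambda>x. x)}"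
  have "\<exists>M\<in>\<E>. \<forall>X\<in>\<E>. M \<subseteq> X \<longrightarrow> X = M"
  proof (rule subset_Zorn_nonempty)
    show "\<E> \<noteq> {}"
      by (auto simp: \<E>_def orthonormal_on_def intro: exI[of _ "{}"])
    fix \<C> assume C: "\<C> \<noteq> {}" "subset.chain \<E> \<C>"
    show "\<Union>\<C> \<in> \<E>"
      unfolding \<E>_def orthonormal_on_def
    proof (intro CollectI ballI)
      fix x y assume "x \<in> \<Union>\<C>" "y \<in> \<Union>\<C>"
      then obtain X Y where XY: "X \<in> \<C>" "Y \<in> \<C>" "x \<in> X" "y \<in> Y"
        by blast
      hence "X \<subseteq> Y \<or> Y \<subseteq> X"
        using C(2) unfolding subset.chain_def by blast
      then obtain Z where "Z \<in> \<C>" "x \<in> Z" "y \<in> Z"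
        using XY by blast
      moreover have "Z \<in> \<E>"
        using C(2) \<open>Z \<in> \<C>\<close> unfolding subset.chain_def by blast
      ultimately show "cinner x y = (if x = y then 1 else 0)"
        unfolding \<E>_def orthonormal_on_def by blast
    qed
  qed
  then obtain M where "M \<in> \<E>" and max: "\<forall>X\<in>\<E>. M \<subseteq> X \<longrightarrow> X = M"
    by (rule bexE)
  hence M: "orthonormal_on M (\<lambda>x. x)"
    by (simp add: \<E>_def)
  have "x = 0" if x: "\<And>e. e \<in> M \<Longrightarrow> cinner e x = 0" for x
  proof (rule ccontr)
    assume "x \<noteq> 0"
    define u where "u = complex_of_real (1 / norm x) *\<^sub>C x"
    have uM: "cinner e u = 0" "cinner u e = 0" if "e \<in> M" for e
      using x[OF that] cinner_eq_0_sym[OF x[OF that]] by (simp_all add: u_def cinner_simps)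
    have uu: "cinner u u = 1"
      using \<open>x \<noteq> 0\<close> by (simp add: u_def cinner_self norm_divide)
    have "u \<notin> M"
      using uM uu by fastforce
    hence "orthonormal_on (insert u M) (\<lambda>x. x)"
      using M uM uu unfolding orthonormal_on_def by (metis insertE)
    hence "insert u M = M"
      using max by (simp add: \<E>_def subset_insertI)
    thus False
      using \<open>u \<notin> M\<close> by blast
  qed
  hence "closure (cspan M) = UNIV"
    by (rule closure_cspan_eqI)
  thus ?thesis
    using M unfolding onb_def orthonormal_on_def by blast
qed

lemma cspan_finite_coefficients:
  assumes "y \<in> cspan E"
  shows "\<exists>F d. finite F \<and> F \<subseteq> E \<and> y = (\<Sum>e\<in>F. d e *\<^sub>C e)"
  using assms unfolding complex_vector.span_explicit by blast

text \<open>Bessel's inequality is one half. For the other half, the Fourier truncation is at least as close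
  to \<open>x\<close> as any other combination of the same basis vectors.\<close>

lemma Parseval:
  assumes E: "onb E"
  shows "(\<Sum>\<^sub>\<infinity>e\<in>E. ennreal ((cmod (cinner e x))\<^sup>2)) = ennreal ((norm x)\<^sup>2)"
proof (rule antisym)
  have oE: "orthonormal_on E (\<lambda>x. x)"
    using E by (simp add: onb_def orthonormal_on_def)
  show "(\<Sum>\<^sub>\<infinity>e\<in>E. ennreal ((cmod (cinner e x))\<^sup>2)) \<le> ennreal ((norm x)\<^sup>2)"
    by (rule infsum_le_finite_sums)
       (auto intro!: ennreal_leI Bessel_finite[OF oE] nonneg_summable_on_complete)
  show "ennreal ((norm x)\<^sup>2) \<le> (\<Sum>\<^sub>\<infinity>e\<in>E. ennreal ((cmod (cinner e x))\<^sup>2))"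
  proof (rule ennreal_le_epsilon)
    fix r :: real assume r: "r > 0"
    have "x \<in> closure (cspan E)"
      using E by (simp add: onb_def)
    then obtain y where y: "y \<in> cspan E" "dist y x < sqrt r"
      using r unfolding closure_approachable by (meson real_sqrt_gt_0_iff)
    obtain F d where F: "finite F" "F \<subseteq> E" "y = (\<Sum>e\<in>F. d e *\<^sub>C e)"
      using cspan_finite_coefficients[OF y(1)] by blast
    define P where "P z = (\<Sum>e\<in>F. cinner e z *\<^sub>C e)" for z
    have Py: "P y = y"
      unfolding P_def F(3)
      using F(1,2) by (intro sum.cong refl arg_cong2[where f = scaleC])
        (subst cinner_orthonormal_sum[OF oE], auto)
    have "x - P x = (x - y) - P (x - y)"
      using Py by (simp add: P_def cinner_diff_right complex_vector.scale_left_diff_distrib sum_subtractf)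
    hence "(norm (x - P x))\<^sup>2 = (norm (x - y))\<^sup>2 - (\<Sum>e\<in>F. (cmod (cinner e (x - y)))\<^sup>2)"
      using norm_residual[OF oE F(1,2), of "x - y"] by (simp only: P_def)
    also have "\<dots> \<le> (norm (x - y))\<^sup>2"
      by (simp add: sum_nonneg)
    also have "\<dots> \<le> (sqrt r)\<^sup>2"
      using y(2) r by (intro power_mono) (auto simp: dist_norm norm_minus_commute)
    finally have "(norm x)\<^sup>2 \<le> (\<Sum>e\<in>F. (cmod (cinner e x))\<^sup>2) + r"
      using norm_residual[OF oE F(1,2), of x] r by (simp add: P_def)
    hence "ennreal ((norm x)\<^sup>2) \<le> ennreal (\<Sum>e\<in>F. (cmod (cinner e x))\<^sup>2) + ennreal r"
      using r by (simp add: ennreal_leI sum_nonneg flip: ennreal_plus)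
    also have "ennreal (\<Sum>e\<in>F. (cmod (cinner e x))\<^sup>2) = (\<Sum>e\<in>F. ennreal ((cmod (cinner e x))\<^sup>2))"
      by simp
    also have "\<dots> \<le> (\<Sum>\<^sub>\<infinity>e\<in>E. ennreal ((cmod (cinner e x))\<^sup>2))"
      using F(1,2) by (rule sum_le_infsum_ennreal)
    finally show "ennreal ((norm x)\<^sup>2) \<le> (\<Sum>\<^sub>\<infinity>e\<in>E. ennreal ((cmod (cinner e x))\<^sup>2)) + ennreal r"
      by (simp add: add_right_mono)
  qed
qed



section \<open>Diagonal operators\<close>

text \<open>The series determines the operator everywhere, in particular it makes it vanish on the
  orthogonal complement of the family \<open>e\<close>, which need not be complete.\<close>

definition diagonal ::
  "('a::complex_hilbert \<Rightarrow> 'a) \<Rightarrow> ('i \<Rightarrow> 'a) \<Rightarrow> ('i \<Rightarrow> real) \<Rightarrow> bool" where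
  "diagonal T e w \<longleftrightarrow> bounded_clinear T \<and> orthonormal e \<and>
     (\<forall>x. ((\<lambda>i. (complex_of_real (w i) * cinner (e i) x) *\<^sub>C e i) has_sum T x) UNIV)"

lemma orthonormal_projection:
  assumes e: "orthonormal e"
  obtains z where "((\<lambda>i. cinner (e i) x *\<^sub>C e i) has_sum z) UNIV"
    and "\<And>i. cinner (e i) (x - z) = 0"
proof -
  have s: "((\<lambda>i. cinner (e i) x *\<^sub>C e i) has_sum (\<Sum>\<^sub>\<infinity>i. cinner (e i) x *\<^sub>C e i)) UNIV"
    by (intro has_sum_infsum orthonormal_summable Bessel_summable e)
  show ?thesis
    by (rule that[OF s]) (simp add: cinner_diff_right cinner_orthonormal_has_sum[OF e s])
qed

lemma norm_weighted_orthonormal_le: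
  assumes e: "orthonormal e"
    and s: "((\<lambda>i. (complex_of_real (w i) * cinner (e i) x) *\<^sub>C e i) has_sum z) UNIV"
    and K: "\<And>i. cinner (e i) x \<noteq> 0 \<Longrightarrow> \<bar>w i\<bar> \<le> K" and K0: "K \<ge> 0"
  shows "norm z \<le> K * norm x"
proof -
  have "(norm z)\<^sup>2 \<le> K\<^sup>2 * (norm x)\<^sup>2"
  proof (rule has_sum_le_finite_sums[OF norm_orthonormal_has_sum[OF e s]])
    fix F :: "'a set" assume F: "finite F" "F \<subseteq> UNIV"
    have "(\<Sum>i\<in>F. (cmod (complex_of_real (w i) * cinner (e i) x))\<^sup>2)
        \<le> (\<Sum>i\<in>F. K\<^sup>2 * (cmod (cinner (e i) x))\<^sup>2)"
    proof (rule sum_mono)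
      fix i
      have "\<bar>w i\<bar> * cmod (cinner (e i) x) \<le> K * cmod (cinner (e i) x)"
        using K[of i] by (cases "cinner (e i) x = 0") (auto intro: mult_right_mono)
      hence "(\<bar>w i\<bar> * cmod (cinner (e i) x))\<^sup>2 \<le> (K * cmod (cinner (e i) x))\<^sup>2"
        by (intro power_mono) auto
      thus "(cmod (complex_of_real (w i) * cinner (e i) x))\<^sup>2 \<le> K\<^sup>2 * (cmod (cinner (e i) x))\<^sup>2"
        by (simp add: norm_mult power_mult_distrib)
    qed
    also have "\<dots> \<le> K\<^sup>2 * (norm x)\<^sup>2"
      using Bessel_finite[OF e F] by (simp add: mult_left_mono flip: sum_distrib_left)
    finally show "(\<Sum>i\<in>F. (cmod (complex_of_real (w i) * cinner (e i) x))\<^sup>2) \<le> K\<^sup>2 * (norm x)\<^sup>2" .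
  qed
  hence "(norm z)\<^sup>2 \<le> (K * norm x)\<^sup>2"
    by (simp add: power_mult_distrib)
  thus ?thesis
    by (rule power2_le_imp_le) (use K0 in simp)
qed

lemma diagonal_exists:
  assumes e: "orthonormal e" and K: "\<And>i. \<bar>w i\<bar> \<le> K"
  shows "\<exists>T. diagonal T e w"
proof -
  define T where "T x = (\<Sum>\<^sub>\<infinity>i. (complex_of_real (w i) * cinner (e i) x) *\<^sub>C e i)" for x
  have K0: "K \<ge> 0"
    using K[of undefined] by linarith
  have s: "((\<lambda>i. (complex_of_real (w i) * cinner (e i) x) *\<^sub>C e i) has_sum T x) UNIV" for x
    unfolding T_def
  proof (intro has_sum_infsum orthonormal_summable[OF e])
    have "(\<lambda>i. K\<^sup>2 * (cmod (cinner (e i) x))\<^sup>2) summable_on UNIV"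
      by (intro summable_on_cmult_right Bessel_summable e)
    moreover have "(cmod (complex_of_real (w i) * cinner (e i) x))\<^sup>2 \<le> K\<^sup>2 * (cmod (cinner (e i) x))\<^sup>2" for i
    proof -
      have "(w i)\<^sup>2 \<le> K\<^sup>2"
        using K[of i] K0 by (simp add: abs_le_square_iff[symmetric])
      thus ?thesis
        by (simp add: norm_mult power_mult_distrib mult_right_mono)
    qed
    ultimately show "(\<lambda>i. (cmod (complex_of_real (w i) * cinner (e i) x))\<^sup>2) summable_on UNIV"
      by (rule summable_on_comparison_test) auto
  qed
  have C: "T (c *\<^sub>C x) = c *\<^sub>C T x" for c x
  proof (rule has_sum_unique[OF s])
    show "((\<lambda>i. (complex_of_real (w i) * cinner (e i) (c *\<^sub>C x)) *\<^sub>C e i) has_sum c *\<^sub>C T x) UNIV"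
      using has_sum_bounded_linear[OF bounded_linear_scaleC_right s, of c x]
      by (simp add: cinner_simps scaleC_scaleC mult_ac)
  qed
  have "bounded_linear T"
  proof (rule bounded_linear_intro[where K = K])
    show "T (x + y) = T x + T y" for x y
    proof (rule has_sum_unique[OF s])
      show "((\<lambda>i. (complex_of_real (w i) * cinner (e i) (x + y)) *\<^sub>C e i) has_sum T x + T y) UNIV"
        using has_sum_add[OF s s, of x y]
        by (simp add: cinner_simps distrib_left scaleC_add_left)
    qed
    show "T (r *\<^sub>R x) = r *\<^sub>R T x" for r x
      by (simp add: scaleR_conv_scaleC C)
    show "norm (T x) \<le> norm x * K" for x
      using norm_weighted_orthonormal_le[OF e s K K0] by (simp add: mult.commute)
  qed
  thus ?thesis
    using C e s unfolding diagonal_def bounded_clinear_def by blast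
qed

lemma diagonalD:
  assumes "diagonal T e w"
  shows "bounded_clinear T" and "orthonormal e"
    and "((\<lambda>i. (complex_of_real (w i) * cinner (e i) x) *\<^sub>C e i) has_sum T x) UNIV"
  using assms unfolding diagonal_def by blast+

lemma diagonal_unique: "diagonal S e w \<Longrightarrow> diagonal T e w \<Longrightarrow> S = T"
  using has_sum_unique diagonalD(3) by blast

lemma diagonal_norm_le:
  assumes "diagonal T e w" and "\<And>i. cinner (e i) x \<noteq> 0 \<Longrightarrow> \<bar>w i\<bar> \<le> K" and "K \<ge> 0"
  shows "norm (T x) \<le> K * norm x"
  by (rule norm_weighted_orthonormal_le[OF diagonalD(2,3)[OF assms(1)] assms(2,3)])

lemma diagonal_cinner:
  "diagonal T e w \<Longrightarrow> cinner (e j) (T x) = complex_of_real (w j) * cinner (e j) x"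
  using cinner_orthonormal_has_sum diagonalD(2,3) by fast

lemma diagonal_eigenvector:
  assumes T: "diagonal T e w"
  shows "T (e j) = complex_of_real (w j) *\<^sub>C e j"
proof (rule has_sum_unique[OF diagonalD(3)[OF T]])
  show "((\<lambda>i. (complex_of_real (w i) * cinner (e i) (e j)) *\<^sub>C e i)
          has_sum complex_of_real (w j) *\<^sub>C e j) UNIV"
    by (rule has_sum_finite_neutralI[where B = "{j}"]) (auto simp: orthonormalD[OF diagonalD(2)[OF T]])
qed

lemma diagonal_kernel:
  assumes T: "diagonal T e w" and x: "\<And>i. cinner (e i) x = 0"
  shows "T x = 0"
  using diagonal_norm_le[OF T, of x 0] x by simp

lemma diagonalI:
  assumes T: "bounded_clinear T" and e: "orthonormal e"
    and ev: "\<And>i. T (e i) = complex_of_real (w i) *\<^sub>C e i"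
    and ker: "\<And>x. (\<And>i. cinner (e i) x = 0) \<Longrightarrow> T x = 0"
  shows "diagonal T e w"
proof -
  have "((\<lambda>i. (complex_of_real (w i) * cinner (e i) x) *\<^sub>C e i) has_sum T x) UNIV" for x
  proof -
    obtain z where z: "((\<lambda>i. cinner (e i) x *\<^sub>C e i) has_sum z) UNIV" "\<And>i. cinner (e i) (x - z) = 0"
      by (rule orthonormal_projection[OF e, where x = x]) blast
    have "((\<lambda>i. T (cinner (e i) x *\<^sub>C e i)) has_sum T z) UNIV"
      by (rule has_sum_bounded_linear[OF bounded_clinearD(1)[OF T] z(1)])
    moreover have "T x = T z"
      using ker[OF z(2)] by (simp add: bounded_clinear_diff[OF T])
    ultimately show ?thesis
      by (simp add: bounded_clinearD(2)[OF T] ev scaleC_scaleC mult.commute)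
  qed
  thus ?thesis
    using T e by (simp add: diagonal_def)
qed

lemma bounded_clinear_compose:
  "bounded_clinear S \<Longrightarrow> bounded_clinear T \<Longrightarrow> bounded_clinear (S \<circ> T)"
  unfolding bounded_clinear_def o_def by (auto intro: bounded_linear_compose)

lemma diagonal_comp:
  assumes S: "diagonal S e v" and T: "diagonal T e w"
  shows "diagonal (S \<circ> T) e (\<lambda>i. v i * w i)"
proof (rule diagonalI)
  show "bounded_clinear (S \<circ> T)"
    using S T by (intro bounded_clinear_compose diagonalD(1))
  show "orthonormal e"
    by (rule diagonalD(2)[OF S])
  show "(S \<circ> T) (e i) = complex_of_real (v i * w i) *\<^sub>C e i" for i
    by (simp add: diagonal_eigenvector[OF T] diagonal_eigenvector[OF S]
        bounded_clinearD(2)[OF diagonalD(1)[OF S]] scaleC_scaleC mult.commute)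
  show "(S \<circ> T) x = 0" if "\<And>i. cinner (e i) x = 0" for x
    using diagonal_kernel[OF T that] by (simp add: bounded_clinear_zero[OF diagonalD(1)[OF S]])
qed

lemma diagonal_quadratic_form:
  assumes T: "diagonal T e w"
  shows "((\<lambda>i. complex_of_real (w i * (cmod (cinner (e i) x))\<^sup>2)) has_sum cinner x (T x)) UNIV"
proof -
  have "((\<lambda>i. cinner x ((complex_of_real (w i) * cinner (e i) x) *\<^sub>C e i)) has_sum cinner x (T x)) UNIV"
    by (rule has_sum_bounded_linear[OF bounded_linear_cinner_right diagonalD(3)[OF T]])
  moreover have "cinner x ((complex_of_real (w i) * cinner (e i) x) *\<^sub>C e i)
      = complex_of_real (w i * (cmod (cinner (e i) x))\<^sup>2)" for i
    using cinner_commute[of x "e i"] complex_norm_square[of "cinner (e i) x"]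
    by (simp add: cinner_scaleC_right mult.assoc)
  ultimately show ?thesis
    by simp
qed

lemma diagonal_Re_quadratic_form:
  assumes T: "diagonal T e w"
  shows "((\<lambda>i. w i * (cmod (cinner (e i) x))\<^sup>2) has_sum Re (cinner x (T x))) UNIV"
  using has_sum_Re[OF diagonal_quadratic_form[OF T]] by simp

lemma diagonal_positive:
  assumes T: "diagonal T e w" and w: "\<And>i. w i \<ge> 0"
  shows "positive_op T"
proof -
  have "cinner x (T x) \<in> \<real>\<^sub>\<ge>\<^sub>0" for x
  proof -
    have "Re (cinner x (T x)) \<ge> 0"
      by (rule has_sum_nonneg[OF diagonal_Re_quadratic_form[OF T]]) (use w in simp)
    moreover have "Im (cinner x (T x)) = 0"
      using has_sum_unique[OF has_sum_Im[OF diagonal_quadratic_form[OF T]]] by simp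
    ultimately show ?thesis
      by (simp add: complex_nonneg_Reals_iff)
  qed
  thus ?thesis
    using diagonalD(1)[OF T] by (simp add: positive_op_def)
qed

lemma compact_coordinate_box:
  fixes e :: "'i \<Rightarrow> 'a::complex_hilbert"
  assumes "finite F"
  shows "\<exists>C. compact C \<and> (\<forall>z. (\<forall>i\<in>F. cmod (z i) \<le> M) \<longrightarrow> (\<Sum>i\<in>F. z i *\<^sub>C e i) \<in> C)"
  using assms
proof induction
  case empty
  show ?case
    by (intro exI[of _ "{0}"]) simp
next
  case (insert j F)
  then obtain C where C: "compact C" "\<And>z. \<forall>i\<in>F. cmod (z i) \<le> M \<Longrightarrow> (\<Sum>i\<in>F. z i *\<^sub>C e i) \<in> C"
    by blast
  define D where "D = (\<lambda>c. c *\<^sub>C e j) ` cball 0 M"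
  have "compact D"
    unfolding D_def
    by (intro compact_continuous_image compact_cball linear_continuous_on bounded_linear_scaleC_left)
  hence "compact {x + y | x y. x \<in> D \<and> y \<in> C}"
    using C(1) by (rule compact_sums)
  moreover have "(\<Sum>i\<in>insert j F. z i *\<^sub>C e i) \<in> {x + y | x y. x \<in> D \<and> y \<in> C}"
    if "\<forall>i\<in>insert j F. cmod (z i) \<le> M" for z
  proof -
    have "z j *\<^sub>C e j \<in> D" "(\<Sum>i\<in>F. z i *\<^sub>C e i) \<in> C"
      using that C(2)[of z] by (auto simp: D_def)
    thus ?thesis
      using insert.hyps by auto
  qed
  ultimately show ?case
    by blast
qed

text \<open>Coefficients vanishing at infinity make a diagonal operator a uniform limit of finite rank
  truncations, hence compact.\<close>

lemma diagonal_compact: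
  fixes e :: "'i \<Rightarrow> 'a::complex_hilbert"
  assumes T: "diagonal T e w" and w: "\<And>r. r > 0 \<Longrightarrow> finite {i. \<bar>w i\<bar> \<ge> r}"
  shows "compact_op T"
proof -
  define B where "B = T ` cball 0 1"
  have e: "orthonormal e" and lin: "bounded_clinear T"
    using T by (auto dest: diagonalD)
  have "\<exists>k. finite k \<and> closure B \<subseteq> (\<Union>x\<in>k. ball x r)" if r: "r > 0" for r
  proof -
    define F where "F = {i. \<bar>w i\<bar> \<ge> r / 3}"
    have F: "finite F"
      unfolding F_def using r by (intro w) simp
    define M where "M = (\<Sum>i\<in>F. \<bar>w i\<bar>)"
    obtain C where C: "compact C" "\<And>z. \<forall>i\<in>F. cmod (z i) \<le> M \<Longrightarrow> (\<Sum>i\<in>F. z i *\<^sub>C e i) \<in> C"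
      using compact_coordinate_box[OF F] by blast
    obtain k where k: "finite k" "C \<subseteq> (\<Union>x\<in>k. ball x (r/3))"
      using C(1) r unfolding compact_eq_totally_bounded by (meson divide_pos_pos zero_less_numeral)
    have "\<exists>x\<in>k. dist x y < 2 * r / 3" if "y \<in> B" for y
    proof -
      from that obtain v where v: "norm v \<le> 1" "y = T v"
        by (auto simp: B_def)
      define u where "u = (\<Sum>i\<in>F. cinner (e i) v *\<^sub>C e i)"
      have Tu: "T u = (\<Sum>i\<in>F. (cinner (e i) v * complex_of_real (w i)) *\<^sub>C e i)"
        by (simp add: u_def bounded_clinear_sum[OF lin] bounded_clinearD(2)[OF lin]
            diagonal_eigenvector[OF T] scaleC_scaleC)
      have "T u \<in> C"
        unfolding Tu
      proof (intro C(2) ballI)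
        fix i assume "i \<in> F"
        have "cmod (cinner (e i) v) \<le> 1"
          using Cauchy_Schwarz_cinner[of "e i" v] v(1) orthonormal_on_norm[OF e, of i] by simp
        moreover have "\<bar>w i\<bar> \<le> M"
          unfolding M_def using F \<open>i \<in> F\<close> by (intro member_le_sum) auto
        ultimately show "cmod (cinner (e i) v * complex_of_real (w i)) \<le> M"
          using mult_mono[of "cmod (cinner (e i) v)" 1 "\<bar>w i\<bar>" M] by (simp add: norm_mult)
      qed
      then obtain x where x: "x \<in> k" "dist x (T u) < r / 3"
        using k(2) by auto
      have "norm (T (v - u)) \<le> r / 3 * norm (v - u)"
      proof (rule diagonal_norm_le[OF T])
        fix i assume "cinner (e i) (v - u) \<noteq> 0"
        hence "i \<notin> F"
          using residual_orthogonal[OF e F] by (auto simp: u_def)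
        thus "\<bar>w i\<bar> \<le> r / 3"
          by (simp add: F_def)
      qed (use r in simp)
      also have "norm (v - u) \<le> 1"
      proof -
        have "(norm (v - u))\<^sup>2 \<le> (norm v)\<^sup>2"
          using norm_residual[OF e F, of v] by (simp add: u_def sum_nonneg)
        hence "norm (v - u) \<le> norm v"
          by (rule power2_le_imp_le) simp
        thus ?thesis
          using v by simp
      qed
      finally have "dist (T u) y \<le> r / 3"
        using r v by (simp add: bounded_clinear_diff[OF lin] dist_norm norm_minus_commute)
      hence "dist x y < 2 * r / 3"
        using x(2) dist_triangle[of x y "T u"] by simp
      thus ?thesis
        using x(1) by blast
    qed
    note near = this
    have "closure B \<subseteq> (\<Union>x\<in>k. ball x r)"
    proof
      fix y assume "y \<in> closure B"
      then obtain b where b: "b \<in> B" "dist b y < r / 3"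
        using r unfolding closure_approachable by (meson divide_pos_pos zero_less_numeral)
      then obtain x where "x \<in> k" "dist x b < 2 * r / 3"
        using near by blast
      thus "y \<in> (\<Union>x\<in>k. ball x r)"
        using b dist_triangle[of x y b] by (intro UN_I[of x]) auto
    qed
    thus ?thesis
      using k(1) by blast
  qed
  moreover have "complete (closure B)"
    by (simp add: complete_eq_closed)
  ultimately have "compact (closure B)"
    unfolding compact_eq_totally_bounded by blast
  thus ?thesis
    using lin by (simp add: compact_op_def B_def)
qed

lemma independent_orthonormal:
  assumes e: "orthonormal_on F e" and F: "finite F"
  shows "complex_vector.independent (e ` F)"
proof (rule complex_vector.independent_if_scalars_zero)
  fix f x assume f: "(\<Sum>y\<in>e ` F. f y *\<^sub>C y) = 0" and "x \<in> e ` F"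
  then obtain j where j: "j \<in> F" "x = e j"
    by blast
  have "(\<Sum>i\<in>F. f (e i) *\<^sub>C e i) = 0"
    using f orthonormal_on_inj[OF e] by (simp add: sum.reindex)
  moreover have "cinner (e j) (\<Sum>i\<in>F. f (e i) *\<^sub>C e i) = f (e j)"
    using j by (simp add: cinner_orthonormal_sum[OF e F])
  ultimately show "f x = 0"
    using j by simp
qed (use F in simp)

lemma cdim_orthonormal_image:
  assumes "orthonormal_on F e" and "finite F"
  shows "cdim (cspan (e ` F)) = card F"
  using complex_vector.dim_span_eq_card_independent[OF independent_orthonormal[OF assms]]
    card_image[OF orthonormal_on_inj[OF assms(1)]] by simp

lemma eigenspace_diagonal:
  assumes T: "diagonal T e w" and l: "l \<noteq> 0" and F: "finite {i. w i = l}"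
  shows "eigenspace T (complex_of_real l) = cspan (e ` {i. w i = l})"
proof (intro equalityI subsetI)
  have e: "orthonormal e" and lin: "bounded_clinear T"
    using T by (auto dest: diagonalD)
  fix x
  {
    assume x: "x \<in> eigenspace T (complex_of_real l)"
    have "cinner (e i) x = 0" if "w i \<noteq> l" for i
    proof -
      have "complex_of_real (w i) * cinner (e i) x = complex_of_real l * cinner (e i) x"
        using x by (simp add: eigenspace_def cinner_scaleC_right flip: diagonal_cinner[OF T])
      thus ?thesis
        using that by simp
    qed
    hence "((\<lambda>i. (complex_of_real (w i) * cinner (e i) x) *\<^sub>C e i)
        has_sum (\<Sum>i\<in>{i. w i = l}. (complex_of_real (w i) * cinner (e i) x) *\<^sub>C e i)) UNIV"
      by (intro has_sum_finite_neutralI) (use F in auto)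
    hence "T x = (\<Sum>i\<in>{i. w i = l}. (complex_of_real (w i) * cinner (e i) x) *\<^sub>C e i)"
      using has_sum_unique diagonalD(3)[OF T] by blast
    also have "\<dots> \<in> cspan (e ` {i. w i = l})"
      by (intro complex_vector.span_sum complex_vector.span_scale complex_vector.span_base) auto
    finally have "complex_of_real l *\<^sub>C x \<in> cspan (e ` {i. w i = l})"
      using x by (simp add: eigenspace_def)
    hence "inverse (complex_of_real l) *\<^sub>C complex_of_real l *\<^sub>C x \<in> cspan (e ` {i. w i = l})"
      by (rule complex_vector.span_scale)
    thus "x \<in> cspan (e ` {i. w i = l})"
      using l by (simp add: scaleC_scaleC)
  next
    assume "x \<in> cspan (e ` {i. w i = l})"
    thus "x \<in> eigenspace T (complex_of_real l)"
    proof (induction rule: complex_vector.span_induct_alt)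
      case base
      show ?case
        by (simp add: eigenspace_def bounded_clinear_zero[OF lin])
    next
      case (step c x y)
      thus ?case
        by (auto simp: eigenspace_def bounded_clinear_add[OF lin] bounded_clinearD(2)[OF lin]
            diagonal_eigenvector[OF T] scaleC_add_right scaleC_scaleC mult.commute)
    qed
  }
qed

lemma cdim_eigenspace_diagonal:
  assumes "diagonal T e w" and "l \<noteq> 0" and "finite {i. w i = l}"
  shows "cdim (eigenspace T (complex_of_real l)) = card {i. w i = l}"
  using assms cdim_orthonormal_image[OF orthonormal_on_subset[OF diagonalD(2)[OF assms(1)]]]
  by (simp add: eigenspace_diagonal)


section \<open>Positive operators, powers and traces\<close>

lemma positive_opD:
  assumes "positive_op T"
  shows "bounded_clinear T" and "Re (cinner x (T x)) \<ge> 0" and "Im (cinner x (T x)) = 0"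
  using assms by (auto simp: positive_op_def complex_nonneg_Reals_iff)

text \<open>Polarisation: the defect \<open>D\<close> is sesquilinear and vanishes on the diagonal, and evaluating it at
  \<open>x + y\<close> and \<open>x + \<i> y\<close> makes it vanish altogether.\<close>

lemma positive_op_selfadjoint:
  assumes T: "positive_op T"
  shows "cinner (T x) y = cinner x (T y)"
proof -
  define D where "D x y = cinner x (T y) - cinner (T x) y" for x y
  have lin: "bounded_clinear T"
    by (rule positive_opD[OF T])
  have D0: "D x x = 0" for x
    using positive_opD(3)[OF T, of x] cinner_commute[of "T x" x]
    by (simp add: D_def complex_eq_iff)
  have "D (x + y) (x + y) = D x x + D x y + D y x + D y y"
    by (simp add: D_def bounded_clinear_add[OF lin] cinner_simps)
  hence 1: "D x y + D y x = 0"
    using D0 by simp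
  have "D (x + \<i> *\<^sub>C y) (x + \<i> *\<^sub>C y) = D x x + \<i> * D x y - \<i> * D y x + D y y"
    by (simp add: D_def bounded_clinear_add[OF lin] bounded_clinearD(2)[OF lin] cinner_simps
        algebra_simps flip: mult.assoc)
  hence "\<i> * (D x y - D y x) = 0"
    using D0 by (simp add: algebra_simps)
  hence "D x y = 0"
    using 1 by simp
  thus ?thesis
    by (simp add: D_def)
qed

lemma adj_positive: "positive_op T \<Longrightarrow> adj T = T"
  by (rule adj_eqI) (rule positive_op_selfadjoint)

text \<open>Uniqueness of the positive square root: on an eigenvector \<open>e i\<close> of \<open>P\<close> the factorisation
  \<open>(Q + s i) (Q - s i) e i = 0\<close> forces \<open>Q e i = s i e i\<close>, since \<open>Q + s i\<close> is injective for
  \<open>s i > 0\<close>.\<close>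

lemma positive_sqrt_unique:
  assumes P: "diagonal P e s" and s: "\<And>i. s i \<ge> 0" and Q: "positive_op Q" and QP: "Q \<circ> Q = P \<circ> P"
  shows "Q = P"
proof -
  have lin: "bounded_clinear Q" and linP: "bounded_clinear P"
    using positive_opD[OF Q] diagonalD[OF P] by auto
  have QP': "Q (Q x) = P (P x)" for x
    using QP by (metis comp_apply)
  have ker: "Q x = 0" if "P x = 0" for x
  proof -
    have "cinner (Q x) (Q x) = cinner x (P (P x))"
      by (simp add: positive_op_selfadjoint[OF Q] QP')
    thus ?thesis
      using that by (simp add: bounded_clinear_zero[OF linP])
  qed
  have "diagonal Q e s"
  proof (rule diagonalI[OF lin])
    show "orthonormal e"
      by (rule diagonalD[OF P])
    show "Q x = 0" if "\<And>i. cinner (e i) x = 0" for x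
      using that by (intro ker diagonal_kernel[OF P])
    show "Q (e i) = complex_of_real (s i) *\<^sub>C e i" for i
    proof (cases "s i = 0")
      case True
      thus ?thesis
        using ker[of "e i"] by (simp add: diagonal_eigenvector[OF P])
    next
      case False
      hence si: "s i > 0"
        using s[of i] by simp
      define u where "u = Q (e i) - complex_of_real (s i) *\<^sub>C e i"
      have "Q u = - (complex_of_real (s i) *\<^sub>C u)"
        by (simp add: u_def bounded_clinear_diff[OF lin] bounded_clinearD(2)[OF lin] QP'
            diagonal_eigenvector[OF P] bounded_clinearD(2)[OF linP] scaleC_diff_right scaleC_scaleC)
      hence "Re (cinner u (Q u)) = - (s i * (norm u)\<^sup>2)"
        by (simp add: cinner_minus_right cinner_scaleC_right cinner_self del: of_real_power)
      hence "s i * (norm u)\<^sup>2 \<le> 0"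
        using positive_opD(2)[OF Q, of u] by linarith
      hence "u = 0"
        using si by (simp add: mult_le_0_iff)
      thus ?thesis
        by (simp add: u_def)
    qed
  qed
  thus ?thesis
    using P by (rule diagonal_unique)
qed

lemma abs_op_eqI:
  assumes P: "diagonal P e s" and s: "\<And>i. s i \<ge> 0" and PT: "P \<circ> P = adj T \<circ> T"
  shows "abs_op T = P"
  unfolding abs_op_def
proof (rule the_equality)
  show "positive_op P \<and> P \<circ> P = adj T \<circ> T"
    using diagonal_positive[OF P s] PT by simp
  show "Q = P" if "positive_op Q \<and> Q \<circ> Q = adj T \<circ> T" for Q
    using that PT by (intro positive_sqrt_unique[OF P s]) auto
qed

lemma abs_op_diagonal: "diagonal T e w \<Longrightarrow> (\<And>i. w i \<ge> 0) \<Longrightarrow> abs_op T = T"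
  by (rule abs_op_eqI) (auto simp: adj_positive diagonal_positive)

text \<open>The conditions on eigenvectors that define the power fix it on every \<open>e i\<close> and on the orthogonal
  complement of the family, which lies in the kernel of \<open>B\<close>.\<close>

lemma op_powr_diagonal:
  assumes B: "diagonal B e w" and w: "\<And>i. w i \<ge> 0" "\<And>i. w i \<le> K" and p: "p > 0"
  shows "diagonal (op_powr B p) e (\<lambda>i. w i powr p)"
proof -
  have e: "orthonormal e" and linB: "bounded_clinear B"
    using B by (auto dest: diagonalD)
  have "\<bar>w i powr p\<bar> \<le> K powr p" for i
    using w p by (auto intro: powr_mono2)
  then obtain T where T: "diagonal T e (\<lambda>i. w i powr p)"
    using diagonal_exists[OF e, of "\<lambda>i. w i powr p"] by blast
  have "op_powr B p = T"
    unfolding op_powr_def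
  proof (rule the_equality, intro conjI allI impI ballI)
    show "bounded_clinear T"
      by (rule diagonalD[OF T])
    fix l x assume l: "(0::real) \<le> l" and x: "x \<in> eigenspace B (complex_of_real l)"
    have eq: "complex_of_real (w i) * cinner (e i) x = complex_of_real l * cinner (e i) x" for i
      using x by (simp add: eigenspace_def cinner_scaleC_right flip: diagonal_cinner[OF B])
    have coeff: "w i = l \<or> cinner (e i) x = 0" for i
      using eq[of i] by auto
    show "T x = complex_of_real (l powr p) *\<^sub>C x"
    proof (cases "l = 0")
      case True
      \<comment> \<open>A kernel vector has components only where \<open>w i = 0\<close>, and \<open>0 powr p = 0\<close>.\<close>
      have "norm (T x) \<le> 0 * norm x"
        by (rule diagonal_norm_le[OF T]) (use coeff True p in force)+
      thus ?thesis
        using True p by simp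
    next
      case False
      have "((\<lambda>i. (complex_of_real l powr (-1) * complex_of_real (l powr p)) *\<^sub>C
              ((complex_of_real (w i) * cinner (e i) x) *\<^sub>C e i))
            has_sum (complex_of_real l powr (-1) * complex_of_real (l powr p)) *\<^sub>C B x) UNIV"
        by (rule has_sum_bounded_linear[OF bounded_linear_scaleC_right diagonalD(3)[OF B]])
      moreover have "(complex_of_real l powr (-1) * complex_of_real (l powr p)) *\<^sub>C
              ((complex_of_real (w i) * cinner (e i) x) *\<^sub>C e i)
           = (complex_of_real (w i powr p) * cinner (e i) x) *\<^sub>C e i" for i
        using coeff[of i] False by (auto simp: scaleC_scaleC powr_minus field_simps)
      moreover have "(complex_of_real l powr (-1) * complex_of_real (l powr p)) *\<^sub>C B x
          = complex_of_real (l powr p) *\<^sub>C x"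
        using x False by (simp add: eigenspace_def scaleC_scaleC powr_minus)
      ultimately show ?thesis
        by (intro has_sum_unique[OF diagonalD(3)[OF T]]) (simp only:)
    qed
  next
    fix S assume S: "bounded_clinear S \<and>
      (\<forall>l\<ge>0. \<forall>x\<in>eigenspace B (complex_of_real l). S x = complex_of_real (l powr p) *\<^sub>C x)"
    have "diagonal S e (\<lambda>i. w i powr p)"
    proof (rule diagonalI)
      show "S (e i) = complex_of_real (w i powr p) *\<^sub>C e i" for i
        using S w diagonal_eigenvector[OF B, of i] by (simp add: eigenspace_def)
      show "S x = 0" if "\<And>i. cinner (e i) x = 0" for x
      proof -
        have "x \<in> eigenspace B (complex_of_real 0)"
          using diagonal_kernel[OF B that] by (simp add: eigenspace_def)
        hence "S x = complex_of_real (0 powr p) *\<^sub>C x"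
          using S by blast
        thus ?thesis
          by simp
      qed
    qed (use S e in auto)
    thus "S = T"
      using T by (rule diagonal_unique)
  qed
  thus ?thesis
    using T by simp
qed

text \<open>Expanding the quadratic forms and exchanging the sums reduces the trace to Parseval's identity
  for each \<open>e i\<close>, whatever basis the definition picks.\<close>

lemma op_trace_diagonal:
  fixes e :: "'i \<Rightarrow> 'a::complex_hilbert"
  assumes T: "diagonal T e w" and w: "\<And>i. w i \<ge> 0"
  shows "op_trace T = (\<Sum>\<^sub>\<infinity>i. ennreal (w i))"
proof -
  define E :: "'a set" where "E = (SOME E. onb E)"
  have E: "onb E"
    unfolding E_def using onb_exists by (rule someI_ex)
  have "op_trace T = (\<Sum>\<^sub>\<infinity>b\<in>E. ennreal (Re (cinner b (T b))))"
    by (simp add: op_trace_def E_def)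
  also have "\<dots> = (\<Sum>\<^sub>\<infinity>b\<in>E. \<Sum>\<^sub>\<infinity>i. ennreal (w i * (cmod (cinner (e i) b))\<^sup>2))"
    by (intro infsum_cong infsum_ennreal_has_sum[symmetric] diagonal_Re_quadratic_form[OF T])
       (simp add: w)
  also have "\<dots> = (\<Sum>\<^sub>\<infinity>i. \<Sum>\<^sub>\<infinity>b\<in>E. ennreal (w i * (cmod (cinner (e i) b))\<^sup>2))"
    by (rule infsum_swap_ennreal)
  also have "\<dots> = (\<Sum>\<^sub>\<infinity>i. ennreal (w i))"
  proof (rule infsum_cong)
    fix i
    have "(\<Sum>\<^sub>\<infinity>b\<in>E. ennreal (w i * (cmod (cinner (e i) b))\<^sup>2))
        = (\<Sum>\<^sub>\<infinity>b\<in>E. ennreal (w i) * ennreal ((cmod (cinner b (e i)))\<^sup>2))"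
      using w by (intro infsum_cong) (simp add: ennreal_mult cinner_commute[of "e i"])
    also have "\<dots> = ennreal (w i) * ennreal ((norm (e i))\<^sup>2)"
      by (simp only: infsum_cmult_ennreal Parseval[OF E])
    also have "norm (e i) = 1"
      by (rule orthonormal_on_norm[OF diagonalD(2)[OF T]]) simp
    finally show "(\<Sum>\<^sub>\<infinity>b\<in>E. ennreal (w i * (cmod (cinner (e i) b))\<^sup>2)) = ennreal (w i)"
      by simp
  qed
  finally show ?thesis .
qed



section \<open>Singular value decomposition\<close>

lemma compact_opD:
  assumes "compact_op T"
  shows "bounded_clinear T" and "compact (closure (T ` cball 0 1))"
  using assms by (auto simp: compact_op_def)

lemma compact_op_subsequence:
  assumes T: "compact_op T" and X: "\<And>n::nat. norm (X n) \<le> 1"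
  obtains y r where "strict_mono r" and "(\<lambda>n. T (X (r n))) \<longlonglongrightarrow> y"
proof -
  have "\<forall>n. (T \<circ> X) n \<in> closure (T ` cball 0 1)"
    using X by (auto intro!: closure_subset[THEN subsetD])
  then obtain y r where "strict_mono r" "((T \<circ> X) \<circ> r) \<longlonglongrightarrow> y"
    using compact_opD(2)[OF T] unfolding compact_def by blast
  thus ?thesis
    by (intro that[of r y]) (simp_all add: o_def)
qed

text \<open>A maximising sequence for \<open>norm (T x)\<close> consists of approximate eigenvectors of \<open>adj T \<circ> T\<close> by
  the estimate \<open>approx\<close> below, and compactness then makes a subsequence converge to an eigenvector.\<close>

lemma norm_attained_at_eigenvector:
  fixes T :: "'a::complex_hilbert \<Rightarrow> 'b::complex_hilbert"
  assumes T: "compact_op T" and M: "closed M"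
    and sc: "\<And>c x. x \<in> M \<Longrightarrow> c *\<^sub>C x \<in> M"
    and inv: "\<And>x. x \<in> M \<Longrightarrow> adj T (T x) \<in> M"
    and u: "u \<in> M" "norm u = 1"
  shows "\<exists>v\<in>M. norm v = 1 \<and> (\<forall>x\<in>M. norm (T x) \<le> norm (T v) * norm x) \<and>
           adj T (T v) = complex_of_real ((norm (T v))\<^sup>2) *\<^sub>C v"
proof -
  have lin: "bounded_clinear T"
    by (rule compact_opD[OF T])
  have linS: "bounded_clinear (adj T)"
    by (rule bounded_clinear_adj[OF lin])
  obtain K where K: "\<And>x. norm (T x) \<le> norm x * K"
    using bounded_linear.nonneg_bounded[OF bounded_clinearD(1)[OF lin]] by blast
  define U where "U = {x \<in> M. norm x = 1}"
  define s where "s = (SUP x\<in>U. norm (T x))"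
  have bdd: "bdd_above ((\<lambda>x. norm (T x)) ` U)"
    by (rule bdd_aboveI[where M = K]) (use K in \<open>auto simp: U_def, metis mult_1\<close>)
  have U: "U \<noteq> {}"
    using u by (auto simp: U_def)
  have s1: "norm (T x) \<le> s" if "x \<in> U" for x
    unfolding s_def using that by (intro cSUP_upper[OF _ bdd])
  have s0: "s \<ge> 0"
    using s1[of u] u by (auto simp: U_def intro: order.trans[OF norm_ge_zero])
  have sle: "norm (T x) \<le> s * norm x" if "x \<in> M" for x
  proof (cases "x = 0")
    case True
    thus ?thesis
      by (simp add: bounded_clinear_zero[OF lin])
  next
    case False
    hence "complex_of_real (1 / norm x) *\<^sub>C x \<in> U"
      using sc[OF that] by (simp add: U_def norm_divide)
    hence "norm (complex_of_real (1 / norm x) *\<^sub>C T x) \<le> s"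
      using s1 bounded_clinearD(2)[OF lin] by metis
    thus ?thesis
      using False by (simp add: norm_divide field_simps)
  qed
  have approx: "(norm (adj T (T v) - complex_of_real (s\<^sup>2) *\<^sub>C v))\<^sup>2 \<le> s\<^sup>2 * (s\<^sup>2 - (norm (T v))\<^sup>2)"
    if "v \<in> U" for v
  proof -
    have v: "v \<in> M" "norm v = 1"
      using that by (auto simp: U_def)
    define y where "y = adj T (T v)"
    have "(norm y)\<^sup>2 = cmod (cinner y y)"
      by (simp add: cinner_self norm_power)
    also have "cinner y y = cinner (T v) (T y)"
      using cinner_adj_left[OF lin] by (simp add: y_def)
    also have "cmod (cinner (T v) (T y)) \<le> norm (T v) * norm (T y)"
      by (rule Cauchy_Schwarz_cinner)
    also have "\<dots> \<le> norm (T v) * (s * norm y)"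
      using sle[OF inv[OF v(1)]] by (intro mult_left_mono) (auto simp: y_def)
    finally have "norm y \<le> s * norm (T v)"
      using s0 by (cases "norm y = 0") (auto simp: power2_eq_square mult_ac)
    hence "(norm y)\<^sup>2 \<le> (s * norm (T v))\<^sup>2"
      by (intro power_mono) auto
    moreover have "cinner y v = complex_of_real ((norm (T v))\<^sup>2)"
      using cinner_adj_left[OF lin] by (simp add: y_def cinner_self)
    hence "Re (cinner y (complex_of_real (s\<^sup>2) *\<^sub>C v)) = s\<^sup>2 * (norm (T v))\<^sup>2"
      by (simp add: cinner_scaleC_right flip: of_real_power)
    moreover have "(norm (complex_of_real (s\<^sup>2) *\<^sub>C v))\<^sup>2 = s\<^sup>2 * s\<^sup>2"
      using v by (simp add: power2_eq_square norm_mult)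
    ultimately show ?thesis
      unfolding y_def[symmetric] norm_diff_sq by (simp add: power_mult_distrib algebra_simps)
  qed
  show ?thesis
  proof (cases "s = 0")
    case True
    hence "T x = 0" if "x \<in> M" for x
      using sle[OF that] by simp
    thus ?thesis
      using u bounded_clinear_zero[OF linS] by (intro bexI[of _ u]) auto
  next
    case False
    hence s: "s > 0"
      using s0 by simp
    have "\<exists>x\<in>U. s - 1 / real (Suc n) < norm (T x)" for n
      using less_cSUP_iff[OF U bdd, of "s - 1 / real (Suc n)"] by (simp add: s_def)
    then obtain X where X: "\<And>n. X n \<in> U" "\<And>n. s - 1 / real (Suc n) < norm (T (X n))"
      by metis
    have "(\<lambda>n. norm (T (X n))) \<longlonglongrightarrow> s"
    proof (rule tendsto_sandwich[of "\<lambda>n. s - 1 / real (Suc n)" _ _ "\<lambda>_. s"])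
      show "(\<lambda>n. s - 1 / real (Suc n)) \<longlonglongrightarrow> s"
        using tendsto_diff[OF tendsto_const LIMSEQ_Suc[OF lim_1_over_n], of s] by simp
    qed (use X s1 in \<open>auto intro!: always_eventually less_imp_le\<close>)
    moreover obtain y r where r: "strict_mono r" "(\<lambda>n. T (X (r n))) \<longlonglongrightarrow> y"
      by (rule compact_op_subsequence[OF T, of X]) (use X(1) in \<open>auto simp: U_def\<close>)
    ultimately have lim: "(\<lambda>n. norm (T (X (r n)))) \<longlonglongrightarrow> s"
      using LIMSEQ_subseq_LIMSEQ[of "\<lambda>n. norm (T (X n))" s r] by (simp add: o_def)
    define d where "d n = adj T (T (X (r n))) - complex_of_real (s\<^sup>2) *\<^sub>C X (r n)" for n
    have "(\<lambda>n. s\<^sup>2 * (s\<^sup>2 - (norm (T (X (r n))))\<^sup>2)) \<longlonglongrightarrow> s\<^sup>2 * (s\<^sup>2 - s\<^sup>2)"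
      by (intro tendsto_intros lim)
    hence bound: "(\<lambda>n. s\<^sup>2 * (s\<^sup>2 - (norm (T (X (r n))))\<^sup>2)) \<longlonglongrightarrow> 0"
      by simp
    have "(\<lambda>n. (norm (d n))\<^sup>2) \<longlonglongrightarrow> 0"
    proof (rule tendsto_sandwich[OF _ _ tendsto_const bound])
      show "\<forall>\<^sub>F n in sequentially. 0 \<le> (norm (d n))\<^sup>2"
        by simp
      show "\<forall>\<^sub>F n in sequentially. (norm (d n))\<^sup>2 \<le> s\<^sup>2 * (s\<^sup>2 - (norm (T (X (r n))))\<^sup>2)"
        unfolding d_def by (intro always_eventually allI approx X)
    qed
    hence "(\<lambda>n. sqrt ((norm (d n))\<^sup>2)) \<longlonglongrightarrow> sqrt 0"
      by (rule tendsto_real_sqrt)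
    hence d: "d \<longlonglongrightarrow> 0"
      by (simp add: tendsto_norm_zero_iff)
    have "(\<lambda>n. adj T (T (X (r n)))) \<longlonglongrightarrow> adj T y"
      by (rule bounded_linear.tendsto[OF bounded_clinearD(1)[OF linS] r(2)])
    hence "(\<lambda>n. complex_of_real (1 / s\<^sup>2) *\<^sub>C (adj T (T (X (r n))) - d n))
        \<longlonglongrightarrow> complex_of_real (1 / s\<^sup>2) *\<^sub>C (adj T y - 0)"
      by (intro tendsto_scaleC_right tendsto_diff d)
    moreover have "complex_of_real (1 / s\<^sup>2) *\<^sub>C (adj T (T (X (r n))) - d n) = X (r n)" for n
      using s by (simp add: d_def scaleC_scaleC flip: of_real_mult of_real_power)
    ultimately obtain v where v: "(\<lambda>n. X (r n)) \<longlonglongrightarrow> v"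
      by auto
    have "v \<in> M"
      by (rule closed_sequentially[OF M _ v]) (use X in \<open>auto simp: U_def\<close>)
    have "(\<lambda>n. norm (X (r n))) \<longlonglongrightarrow> norm v"
      by (intro tendsto_intros v)
    moreover have "norm (X (r n)) = 1" for n
      using X by (auto simp: U_def)
    ultimately have nv: "norm v = 1"
      using LIMSEQ_unique[OF _ tendsto_const] by auto
    have "(\<lambda>n. norm (T (X (r n)))) \<longlonglongrightarrow> norm (T v)"
      by (intro tendsto_norm bounded_linear.tendsto[OF bounded_clinearD(1)[OF lin] v])
    hence Tv: "norm (T v) = s"
      using lim LIMSEQ_unique by blast
    have "v \<in> U"
      using \<open>v \<in> M\<close> nv by (simp add: U_def)
    hence "adj T (T v) = complex_of_real (s\<^sup>2) *\<^sub>C v"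
      using approx[of v] Tv by simp
    thus ?thesis
      using \<open>v \<in> M\<close> nv Tv sle by blast
  qed
qed

lemma unit_vector_orthogonal_to_finite:
  fixes e :: "nat \<Rightarrow> 'a::complex_hilbert"
  assumes inf: "\<not> (\<exists>F :: 'a set. finite F \<and> cspan F = UNIV)" and e: "orthonormal_on {..<n} e"
  shows "\<exists>u. norm u = 1 \<and> (\<forall>i<n. cinner (e i) u = 0)"
proof -
  obtain x where x: "x \<notin> cspan (e ` {..<n})"
    using inf by (metis UNIV_eq_I finite_imageI finite_lessThan)
  define y where "y = x - (\<Sum>i<n. cinner (e i) x *\<^sub>C e i)"
  have "(\<Sum>i<n. cinner (e i) x *\<^sub>C e i) \<in> cspan (e ` {..<n})"
    by (intro complex_vector.span_sum complex_vector.span_scale complex_vector.span_base) auto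
  hence "y \<noteq> 0"
    using x by (auto simp: y_def)
  moreover have "cinner (e i) y = 0" if "i < n" for i
    unfolding y_def using that by (intro residual_orthogonal[OF e]) auto
  ultimately show ?thesis
    by (intro exI[of _ "complex_of_real (1 / norm y) *\<^sub>C y"])
       (auto simp: norm_divide cinner_scaleC_right)
qed

text \<open>Each vector maximises \<open>norm (T x)\<close> among the unit vectors orthogonal to its predecessors. This
  orthogonal complement is invariant under \<open>adj T \<circ> T\<close> since the predecessors are eigenvectors.\<close>

lemma greedy_singular_vectors:
  fixes T :: "'a::complex_hilbert \<Rightarrow> 'b::complex_hilbert"
  assumes inf: "\<not> (\<exists>F :: 'a set. finite F \<and> cspan F = UNIV)" and T: "compact_op T"
  obtains e :: "nat \<Rightarrow> 'a" where "orthonormal e"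
    and "\<And>n. adj T (T (e n)) = complex_of_real ((norm (T (e n)))\<^sup>2) *\<^sub>C e n"
    and "\<And>n x. (\<And>i. i < n \<Longrightarrow> cinner (e i) x = 0) \<Longrightarrow> norm (T x) \<le> norm (T (e n)) * norm x"
proof -
  have lin: "bounded_clinear T"
    by (rule compact_opD[OF T])
  define P where "P f n r \<longleftrightarrow> norm r = 1 \<and> (\<forall>i<n. cinner (f i) r = 0) \<and>
      (\<forall>x. (\<forall>i<n. cinner (f i) x = 0) \<longrightarrow> norm (T x) \<le> norm (T r) * norm x) \<and>
      adj T (T r) = complex_of_real ((norm (T r))\<^sup>2) *\<^sub>C r" for f :: "nat \<Rightarrow> 'a" and n :: nat and r
  have "\<exists>f. \<forall>n. P f n (f n)"
  proof (rule dependent_wellorder_choice)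
    show "P f n r = P g n r" if "\<And>y. y < n \<Longrightarrow> f y = g y" for r f g n
      using that by (simp add: P_def)
    fix n :: nat and f :: "nat \<Rightarrow> 'a" assume f: "\<And>y. y < n \<Longrightarrow> P f y (f y)"
    have on: "orthonormal_on {..<n} f"
      by (rule orthonormal_onI_less) (use f in \<open>simp_all add: P_def\<close>)
    obtain u where u: "norm u = 1" "\<forall>i<n. cinner (f i) u = 0"
      using unit_vector_orthogonal_to_finite[OF inf on] by blast
    define M where "M = {x. \<forall>i<n. cinner (f i) x = 0}"
    have "M = (\<Inter>i\<in>{..<n}. {x. cinner (f i) x = 0})"
      by (auto simp: M_def)
    moreover have "closed {x. cinner (f i) x = 0}" for i
      by (intro closed_Collect_eq linear_continuous_on bounded_linear_cinner_right continuous_on_const)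
    ultimately have "closed M"
      by auto
    moreover have "adj T (T x) \<in> M" if "x \<in> M" for x
      unfolding M_def
    proof (intro CollectI allI impI)
      fix i assume "i < n"
      have "cinner (f i) (adj T (T x)) = cinner (adj T (T (f i))) x"
        by (simp add: cinner_adj_left[OF lin] cinner_adj_right[OF lin])
      also have "\<dots> = 0"
        using f[OF \<open>i < n\<close>] that \<open>i < n\<close> by (simp add: P_def M_def cinner_scaleC_left)
      finally show "cinner (f i) (adj T (T x)) = 0" .
    qed
    moreover have "c *\<^sub>C x \<in> M" if "x \<in> M" for c x
      using that by (simp add: M_def cinner_scaleC_right)
    moreover have "u \<in> M"
      using u by (simp add: M_def)
    ultimately have "\<exists>v\<in>M. norm v = 1 \<and> (\<forall>x\<in>M. norm (T x) \<le> norm (T v) * norm x) \<and>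
           adj T (T v) = complex_of_real ((norm (T v))\<^sup>2) *\<^sub>C v"
      using u(1) by (intro norm_attained_at_eigenvector[OF T, of M u])
    thus "\<exists>r. P f n r"
      unfolding P_def M_def by blast
  qed
  then obtain e where e: "\<And>n. P e n (e n)"
    by blast
  have "orthonormal e"
    by (rule orthonormal_onI_less) (use e in \<open>simp_all add: P_def\<close>)
  thus ?thesis
    by (rule that) (use e in \<open>simp_all add: P_def\<close>)
qed

lemma tendsto_0_finite_ge:
  fixes s :: "nat \<Rightarrow> real"
  assumes "s \<longlonglongrightarrow> 0" and "r > 0"
  shows "finite {k. s k \<ge> r}"
proof -
  have "\<forall>\<^sub>F k in sequentially. s k < r"
    using assms by (intro order_tendstoD)
  then obtain N where "\<And>k. k \<ge> N \<Longrightarrow> s k < r"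
    by (auto simp: eventually_sequentially)
  hence "{k. s k \<ge> r} \<subseteq> {..<N}"
    by (force simp: not_less[symmetric])
  thus ?thesis
    using finite_subset by blast
qed

lemma tendsto_0_finite_eq:
  fixes s :: "nat \<Rightarrow> real"
  assumes "s \<longlonglongrightarrow> 0" and "r > 0"
  shows "finite {k. s k = r}"
  by (rule finite_subset[OF _ tendsto_0_finite_ge[OF assms]]) auto

text \<open>At the first index where the sequences differ, the larger of the two values is attained more
  often by the sequence that has it there, since the other one has already dropped below it.\<close>

lemma decseq_card_unique:
  fixes s s' :: "nat \<Rightarrow> real"
  assumes s: "decseq s" "s \<longlonglongrightarrow> 0" and s': "decseq s'" "s' \<longlonglongrightarrow> 0"
    and card: "\<And>l. l > 0 \<Longrightarrow> card {k. s k = l} = card {k. s' k = l}"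
  shows "s = s'"
proof -

  have no_drop: False
    if s: "decseq s" "s \<longlonglongrightarrow> 0" and s': "decseq s'" "s' \<longlonglongrightarrow> 0"
      and card: "\<And>l. l > 0 \<Longrightarrow> card {k. s k = l} = card {k. s' k = l}"
      and IH: "\<And>m. m < n \<Longrightarrow> s m = s' m" and lt: "s n < s' n" for s s' :: "nat \<Rightarrow> real" and n
  proof -
    have "s n \<ge> 0"
      using s decseq_ge by blast
    hence l: "s' n > 0"
      using lt by simp
    have "{k. s k = s' n} \<subset> {k. s' k = s' n}"
    proof
      have "k < n" if "s k = s' n" for k
        using that lt decseqD[OF s(1), of n k] by (cases "k < n") auto
      thus "{k. s k = s' n} \<subseteq> {k. s' k = s' n}"
        using IH by fastforce
      have "n \<in> {k. s' k = s' n}" "n \<notin> {k. s k = s' n}"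
        using lt by auto
      thus "{k. s k = s' n} \<noteq> {k. s' k = s' n}"
        by blast
    qed
    hence "card {k. s k = s' n} < card {k. s' k = s' n}"
      by (intro psubset_card_mono tendsto_0_finite_eq s' l)
    thus False
      using card[OF l] by simp
  qed
  have "s n = s' n" for n
  proof (induction n rule: less_induct)
    case (less n)
    have "\<not> s n < s' n"
      using no_drop[OF s s' card less.IH] by blast
    moreover have "\<not> s' n < s n"
      using no_drop[OF s' s card[symmetric] less.IH[symmetric]] by blast
    ultimately show ?case
      by simp
  qed
  thus ?thesis
    by blast
qed

lemma sing_val_eqI:
  assumes "decseq s" and "s \<longlonglongrightarrow> 0"
    and "\<And>l. l > 0 \<Longrightarrow> card {k. s k = l} = cdim (eigenspace (abs_op T) (complex_of_real l))"
  shows "sing_val T = s"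
  unfolding sing_val_def
proof (rule the_equality)
  show "s' = s" if "decseq s' \<and> s' \<longlonglongrightarrow> 0 \<and>
    (\<forall>l>0. card {k. s' k = l} = cdim (eigenspace (abs_op T) (complex_of_real l)))" for s'
    using that assms by (intro decseq_card_unique) auto
qed (use assms in blast)

text \<open>The greedy maxima decrease. They tend to \<open>0\<close> because the vectors \<open>T (e n)\<close> are pairwise
  orthogonal, so that a positive lower bound on their norms would exclude convergent subsequences. The
  diagonal operator with these coefficients squares to \<open>adj T \<circ> T\<close> and hence is \<open>abs_op T\<close>, which
  identifies the maxima with the singular values.\<close>

lemma singular_value_decomposition:
  fixes T :: "'a::complex_hilbert \<Rightarrow> 'b::complex_hilbert"
  assumes inf: "\<not> (\<exists>F :: 'a set. finite F \<and> cspan F = UNIV)" and T: "compact_op T"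
  obtains e :: "nat \<Rightarrow> 'a" where "orthonormal e"
    and "decseq (sing_val T)" and "sing_val T \<longlonglongrightarrow> 0"
    and "\<And>n. adj T (T (e n)) = complex_of_real ((sing_val T n)\<^sup>2) *\<^sub>C e n"
    and "\<And>n x. (\<And>i. i < n \<Longrightarrow> cinner (e i) x = 0) \<Longrightarrow> norm (T x) \<le> sing_val T n * norm x"
    and "diagonal (abs_op T) e (sing_val T)" and "abs_op T \<circ> abs_op T = adj T \<circ> T"
proof -
  obtain e :: "nat \<Rightarrow> 'a" where e: "orthonormal e"
    and ev: "\<And>n. adj T (T (e n)) = complex_of_real ((norm (T (e n)))\<^sup>2) *\<^sub>C e n"
    and max: "\<And>n x. (\<And>i. i < n \<Longrightarrow> cinner (e i) x = 0) \<Longrightarrow> norm (T x) \<le> norm (T (e n)) * norm x"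
    using greedy_singular_vectors[OF inf T] by blast
  have lin: "bounded_clinear T"
    by (rule compact_opD[OF T])
  define s where "s n = norm (T (e n))" for n
  have ne: "norm (e n) = 1" for n
    using orthonormal_on_norm[OF e] by simp
  have dec: "decseq s"
  proof (rule decseq_SucI)
    fix n
    show "s (Suc n) \<le> s n"
      using max[of n "e (Suc n)"] by (simp add: s_def ne orthonormalD[OF e])
  qed
  have lim: "s \<longlonglongrightarrow> 0"
  proof -
    have bdd: "bdd_below (range s)"
      by (rule bdd_belowI[where m = 0]) (auto simp: s_def)
    define L where "L = (INF n. s n)"
    have L: "s \<longlonglongrightarrow> L"
      unfolding L_def by (rule LIMSEQ_decseq_INF[OF bdd dec])
    have Ls: "L \<le> s n" for n
      unfolding L_def by (intro cINF_lower[OF bdd]) simp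
    have L0: "L \<ge> 0"
      unfolding L_def by (intro cINF_greatest) (auto simp: s_def)
    have "L = 0"
    proof (rule ccontr)
      assume "L \<noteq> 0"
      hence Lpos: "L > 0"
        using L0 by simp
      obtain y r where r: "strict_mono r" "(\<lambda>n. T (e (r n))) \<longlonglongrightarrow> y"
        by (rule compact_op_subsequence[OF T, of e]) (auto simp: ne)
      have "Cauchy (\<lambda>n. T (e (r n)))"
        using r(2) convergent_Cauchy convergentI by blast
      then obtain N where N: "\<And>m n. m \<ge> N \<Longrightarrow> n \<ge> N \<Longrightarrow> norm (T (e (r m)) - T (e (r n))) < L"
        using Lpos unfolding Cauchy_iff by blast
      have rr: "r N \<noteq> r (Suc N)"
        using r(1) by (metis lessI nat_neq_iff strict_monoD)
      have "cinner (T (e (r N))) (T (e (r (Suc N)))) = cinner (adj T (T (e (r N)))) (e (r (Suc N)))"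
        by (simp add: cinner_adj_left[OF lin])
      also have "\<dots> = 0"
        using rr by (simp add: ev cinner_scaleC_left orthonormalD[OF e])
      finally have "(norm (T (e (r N)) - T (e (r (Suc N)))))\<^sup>2 = (s (r N))\<^sup>2 + (s (r (Suc N)))\<^sup>2"
        by (simp add: norm_diff_sq s_def)
      moreover have "L\<^sup>2 \<le> (s (r N))\<^sup>2"
        using Ls L0 by (intro power_mono)
      ultimately have "L\<^sup>2 \<le> (norm (T (e (r N)) - T (e (r (Suc N)))))\<^sup>2"
        by (smt (verit) zero_le_power2)
      hence "L \<le> norm (T (e (r N)) - T (e (r (Suc N))))"
        by (rule power2_le_imp_le) simp
      thus False
        using N[of N "Suc N"] by simp
    qed
    thus ?thesis
      using L by simp
  qed
  have s0: "s n \<ge> 0" for n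
    by (simp add: s_def)
  have "\<bar>s n\<bar> \<le> s 0" for n
    using decseqD[OF dec, of 0 n] s0 by simp
  then obtain P where P: "diagonal P e s"
    using diagonal_exists[OF e, of s] by blast
  have "diagonal (adj T \<circ> T) e (\<lambda>n. s n * s n)"
  proof (rule diagonalI)
    show "bounded_clinear (adj T \<circ> T)"
      by (intro bounded_clinear_compose bounded_clinear_adj lin)
    show "(adj T \<circ> T) (e n) = complex_of_real (s n * s n) *\<^sub>C e n" for n
      by (simp add: ev s_def power2_eq_square)
    show "(adj T \<circ> T) x = 0" if "\<And>i. cinner (e i) x = 0" for x
    proof -
      have "norm (T x) \<le> s n * norm x" for n
        unfolding s_def by (rule max) (rule that)
      moreover have "(\<lambda>n. s n * norm x) \<longlonglongrightarrow> 0 * norm x"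
        by (intro tendsto_intros lim)
      ultimately have "norm (T x) \<le> 0 * norm x"
        by (intro LIMSEQ_le_const[of "\<lambda>n. s n * norm x"]) auto
      thus ?thesis
        by (simp add: bounded_clinear_zero[OF bounded_clinear_adj[OF lin]])
    qed
  qed (rule e)
  hence PT: "P \<circ> P = adj T \<circ> T"
    using diagonal_comp[OF P P] diagonal_unique by blast
  hence abs: "abs_op T = P"
    by (rule abs_op_eqI[OF P s0])
  have "sing_val T = s"
  proof (rule sing_val_eqI[OF dec lim])
    fix l :: real assume l: "l > 0"
    have "finite {k. s k = l}"
      by (rule tendsto_0_finite_eq[OF lim l])
    thus "card {k. s k = l} = cdim (eigenspace (abs_op T) (complex_of_real l))"
      using l by (simp add: abs cdim_eigenspace_diagonal[OF P])
  qed
  thus ?thesis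
    using that[of e] e dec lim ev max P PT abs by (simp add: s_def)
qed

lemma
  fixes T :: "'a::complex_hilbert \<Rightarrow> 'b::complex_hilbert"
  assumes "\<not> (\<exists>F :: 'a set. finite F \<and> cspan F = UNIV)" and "compact_op T"
  shows decseq_sing_val: "decseq (sing_val T)"
    and sing_val_tendsto_0: "sing_val T \<longlonglongrightarrow> 0"
    and sing_val_nonneg: "sing_val T n \<ge> 0"
    and norm_le_sing_val_0: "norm (T x) \<le> sing_val T 0 * norm x"
  by (rule singular_value_decomposition[OF assms]; auto intro: decseq_ge)+

lemma positive_compact_diagonal:
  fixes T :: "'a::complex_hilbert \<Rightarrow> 'a"
  assumes inf: "\<not> (\<exists>F :: 'a set. finite F \<and> cspan F = UNIV)"
    and T: "compact_op T" "positive_op T"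
  obtains e :: "nat \<Rightarrow> 'a" where "diagonal T e (sing_val T)"
proof -
  obtain e :: "nat \<Rightarrow> 'a" where P: "diagonal (abs_op T) e (sing_val T)"
    and PT: "abs_op T \<circ> abs_op T = adj T \<circ> T"
    by (rule singular_value_decomposition[OF inf T(1)]) blast
  have "T \<circ> T = abs_op T \<circ> abs_op T"
    by (simp add: PT adj_positive[OF T(2)])
  hence "T = abs_op T"
    using positive_sqrt_unique[OF P sing_val_nonneg[OF inf T(1)] T(2)] by blast
  thus ?thesis
    using P that by metis
qed


section \<open>The minimax principle for singular values\<close>

text \<open>Gaussian elimination, with a pivot taken from the last equation.\<close>

lemma homogeneous_system:
  fixes a :: "nat \<Rightarrow> 'i \<Rightarrow> complex"
  assumes "finite F" and "card F > m"
  shows "\<exists>z. (\<exists>i\<in>F. z i \<noteq> 0) \<and> (\<forall>j<m. (\<Sum>i\<in>F. a j i * z i) = 0)"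
  using assms
proof (induction m arbitrary: a F)
  case 0
  then obtain i where "i \<in> F"
    by fastforce
  thus ?case
    by (intro exI[of _ "\<lambda>_. 1"]) auto
next
  case (Suc m)
  show ?case
  proof (cases "\<forall>i\<in>F. a m i = 0")
    case True
    obtain z where "\<exists>i\<in>F. z i \<noteq> 0" "\<forall>j<m. (\<Sum>i\<in>F. a j i * z i) = 0"
      using Suc.IH[of F a] Suc.prems by auto
    thus ?thesis
      using True by (intro exI[of _ z]) (auto simp: less_Suc_eq)
  next
    case False
    then obtain p where p: "p \<in> F" "a m p \<noteq> 0"
      by blast
    define G where "G = F - {p}"
    have F: "F = insert p G" and G: "finite G" "p \<notin> G" "card G > m"
      using p Suc.prems by (auto simp: G_def)
    obtain z where z: "\<exists>i\<in>G. z i \<noteq> 0"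
      "\<forall>j<m. (\<Sum>i\<in>G. (a j i - a j p * a m i / a m p) * z i) = 0"
      using Suc.IH[OF G(1,3), of "\<lambda>j i. a j i - a j p * a m i / a m p"] by blast
    define c where "c = - (\<Sum>i\<in>G. a m i * z i) / a m p"
    define z' where "z' = z(p := c)"
    have S: "(\<Sum>i\<in>F. a j i * z' i) = a j p * c + (\<Sum>i\<in>G. a j i * z i)" for j
    proof -
      have "(\<Sum>i\<in>G. a j i * z' i) = (\<Sum>i\<in>G. a j i * z i)"
        using G by (intro sum.cong) (auto simp: z'_def)
      thus ?thesis
        using G by (simp add: F z'_def)
    qed
    have "(\<Sum>i\<in>F. a j i * z' i) = 0" if "j < Suc m" for j
    proof (cases "j = m")
      case True
      thus ?thesis
        using p by (simp add: S c_def)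
    next
      case False
      hence "(\<Sum>i\<in>G. (a j i - a j p * a m i / a m p) * z i) = 0"
        using z that by simp
      moreover have "(\<Sum>i\<in>G. (a j i - a j p * a m i / a m p) * z i)
          = (\<Sum>i\<in>G. a j i * z i) - a j p / a m p * (\<Sum>i\<in>G. a m i * z i)"
        by (simp add: sum_distrib_left left_diff_distrib sum_subtractf mult.assoc)
      ultimately show ?thesis
        by (simp add: S c_def)
    qed
    moreover have "\<exists>i\<in>F. z' i \<noteq> 0"
      using z(1) G by (auto simp: F z'_def)
    ultimately show ?thesis
      by blast
  qed
qed

text \<open>The span of the first \<open>n + 1\<close> singular vectors contains a nonzero vector orthogonal to
  \<open>v 0, \<dots>, v (n - 1)\<close>, and on this span \<open>T\<close> stretches by at least \<open>sing_val T n\<close>. Together with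
  the tail bound in the decomposition above, where the singular vectors serve as \<open>v\<close>, this is the
  minimax principle.\<close>

lemma sing_val_le:
  fixes T :: "'a::complex_hilbert \<Rightarrow> 'b::complex_hilbert"
  assumes inf: "\<not> (\<exists>F :: 'a set. finite F \<and> cspan F = UNIV)" and T: "compact_op T"
    and v: "\<And>x. (\<And>i. i < n \<Longrightarrow> cinner (v i) x = 0) \<Longrightarrow> norm (T x) \<le> c * norm x"
  shows "sing_val T n \<le> c"
proof -
  define s where "s = sing_val T"
  obtain e :: "nat \<Rightarrow> 'a" where e: "orthonormal e" and dec: "decseq s"
    and ev: "\<And>n. adj T (T (e n)) = complex_of_real ((s n)\<^sup>2) *\<^sub>C e n"
    using singular_value_decomposition[OF inf T] unfolding s_def by metis
  have lin: "bounded_clinear T"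
    by (rule compact_opD[OF T])
  have s0: "s i \<ge> 0" for i
    unfolding s_def by (rule sing_val_nonneg[OF inf T])
  obtain z where z: "\<exists>i\<in>{..n}. z i \<noteq> 0" "\<forall>j<n. (\<Sum>i\<in>{..n}. cinner (v j) (e i) * z i) = 0"
    using homogeneous_system[of "{..n}" n "\<lambda>j i. cinner (v j) (e i)"] by auto
  define x where "x = (\<Sum>i\<le>n. z i *\<^sub>C e i)"
  have coeff: "cinner (e i) x = z i" if "i \<le> n" for i
    using that by (simp add: x_def cinner_orthonormal_sum[OF e])
  have nx: "(norm x)\<^sup>2 = (\<Sum>i\<le>n. (cmod (z i))\<^sup>2)"
    unfolding x_def by (rule norm_orthonormal_sum[OF e]) auto
  have "x \<noteq> 0"
    using z(1) coeff by fastforce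
  have "cinner (v j) x = 0" if "j < n" for j
    using z(2) that by (simp add: x_def cinner_sum_right cinner_scaleC_right mult.commute)
  hence "norm (T x) \<le> c * norm x"
    by (rule v)
  have "adj T (T x) = (\<Sum>i\<le>n. (z i * complex_of_real ((s i)\<^sup>2)) *\<^sub>C e i)"
    by (simp add: x_def bounded_clinear_sum[OF lin] bounded_clinearD(2)[OF lin] ev scaleC_scaleC
        bounded_clinear_sum[OF bounded_clinear_adj[OF lin]]
        bounded_clinearD(2)[OF bounded_clinear_adj[OF lin]])
  hence "cinner x (adj T (T x)) = (\<Sum>i\<le>n. z i * complex_of_real ((s i)\<^sup>2) * cinner x (e i))"
    by (simp add: cinner_sum_right cinner_scaleC_right)
  also have "\<dots> = (\<Sum>i\<le>n. complex_of_real ((s i)\<^sup>2 * (cmod (z i))\<^sup>2))"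
  proof (rule sum.cong)
    fix i assume "i \<in> {..n}"
    hence "cinner x (e i) = cnj (z i)"
      using coeff[of i] cinner_commute[of x "e i"] by simp
    thus "z i * complex_of_real ((s i)\<^sup>2) * cinner x (e i) = complex_of_real ((s i)\<^sup>2 * (cmod (z i))\<^sup>2)"
      by (simp add: complex_norm_square mult_ac flip: of_real_power)
  qed simp
  finally have "complex_of_real ((norm (T x))\<^sup>2) = complex_of_real (\<Sum>i\<le>n. (s i)\<^sup>2 * (cmod (z i))\<^sup>2)"
    by (simp add: cinner_adj_right[OF lin] cinner_self)
  hence "(norm (T x))\<^sup>2 = (\<Sum>i\<le>n. (s i)\<^sup>2 * (cmod (z i))\<^sup>2)"
    using of_real_eq_iff by blast
  also have "\<dots> \<ge> (\<Sum>i\<le>n. (s n)\<^sup>2 * (cmod (z i))\<^sup>2)"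
    using s0 decseqD[OF dec] by (intro sum_mono mult_right_mono power_mono) auto
  finally have "(s n * norm x)\<^sup>2 \<le> (norm (T x))\<^sup>2"
    by (simp add: nx power_mult_distrib sum_distrib_left)
  hence "s n * norm x \<le> norm (T x)"
    by (rule power2_le_imp_le) simp
  hence "s n * norm x \<le> c * norm x"
    using \<open>norm (T x) \<le> c * norm x\<close> by linarith
  thus ?thesis
    using \<open>x \<noteq> 0\<close> by (simp add: s_def)
qed

text \<open>Ky Fan's inequality, in a form that covers both sums and differences.\<close>

lemma sing_val_add_le:
  fixes X :: "'a::complex_hilbert \<Rightarrow> 'b::complex_hilbert" and Y :: "'a \<Rightarrow> 'c::complex_hilbert"
    and Z :: "'a \<Rightarrow> 'd::complex_hilbert"
  assumes inf: "\<not> (\<exists>F :: 'a set. finite F \<and> cspan F = UNIV)"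
    and cpt: "compact_op X" "compact_op Y" "compact_op Z"
    and le: "\<And>x. norm (Z x) \<le> norm (X x) + norm (Y x)"
  shows "sing_val Z (m + n) \<le> sing_val X m + sing_val Y n"
proof -
  obtain e :: "nat \<Rightarrow> 'a"
    where e: "\<And>n x. (\<And>i. i < n \<Longrightarrow> cinner (e i) x = 0) \<Longrightarrow> norm (X x) \<le> sing_val X n * norm x"
    by (rule singular_value_decomposition[OF inf cpt(1)]) blast
  obtain f :: "nat \<Rightarrow> 'a"
    where f: "\<And>n x. (\<And>i. i < n \<Longrightarrow> cinner (f i) x = 0) \<Longrightarrow> norm (Y x) \<le> sing_val Y n * norm x"
    by (rule singular_value_decomposition[OF inf cpt(2)]) blast
  show ?thesis
  proof (rule sing_val_le[OF inf cpt(3)])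
    fix x assume x: "\<And>i. i < m + n \<Longrightarrow> cinner (if i < m then e i else f (i - m)) x = 0"
    have "norm (X x) \<le> sing_val X m * norm x"
    proof (rule e)
      fix i assume "i < m"
      thus "cinner (e i) x = 0"
        using x[of i] by simp
    qed
    moreover have "norm (Y x) \<le> sing_val Y n * norm x"
    proof (rule f)
      fix i assume "i < n"
      thus "cinner (f i) x = 0"
        using x[of "m + i"] by simp
    qed
    ultimately show "norm (Z x) \<le> (sing_val X m + sing_val Y n) * norm x"
      using le[of x] by (simp add: distrib_right)
  qed
qed

lemma sing_val_perturbation:
  fixes X :: "'a::complex_hilbert \<Rightarrow> 'b::complex_hilbert" and Z :: "'a \<Rightarrow> 'c::complex_hilbert"
  assumes inf: "\<not> (\<exists>F :: 'a set. finite F \<and> cspan F = UNIV)"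
    and cpt: "compact_op X" "compact_op Z"
    and le: "\<And>x. norm (Z x) \<le> norm (X x) + c * norm x"
  shows "sing_val Z n \<le> sing_val X n + c"
proof -
  obtain e :: "nat \<Rightarrow> 'a"
    where e: "\<And>n x. (\<And>i. i < n \<Longrightarrow> cinner (e i) x = 0) \<Longrightarrow> norm (X x) \<le> sing_val X n * norm x"
    by (rule singular_value_decomposition[OF inf cpt(1)]) blast
  show ?thesis
  proof (rule sing_val_le[OF inf cpt(2)])
    fix x assume "\<And>i. i < n \<Longrightarrow> cinner (e i) x = 0"
    hence "norm (X x) \<le> sing_val X n * norm x"
      by (rule e)
    thus "norm (Z x) \<le> (sing_val X n + c) * norm x"
      using le[of x] by (simp add: distrib_right)
  qed
qed

text \<open>The nonzero singular values of a positive diagonal operator are its nonzero coefficients,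
  because both sequences count the dimensions of the same eigenspaces.\<close>

lemma infsum_sing_val_diagonal:
  fixes e :: "'i \<Rightarrow> 'a::complex_hilbert" and \<phi> :: "real \<Rightarrow> ennreal"
  assumes inf: "\<not> (\<exists>F :: 'a set. finite F \<and> cspan F = UNIV)"
    and T: "diagonal T e w" and w: "\<And>i. w i \<ge> 0"
    and fin: "\<And>r. r > 0 \<Longrightarrow> finite {i. \<bar>w i\<bar> \<ge> r}" and \<phi>: "\<phi> 0 = 0"
  shows "(\<Sum>\<^sub>\<infinity>k. \<phi> (sing_val T k)) = (\<Sum>\<^sub>\<infinity>i. \<phi> (w i))"
proof -
  define s where "s = sing_val T"
  have cpt: "compact_op T"
    by (rule diagonal_compact[OF T fin])
  have s: "s k \<ge> 0" for k
    unfolding s_def by (rule sing_val_nonneg[OF inf cpt])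
  have abs: "abs_op T = T"
    by (rule abs_op_diagonal[OF T w])
  obtain f :: "nat \<Rightarrow> 'a" where f: "diagonal T f s"
    using positive_compact_diagonal[OF inf cpt diagonal_positive[OF T w]] unfolding s_def by blast
  have "\<exists>g. bij_betw g {i. w i = l} {k. s k = l}" if l: "l > 0" for l
  proof (rule finite_same_card_bij)
    show fw: "finite {i. w i = l}"
      by (rule finite_subset[OF _ fin[OF l]]) auto
    show fs: "finite {k. s k = l}"
      unfolding s_def by (rule tendsto_0_finite_eq[OF sing_val_tendsto_0[OF inf cpt] l])
    show "card {i. w i = l} = card {k. s k = l}"
      using cdim_eigenspace_diagonal[OF T _ fw] cdim_eigenspace_diagonal[OF f _ fs] l by simp
  qed
  then obtain g where g: "\<And>l. l > 0 \<Longrightarrow> bij_betw (g l) {i. w i = l} {k. s k = l}"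
    by metis
  define \<pi> where "\<pi> i = g (w i) i" for i
  have s\<pi>: "s (\<pi> i) = w i" if "w i > 0" for i
    using bij_betwE[OF g[OF that]] by (auto simp: \<pi>_def)
  have bij: "bij_betw \<pi> {i. w i > 0} {k. s k > 0}"
    unfolding bij_betw_def
  proof (intro conjI inj_onI equalityI subsetI)
    fix i j assume ij: "i \<in> {i. w i > 0}" "j \<in> {i. w i > 0}" "\<pi> i = \<pi> j"
    hence "w i = w j"
      using s\<pi> by (metis mem_Collect_eq)
    thus "i = j"
      using ij g[of "w i"] by (auto simp: \<pi>_def bij_betw_def inj_on_def)
  next
    fix k assume k: "k \<in> {k. s k > 0}"
    have "k \<in> g (s k) ` {i. w i = s k}"
      using bij_betw_imp_surj_on[OF g[of "s k"]] k by simp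
    then obtain i where i: "k = g (s k) i" "i \<in> {i. w i = s k}"
      by (rule imageE)
    show "k \<in> \<pi> ` {i. w i > 0}"
    proof (rule image_eqI)
      show "k = \<pi> i"
        using i by (simp add: \<pi>_def)
      show "i \<in> {i. w i > 0}"
        using i k by simp
    qed
  qed (use s\<pi> in auto)
  have s_zero: "\<phi> (s k) = 0" if "\<not> s k > 0" for k
  proof -
    have "s k = 0"
      using s[of k] that by linarith
    thus ?thesis
      by (simp add: \<phi>)
  qed
  have w_zero: "\<phi> (w i) = 0" if "\<not> w i > 0" for i
  proof -
    have "w i = 0"
      using w[of i] that by linarith
    thus ?thesis
      by (simp add: \<phi>)
  qed
  have "(\<Sum>\<^sub>\<infinity>k. \<phi> (s k)) = (\<Sum>\<^sub>\<infinity>k\<in>{k. s k > 0}. \<phi> (s k))"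
    using s_zero by (intro infsum_cong_neutral) auto
  also have "\<dots> = (\<Sum>\<^sub>\<infinity>i\<in>{i. w i > 0}. \<phi> (s (\<pi> i)))"
    by (rule infsum_reindex_bij_betw[OF bij, symmetric])
  also have "\<dots> = (\<Sum>\<^sub>\<infinity>i. \<phi> (w i))"
    using w_zero s\<pi> by (intro infsum_cong_neutral) auto
  finally show ?thesis
    by (simp add: s_def)
qed



section \<open>Submajorization\<close>

text \<open>Abel summation: a decreasing nonnegative weight preserves the positivity of partial sums.\<close>

lemma weighted_partial_sums:
  fixes w d :: "nat \<Rightarrow> real"
  assumes w: "decseq w" "\<And>k. w k \<ge> 0" and d: "\<And>n. (\<Sum>k\<le>n. d k) \<ge> 0"
  shows "(\<Sum>k\<le>n. w k * d k) \<ge> w n * (\<Sum>k\<le>n. d k)"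
proof (induction n)
  case (Suc n)
  have "w (Suc n) * (\<Sum>k\<le>n. d k) \<le> w n * (\<Sum>k\<le>n. d k)"
    using decseqD[OF w(1), of n "Suc n"] d by (intro mult_right_mono) auto
  thus ?case
    using Suc by (simp add: distrib_left)
qed simp

lemma weighted_submajorization:
  fixes w x y :: "nat \<Rightarrow> real"
  assumes w: "decseq w" "\<And>k. w k \<ge> 0" and le: "\<And>n. (\<Sum>k\<le>n. x k) \<le> (\<Sum>k\<le>n. y k)"
  shows "(\<Sum>k\<le>n. w k * x k) \<le> (\<Sum>k\<le>n. w k * y k)"
proof -
  have "0 \<le> w n * (\<Sum>k\<le>n. y k - x k)"
    using w(2) le by (simp add: sum_subtractf)
  also have "\<dots> \<le> (\<Sum>k\<le>n. w k * (y k - x k))"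
    using le by (intro weighted_partial_sums[OF w]) (simp add: sum_subtractf)
  finally show ?thesis
    by (simp add: right_diff_distrib sum_subtractf)
qed

text \<open>Convexity of \<open>x powr p\<close>, from Young's inequality for \<open>y\<close> and \<open>x powr (p - 1)\<close>.\<close>

lemma powr_tangent:
  fixes x y p :: real
  assumes p: "p > 1" and xy: "x \<ge> 0" "y \<ge> 0"
  shows "x powr p + p * x powr (p - 1) * (y - x) \<le> y powr p"
proof -
  define q where "q = p / (p - 1)"
  have q: "q > 1" "1 / p + 1 / q = 1" "(p - 1) * q = p"
    using p by (auto simp: q_def field_simps)
  have "y * x powr (p - 1) \<le> y powr p / p + (x powr (p - 1)) powr q / q"
    using xy by (intro Youngs_inequality p q) auto
  also have "(x powr (p - 1)) powr q = x powr p"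
    by (simp add: powr_powr q)
  finally have "p * (y * x powr (p - 1)) \<le> p * (y powr p / p + x powr p / q)"
    using p by (intro mult_left_mono) auto
  also have "\<dots> = y powr p + (p - 1) * x powr p"
    using p by (simp add: q_def field_simps)
  finally have "p * x powr (p - 1) * y \<le> y powr p + (p - 1) * x powr p"
    by (simp add: mult_ac)
  moreover have "x powr p = x powr (p - 1) * x"
    using xy by (cases "x = 0") (simp_all add: powr_diff)
  ultimately show ?thesis
    by (simp add: algebra_simps)
qed

lemma sum_powr_submajorization:
  fixes x y :: "nat \<Rightarrow> real"
  assumes x: "decseq x" "\<And>k. x k \<ge> 0" and y: "\<And>k. y k \<ge> 0"
    and le: "\<And>n. (\<Sum>k\<le>n. x k) \<le> (\<Sum>k\<le>n. y k)" and p: "p > 1"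
  shows "(\<Sum>k\<le>n. x k powr p) \<le> (\<Sum>k\<le>n. y k powr p)"
proof -
  have w: "decseq (\<lambda>k. p * x k powr (p - 1))"
    using x p by (auto simp: decseq_def intro!: mult_left_mono powr_mono2)
  have "(\<Sum>k\<le>n. x k powr p + p * x k powr (p - 1) * (y k - x k)) \<le> (\<Sum>k\<le>n. y k powr p)"
    using x y p by (intro sum_mono powr_tangent)
  moreover have "(\<Sum>k\<le>n. p * x k powr (p - 1) * x k) \<le> (\<Sum>k\<le>n. p * x k powr (p - 1) * y k)"
    using p by (intro weighted_submajorization w le) auto
  ultimately show ?thesis
    by (simp add: sum.distrib right_diff_distrib sum_subtractf)
qed

text \<open>The weights are the indicator of \<open>x k > t\<close>, under which the excess of \<open>x\<close> is attained and that of
  \<open>y\<close> is not overestimated.\<close>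

lemma sum_excess_submajorization:
  fixes x y :: "nat \<Rightarrow> real"
  assumes x: "decseq x" and le: "\<And>n. (\<Sum>k\<le>n. x k) \<le> (\<Sum>k\<le>n. y k)"
  shows "(\<Sum>k\<le>n. max 0 (x k - t)) \<le> (\<Sum>k\<le>n. max 0 (y k - t))"
proof -
  define w :: "nat \<Rightarrow> real" where "w k = (if x k > t then 1 else 0)" for k
  have w: "decseq w" "\<And>k. w k \<ge> 0"
    using x by (auto simp: decseq_def w_def dest: order.strict_trans2)
  have "(\<Sum>k\<le>n. max 0 (x k - t)) = (\<Sum>k\<le>n. w k * x k) - (\<Sum>k\<le>n. w k * t)"
    unfolding sum_subtractf[symmetric] by (intro sum.cong) (auto simp: w_def)
  also have "\<dots> \<le> (\<Sum>k\<le>n. w k * y k) - (\<Sum>k\<le>n. w k * t)"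
    using weighted_submajorization[OF w le, of n] by simp
  also have "\<dots> \<le> (\<Sum>k\<le>n. max 0 (y k - t))"
    unfolding sum_subtractf[symmetric] by (intro sum_mono) (auto simp: w_def)
  finally show ?thesis .
qed

lemma infsum_le_of_partial_sums:
  fixes f g :: "nat \<Rightarrow> real"
  assumes nn: "\<And>k. f k \<ge> 0" "\<And>k. g k \<ge> 0" and le: "\<And>n. (\<Sum>k\<le>n. f k) \<le> (\<Sum>k\<le>n. g k)"
  shows "(\<Sum>\<^sub>\<infinity>k. ennreal (f k)) \<le> (\<Sum>\<^sub>\<infinity>k. ennreal (g k))"
proof (rule infsum_le_ennreal)
  fix F :: "nat set" assume F: "finite F"
  then obtain n where "F \<subseteq> {..n}"
    using finite_nat_iff_bounded_le by blast
  hence "(\<Sum>k\<in>F. ennreal (f k)) \<le> (\<Sum>k\<le>n. ennreal (f k))"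
    by (intro sum_mono2) auto
  also have "\<dots> \<le> (\<Sum>k\<le>n. ennreal (g k))"
    using nn le by (simp add: sum_nonneg ennreal_leI)
  also have "\<dots> \<le> (\<Sum>\<^sub>\<infinity>k. ennreal (g k))"
    by (intro sum_le_infsum_ennreal) auto
  finally show "(\<Sum>k\<in>F. ennreal (f k)) \<le> (\<Sum>\<^sub>\<infinity>k. ennreal (g k))" .
qed


section \<open>Tensor products of diagonal operators\<close>

lemma hilbert_tensorD:
  assumes "hilbert_tensor t"
  shows "t (x + x') y = t x y + t x' y" and "t x (y + y') = t x y + t x y'"
    and "t (c *\<^sub>C x) y = c *\<^sub>C t x y" and "t x (c *\<^sub>C y) = c *\<^sub>C t x y"
    and "cinner (t x y) (t x' y') = cinner x x' * cinner y y'"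
    and "closure (cspan {t x y |x y. True}) = UNIV"
  using assms unfolding hilbert_tensor_def by blast+

lemma norm_hilbert_tensor:
  assumes t: "hilbert_tensor t" shows "norm (t x y) = norm x * norm y"
proof -
  have "complex_of_real ((norm (t x y))\<^sup>2) = complex_of_real ((norm x * norm y)\<^sup>2)"
    unfolding cinner_self[symmetric] hilbert_tensorD(5)[OF t]
    by (simp add: cinner_self power_mult_distrib)
  hence "(norm (t x y))\<^sup>2 = (norm x * norm y)\<^sup>2"
    using of_real_eq_iff by blast
  thus ?thesis
    by (simp add: power2_eq_iff_nonneg)
qed

lemma
  assumes t: "hilbert_tensor t"
  shows bounded_clinear_tensor_left: "bounded_clinear (\<lambda>x. t x y)"
    and bounded_clinear_tensor_right: "bounded_clinear (t x)"
proof -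
  have "bounded_linear (\<lambda>x. t x y)"
    by (rule bounded_linear_intro[where K = "norm y"])
       (simp_all add: hilbert_tensorD[OF t] scaleR_conv_scaleC norm_hilbert_tensor[OF t])
  thus "bounded_clinear (\<lambda>x. t x y)"
    by (simp add: bounded_clinear_def hilbert_tensorD[OF t])
  have "bounded_linear (t x)"
    by (rule bounded_linear_intro[where K = "norm x"])
       (simp_all add: hilbert_tensorD[OF t] scaleR_conv_scaleC norm_hilbert_tensor[OF t] mult.commute)
  thus "bounded_clinear (t x)"
    by (simp add: bounded_clinear_def hilbert_tensorD[OF t])
qed

lemma orthonormal_tensor:
  assumes t: "hilbert_tensor t" and e: "orthonormal e" and f: "orthonormal f"
  shows "orthonormal (\<lambda>(i, j). t (e i) (f j))"
  by (auto simp: orthonormal_on_def hilbert_tensorD(5)[OF t] orthonormalD[OF e] orthonormalD[OF f])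

lemma orthonormal_ext:
  assumes e: "orthonormal e" and S: "bounded_clinear S" and S': "bounded_clinear S'"
    and eq: "\<And>i. S (e i) = S' (e i)" and ker: "\<And>x. (\<And>i. cinner (e i) x = 0) \<Longrightarrow> S x = S' x"
  shows "S x = S' x"
proof -
  obtain z where z: "((\<lambda>i. cinner (e i) x *\<^sub>C e i) has_sum z) UNIV" "\<And>i. cinner (e i) (x - z) = 0"
    by (rule orthonormal_projection[OF e, where x = x]) blast
  have "((\<lambda>i. S (cinner (e i) x *\<^sub>C e i)) has_sum S z) UNIV"
    by (rule has_sum_bounded_linear[OF bounded_clinearD(1)[OF S] z(1)])
  moreover have "((\<lambda>i. S' (cinner (e i) x *\<^sub>C e i)) has_sum S' z) UNIV"
    by (rule has_sum_bounded_linear[OF bounded_clinearD(1)[OF S'] z(1)])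
  ultimately have "S z = S' z"
    by (simp add: bounded_clinearD(2)[OF S] bounded_clinearD(2)[OF S'] eq has_sum_unique)
  moreover have "S (x - z) = S' (x - z)"
    by (rule ker) (rule z(2))
  ultimately show ?thesis
    by (simp add: bounded_clinear_diff[OF S] bounded_clinear_diff[OF S'])
qed

text \<open>The diagonal operator with the product coefficients agrees with \<open>t (A x) (C y)\<close> on the tensors
  of basis vectors, and the agreement extends to all elementary tensors one factor at a time. The span
  of these is dense, so no other bounded operator qualifies.\<close>

lemma tensor_op_diagonal:
  assumes t: "hilbert_tensor t" and A: "diagonal A e a" and C: "diagonal C f c"
    and Ka: "\<And>i. \<bar>a i\<bar> \<le> Ka" and Kc: "\<And>j. \<bar>c j\<bar> \<le> Kc"
  shows "diagonal (tensor_op t A C) (\<lambda>(i, j). t (e i) (f j)) (\<lambda>(i, j). a i * c j)"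
proof -
  have e: "orthonormal e" and f: "orthonormal f" and lA: "bounded_clinear A" and lC: "bounded_clinear C"
    using A C by (auto dest: diagonalD)
  define g where "g = (\<lambda>(i, j). t (e i) (f j))"
  have g: "orthonormal g"
    unfolding g_def by (rule orthonormal_tensor[OF t e f])
  have "\<bar>a i * c j\<bar> \<le> Ka * Kc" for i j
    using mult_mono[OF Ka[of i] Kc[of j]] order.trans[OF abs_ge_zero Ka[of i]]
    by (simp add: abs_mult)
  hence "\<bar>case ij of (i, j) \<Rightarrow> a i * c j\<bar> \<le> Ka * Kc" for ij
    by (cases ij) simp
  then obtain T where T: "diagonal T g (\<lambda>(i, j). a i * c j)"
    using diagonal_exists[OF g, of "\<lambda>(i, j). a i * c j"] by blast
  have lT: "bounded_clinear T"
    by (rule diagonalD[OF T])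
  have ker: "T (t x y) = 0" if "(\<forall>i. cinner (e i) x = 0) \<or> (\<forall>j. cinner (f j) y = 0)" for x y
    by (rule diagonal_kernel[OF T]) (use that in \<open>auto simp: g_def hilbert_tensorD(5)[OF t]\<close>)
  have t0: "t 0 y = 0" "t x 0 = 0" for x y
    using hilbert_tensorD(3)[OF t, of 0 0 y] hilbert_tensorD(4)[OF t, of x 0 0] by simp_all
  have basis: "T (t (e i) y) = t (A (e i)) (C y)" for i y
  proof (rule orthonormal_ext[OF f, where S = "\<lambda>y. T (t (e i) y)" and S' = "\<lambda>y. t (A (e i)) (C y)"])
    show "bounded_clinear (\<lambda>y. T (t (e i) y))"
      using bounded_clinear_compose[OF lT bounded_clinear_tensor_right[OF t]] by (simp add: o_def)
    show "bounded_clinear (\<lambda>y. t (A (e i)) (C y))"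
      using bounded_clinear_compose[OF bounded_clinear_tensor_right[OF t] lC] by (simp add: o_def)
    show "T (t (e i) (f j)) = t (A (e i)) (C (f j))" for j
      using diagonal_eigenvector[OF T, of "(i, j)"]
      by (simp add: g_def diagonal_eigenvector[OF A] diagonal_eigenvector[OF C] hilbert_tensorD[OF t]
          scaleC_scaleC)
    show "T (t (e i) y) = t (A (e i)) (C y)" if "\<And>j. cinner (f j) y = 0" for y
      using ker[of "e i" y] that diagonal_kernel[OF C that] by (simp add: t0)
  qed
  have elem: "T (t x y) = t (A x) (C y)" for x y
  proof (rule orthonormal_ext[OF e, where S = "\<lambda>x. T (t x y)" and S' = "\<lambda>x. t (A x) (C y)"])
    show "bounded_clinear (\<lambda>x. T (t x y))"
      using bounded_clinear_compose[OF lT bounded_clinear_tensor_left[OF t]] by (simp add: o_def)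
    show "bounded_clinear (\<lambda>x. t (A x) (C y))"
      using bounded_clinear_compose[OF bounded_clinear_tensor_left[OF t] lA] by (simp add: o_def)
    show "T (t (e i) y) = t (A (e i)) (C y)" for i
      by (rule basis)
    show "T (t x y) = t (A x) (C y)" if "\<And>i. cinner (e i) x = 0" for x
      using ker[of x y] that diagonal_kernel[OF A that] by (simp add: t0)
  qed
  have "tensor_op t A C = T"
    unfolding tensor_op_def
  proof (rule the_equality)
    fix S assume S: "bounded_clinear S \<and> (\<forall>x y. S (t x y) = t (A x) (C y))"
    define E where "E = {z. S z = T z}"
    have "closed E"
      unfolding E_def using S lT
      by (intro closed_Collect_eq linear_continuous_on bounded_clinearD(1)) auto
    moreover have "cspan {t x y |x y. True} \<subseteq> E"
    proof
      fix z assume "z \<in> cspan {t x y |x y. True}"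
      thus "z \<in> E"
      proof (induction rule: complex_vector.span_induct_alt)
        case base
        show ?case
          using S lT by (simp add: E_def bounded_clinear_zero)
      next
        case (step c x y)
        thus ?case
          using S lT elem by (auto simp: E_def bounded_clinear_add bounded_clinearD(2))
      qed
    qed
    ultimately have "E = UNIV"
      using hilbert_tensorD(6)[OF t] closure_minimal by blast
    thus "S = T"
      by (auto simp: E_def)
  qed (use lT elem in blast)
  thus ?thesis
    using T by (simp add: g_def)
qed

lemma infinite_dimensional_if_orthonormal:
  fixes g :: "nat \<Rightarrow> 'a::complex_hilbert"
  assumes g: "orthonormal g"
  shows "\<not> (\<exists>F :: 'a set. finite F \<and> cspan F = UNIV)"
proof
  assume "\<exists>F :: 'a set. finite F \<and> cspan F = UNIV"
  then obtain F :: "'a set" where F: "finite F" "cspan F = UNIV"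
    by blast
  define G where "G = {..card F}"
  have gG: "orthonormal_on G g"
    using orthonormal_on_subset[OF g] by simp
  have "card (g ` G) \<le> card F"
    using complex_vector.independent_span_bound[OF F(1) independent_orthonormal[OF gG]] F(2)
    by (simp add: G_def)
  thus False
    by (simp add: card_image[OF orthonormal_on_inj[OF gG]]) (simp add: G_def)
qed

lemma finite_products_ge:
  fixes a :: "'i \<Rightarrow> real" and c :: "'j \<Rightarrow> real"
  assumes a: "\<And>i. 0 \<le> a i" "\<And>i. a i \<le> Ka" and c: "\<And>j. 0 \<le> c j" "\<And>j. c j \<le> Kc"
    and fin: "\<And>r. r > 0 \<Longrightarrow> finite {i. a i \<ge> r}" "\<And>r. r > 0 \<Longrightarrow> finite {j. c j \<ge> r}" and r: "r > 0"
  shows "finite {ij. (case ij of (i, j) \<Rightarrow> a i * c j) \<ge> r}"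
proof -
  define K where "K = max 1 (max Ka Kc)"
  have K: "K > 0" "a i \<le> K" "c j \<le> K" for i j
    using a(2)[of i] c(2)[of j] by (auto simp: K_def)
  have "r / K \<le> a i \<and> r / K \<le> c j" if "a i * c j \<ge> r" for i j
  proof -
    have "a i * c j \<le> a i * K" "a i * c j \<le> K * c j"
      using a c K by (auto intro: mult_left_mono mult_right_mono)
    thus ?thesis
      using that K(1) by (simp add: divide_le_eq mult.commute)
  qed
  hence "{ij. (case ij of (i, j) \<Rightarrow> a i * c j) \<ge> r} \<subseteq> {i. a i \<ge> r / K} \<times> {j. c j \<ge> r / K}"
    by auto
  thus ?thesis
    using fin r K(1) by (meson divide_pos_pos finite_SigmaI finite_subset)
qed


section \<open>Consequences of catalytic submajorization\<close>

text \<open>The singular values of a tensor product are the rearranged products of those of the factors, so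
  the two monotonicity properties of submajorization become inequalities between sums of products. The
  sequence \<open>c\<close> consists of the eigenvalues of the catalyst.\<close>

lemma Catal_inequalities:
  fixes t :: "'h::complex_hilbert \<Rightarrow> 'h \<Rightarrow> 'k::complex_hilbert" and e :: "nat \<Rightarrow> 'h"
  assumes inf: "\<not> (\<exists>F :: 'h set. finite F \<and> cspan F = UNIV)" and t: "hilbert_tensor t"
    and A: "diagonal A e a" and a: "\<And>i. a i \<ge> 0" "a \<longlonglongrightarrow> 0" and B: "B \<in> Catal t A"
  obtains c :: "nat \<Rightarrow> real" where "decseq c" and "\<And>j. c j \<ge> 0" and "c 0 > 0"
    and "(\<Sum>\<^sub>\<infinity>j. ennreal (c j)) < \<infinity>"
    and "\<And>p. p > 1 \<Longrightarrow> (\<Sum>\<^sub>\<infinity>(i, j). ennreal ((sing_val B i * c j) powr p))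
            \<le> (\<Sum>\<^sub>\<infinity>(i, j). ennreal ((a i * c j) powr p))"
    and "\<And>r. r > 0 \<Longrightarrow> (\<Sum>\<^sub>\<infinity>(i, j). ennreal (max 0 (sing_val B i * c j - r)))
            \<le> (\<Sum>\<^sub>\<infinity>(i, j). ennreal (max 0 (a i * c j - r)))"
proof -
  obtain C where C: "positive_op C" "C \<in> trace_class" "C \<noteq> (\<lambda>x. 0)"
    and maj: "tensor_op t B C \<prec>\<prec> tensor_op t A C" and Bpos: "positive_op B" and BL: "B \<in> weak_L1"
    using B unfolding Catal_def by blast
  have cptC: "compact_op C" and cptB: "compact_op B"
    using C BL by (auto simp: trace_class_def weak_L1_def)
  define b where "b = sing_val B"
  define c where "c = sing_val C"
  obtain f :: "nat \<Rightarrow> 'h" where f: "diagonal C f c"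
    using positive_compact_diagonal[OF inf cptC C(1)] unfolding c_def by blast
  obtain h :: "nat \<Rightarrow> 'h" where h: "diagonal B h b"
    using positive_compact_diagonal[OF inf cptB Bpos] unfolding b_def by blast
  have c: "decseq c" "\<And>j. c j \<ge> 0" "c \<longlonglongrightarrow> 0"
    unfolding c_def using decseq_sing_val sing_val_nonneg sing_val_tendsto_0 inf cptC by blast+
  have b: "decseq b" "\<And>j. b j \<ge> 0" "b \<longlonglongrightarrow> 0"
    unfolding b_def using decseq_sing_val sing_val_nonneg sing_val_tendsto_0 inf cptB by blast+
  have bb: "b i \<le> b 0" and cb: "c i \<le> c 0" for i
    using decseqD[OF b(1), of 0 i] decseqD[OF c(1), of 0 i] by simp_all
  have "Bseq a"
    using a(2) by (intro convergent_imp_Bseq) (auto simp: convergent_def)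
  then obtain K where K: "\<And>i. a i \<le> K"
    by (metis BseqE abs_le_D1 real_norm_def)
  have infk: "\<not> (\<exists>F :: 'k set. finite F \<and> cspan F = UNIV)"
  proof (rule infinite_dimensional_if_orthonormal)
    have "orthonormal (\<lambda>(i, j). t (e i) (f j))"
      using A f by (intro orthonormal_tensor t) (auto dest: diagonalD)
    thus "orthonormal (\<lambda>i. t (e i) (f 0))"
      unfolding orthonormal_on_def by (auto dest: bspec[where x = "(i, 0)" for i])
  qed
  have finA: "finite {ij. \<bar>case ij of (i, j) \<Rightarrow> a i * c j\<bar> \<ge> r}" if "r > 0" for r
  proof -
    have "\<bar>case ij of (i, j) \<Rightarrow> a i * c j\<bar> = (case ij of (i, j) \<Rightarrow> a i * c j)" for ij
      using a c by (cases ij) auto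
    thus ?thesis
      using finite_products_ge[OF a(1) K c(2) cb tendsto_0_finite_ge[OF a(2)] tendsto_0_finite_ge[OF c(3)] that]
      by simp
  qed
  have finB: "finite {ij. \<bar>case ij of (i, j) \<Rightarrow> b i * c j\<bar> \<ge> r}" if "r > 0" for r
  proof -
    have "\<bar>case ij of (i, j) \<Rightarrow> b i * c j\<bar> = (case ij of (i, j) \<Rightarrow> b i * c j)" for ij
      using b c by (cases ij) auto
    thus ?thesis
      using finite_products_ge[OF b(2) bb c(2) cb tendsto_0_finite_ge[OF b(3)] tendsto_0_finite_ge[OF c(3)] that]
      by simp
  qed
  define \<alpha> where "\<alpha> = sing_val (tensor_op t A C)"
  define \<beta> where "\<beta> = sing_val (tensor_op t B C)"
  have dA: "diagonal (tensor_op t A C) (\<lambda>(i, j). t (e i) (f j)) (\<lambda>(i, j). a i * c j)"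
    using a K c cb by (intro tensor_op_diagonal[OF t A f, of K "c 0"]) auto
  have dB: "diagonal (tensor_op t B C) (\<lambda>(i, j). t (h i) (f j)) (\<lambda>(i, j). b i * c j)"
    using b bb c cb by (intro tensor_op_diagonal[OF t h f, of "b 0" "c 0"]) auto
  have \<alpha>: "\<And>k. \<alpha> k \<ge> 0" and \<beta>: "decseq \<beta>" "\<And>k. \<beta> k \<ge> 0"
    unfolding \<alpha>_def \<beta>_def
    using sing_val_nonneg[OF infk] decseq_sing_val[OF infk] diagonal_compact[OF dA finA]
      diagonal_compact[OF dB finB] by blast+
  have transA: "(\<Sum>\<^sub>\<infinity>k. \<phi> (\<alpha> k)) = (\<Sum>\<^sub>\<infinity>(i, j). \<phi> (a i * c j))"
    if "\<phi> 0 = 0" for \<phi> :: "real \<Rightarrow> ennreal"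
  proof -
    have "(\<Sum>\<^sub>\<infinity>k. \<phi> (\<alpha> k)) = (\<Sum>\<^sub>\<infinity>ij. \<phi> (case ij of (i, j) \<Rightarrow> a i * c j))"
      unfolding \<alpha>_def
      by (rule infsum_sing_val_diagonal[where \<phi> = \<phi>, OF infk dA])
         (use a c finA that in auto)
    thus ?thesis
      by (simp add: case_prod_unfold)
  qed
  have transB: "(\<Sum>\<^sub>\<infinity>k. \<phi> (\<beta> k)) = (\<Sum>\<^sub>\<infinity>(i, j). \<phi> (b i * c j))"
    if "\<phi> 0 = 0" for \<phi> :: "real \<Rightarrow> ennreal"
  proof -
    have "(\<Sum>\<^sub>\<infinity>k. \<phi> (\<beta> k)) = (\<Sum>\<^sub>\<infinity>ij. \<phi> (case ij of (i, j) \<Rightarrow> b i * c j))"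
      unfolding \<beta>_def
      by (rule infsum_sing_val_diagonal[where \<phi> = \<phi>, OF infk dB])
         (use b c finB that in auto)
    thus ?thesis
      by (simp add: case_prod_unfold)
  qed
  have le: "(\<Sum>k\<le>n. \<beta> k) \<le> (\<Sum>k\<le>n. \<alpha> k)" for n
    using maj by (simp add: submaj_def \<alpha>_def \<beta>_def)
  have "c 0 \<noteq> 0"
  proof
    assume "c 0 = 0"
    hence "c i = 0" for i
      using c(2)[of i] cb[of i] by simp
    hence "C x = 0" for x
      using diagonal_norm_le[OF f, of x 0] by simp
    thus False
      using C(3) by blast
  qed
  hence c0: "c 0 > 0"
    using c(2)[of 0] by simp
  have "abs_op C = C"
    by (rule abs_op_diagonal[OF f c(2)])
  hence sum: "(\<Sum>\<^sub>\<infinity>j. ennreal (c j)) < \<infinity>"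
    using C(2) op_trace_diagonal[OF f c(2)] by (simp add: trace_class_def)
  show ?thesis
  proof (rule that[OF c(1) c(2) c0 sum])
    fix p :: real assume p: "p > 1"
    have "(\<Sum>\<^sub>\<infinity>k. ennreal (\<beta> k powr p)) \<le> (\<Sum>\<^sub>\<infinity>k. ennreal (\<alpha> k powr p))"
      by (intro infsum_le_of_partial_sums sum_powr_submajorization \<alpha> \<beta> le p) auto
    thus "(\<Sum>\<^sub>\<infinity>(i, j). ennreal ((sing_val B i * c j) powr p)) \<le> (\<Sum>\<^sub>\<infinity>(i, j). ennreal ((a i * c j) powr p))"
      using transA[of "\<lambda>x. ennreal (x powr p)"] transB[of "\<lambda>x. ennreal (x powr p)"] p
      by (simp add: b_def)
  next
    fix r :: real assume r: "r > 0"
    have "(\<Sum>\<^sub>\<infinity>k. ennreal (max 0 (\<beta> k - r))) \<le> (\<Sum>\<^sub>\<infinity>k. ennreal (max 0 (\<alpha> k - r)))"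
      by (intro infsum_le_of_partial_sums sum_excess_submajorization \<beta> le) auto
    thus "(\<Sum>\<^sub>\<infinity>(i, j). ennreal (max 0 (sing_val B i * c j - r)))
            \<le> (\<Sum>\<^sub>\<infinity>(i, j). ennreal (max 0 (a i * c j - r)))"
      using transA[of "\<lambda>x. ennreal (max 0 (x - r))"] transB[of "\<lambda>x. ennreal (max 0 (x - r))"] r
      by (simp add: b_def)
  qed
qed

lemma op_trace_powr:
  fixes B :: "'h::complex_hilbert \<Rightarrow> 'h"
  assumes inf: "\<not> (\<exists>F :: 'h set. finite F \<and> cspan F = UNIV)"
    and B: "compact_op B" "positive_op B" and p: "p > 0"
  shows "op_trace (op_powr B p) = (\<Sum>\<^sub>\<infinity>k. ennreal (sing_val B k powr p))"
proof -
  obtain h :: "nat \<Rightarrow> 'h" where h: "diagonal B h (sing_val B)"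
    using positive_compact_diagonal[OF inf B] by blast
  have "diagonal (op_powr B p) h (\<lambda>k. sing_val B k powr p)"
  proof (rule op_powr_diagonal[OF h _ _ p])
    show "sing_val B k \<ge> 0" for k
      by (rule sing_val_nonneg[OF inf B(1)])
    show "sing_val B k \<le> sing_val B 0" for k
      using decseqD[OF decseq_sing_val[OF inf B(1)], of 0 k] by simp
  qed
  thus ?thesis
    by (rule op_trace_diagonal) simp
qed

lemma op_trace_powr_diagonal:
  assumes A: "diagonal A e a" and a: "\<And>i. a i \<ge> 0" "\<And>i. a i \<le> K" and p: "p > 0"
  shows "op_trace (op_powr A p) = (\<Sum>\<^sub>\<infinity>i. ennreal (a i powr p))"
  by (rule op_trace_diagonal[OF op_powr_diagonal[OF A a p]]) simp

text \<open>Power sums are multiplicative under tensor products, so a trace class catalyst cancels.\<close>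

lemma Catal_power_sums:
  fixes t :: "'h::complex_hilbert \<Rightarrow> 'h \<Rightarrow> 'k::complex_hilbert" and e :: "nat \<Rightarrow> 'h"
  assumes inf: "\<not> (\<exists>F :: 'h set. finite F \<and> cspan F = UNIV)" and t: "hilbert_tensor t"
    and A: "diagonal A e a" and a: "\<And>i. a i \<ge> 0" "a \<longlonglongrightarrow> 0" and B: "B \<in> Catal t A" and p: "p > 1"
  shows "(\<Sum>\<^sub>\<infinity>k. ennreal (sing_val B k powr p)) \<le> (\<Sum>\<^sub>\<infinity>i. ennreal (a i powr p))"
proof -
  obtain c :: "nat \<Rightarrow> real" where c: "decseq c" "\<And>j. c j \<ge> 0" "c 0 > 0"
    and sum: "(\<Sum>\<^sub>\<infinity>j. ennreal (c j)) < \<infinity>"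
    and le: "\<And>p. p > 1 \<Longrightarrow> (\<Sum>\<^sub>\<infinity>(i, j). ennreal ((sing_val B i * c j) powr p))
            \<le> (\<Sum>\<^sub>\<infinity>(i, j). ennreal ((a i * c j) powr p))"
    by (rule Catal_inequalities[OF inf t A a B]) blast
  have "compact_op B"
    using B by (simp add: Catal_def weak_L1_def)
  hence b: "sing_val B k \<ge> 0" for k
    by (rule sing_val_nonneg[OF inf])
  define S where "S = (\<Sum>\<^sub>\<infinity>j. ennreal (c j powr p))"
  have prod: "(\<Sum>\<^sub>\<infinity>(i, j). ennreal ((x i * c j) powr p)) = S * (\<Sum>\<^sub>\<infinity>i. ennreal (x i powr p))"
    if x: "\<And>i. x i \<ge> 0" for x :: "nat \<Rightarrow> real"
  proof -
    have "(\<lambda>(i, j). ennreal ((x i * c j) powr p)) = (\<lambda>(i, j). ennreal (x i powr p) * ennreal (c j powr p))"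
      using x c by (auto simp: powr_mult ennreal_mult)
    thus ?thesis
      using infsum_times_ennreal[of "\<lambda>i. ennreal (x i powr p)" "\<lambda>j. ennreal (c j powr p)" UNIV UNIV]
      by (simp add: S_def mult.commute)
  qed
  have "S \<le> (\<Sum>\<^sub>\<infinity>j. ennreal (c 0 powr (p - 1)) * ennreal (c j))"
    unfolding S_def
  proof (rule infsum_mono)
    fix j
    have "c j powr p = c j powr (p - 1) * c j"
      using c(2)[of j] by (cases "c j = 0") (simp_all add: powr_diff)
    also have "\<dots> \<le> c 0 powr (p - 1) * c j"
      using c decseqD[OF c(1), of 0 j] p by (intro mult_right_mono powr_mono2) auto
    finally show "ennreal (c j powr p) \<le> ennreal (c 0 powr (p - 1)) * ennreal (c j)"
      using c by (simp add: ennreal_leI flip: ennreal_mult)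
  qed (auto intro: nonneg_summable_on_complete)
  also have "\<dots> = ennreal (c 0 powr (p - 1)) * (\<Sum>\<^sub>\<infinity>j. ennreal (c j))"
    by (rule infsum_cmult_ennreal)
  also have "\<dots> < top"
    using sum by (simp add: ennreal_mult_less_top)
  finally have "S \<noteq> top"
    by simp
  moreover have "S \<noteq> 0"
  proof -
    have "(\<Sum>j\<in>{0}. ennreal (c j powr p)) \<le> S"
      unfolding S_def by (intro sum_le_infsum_ennreal) auto
    moreover have "ennreal (c 0 powr p) > 0"
      using c(3) by simp
    ultimately show ?thesis
      by auto
  qed
  moreover have "S * (\<Sum>\<^sub>\<infinity>k. ennreal (sing_val B k powr p)) \<le> S * (\<Sum>\<^sub>\<infinity>i. ennreal (a i powr p))"
    using le[OF p] prod[OF b] prod[OF a(1)] by simp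
  ultimately show ?thesis
    by (simp add: ennreal_mult_le_mult_iff)
qed

lemma compact_op_diff:
  fixes X Y :: "'a::complex_hilbert \<Rightarrow> 'b::complex_hilbert"
  assumes X: "compact_op X" and Y: "compact_op Y"
  shows "compact_op (\<lambda>x. X x - Y x)"
proof -
  define S where "S = {x - y | x y. x \<in> closure (X ` cball 0 1) \<and> y \<in> closure (Y ` cball 0 1)}"
  have S: "compact S"
    unfolding S_def by (intro compact_differences compact_opD X Y)
  have "(\<lambda>x. X x - Y x) ` cball 0 1 \<subseteq> S"
    unfolding S_def using closure_subset by blast
  hence "closure ((\<lambda>x. X x - Y x) ` cball 0 1) \<subseteq> S"
    by (intro closure_minimal compact_imp_closed S)
  hence "compact (closure ((\<lambda>x. X x - Y x) ` cball 0 1))"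
    using compact_Int_closed[OF S closed_closure[of "(\<lambda>x. X x - Y x) ` cball 0 1"]]
    by (simp add: Int_absorb1)
  moreover have "bounded_clinear (\<lambda>x. X x - Y x)"
    using compact_opD(1)[OF X] compact_opD(1)[OF Y]
    by (auto simp: bounded_clinear_def scaleC_diff_right intro: bounded_linear_sub)
  ultimately show ?thesis
    by (simp add: compact_op_def)
qed

text \<open>Ky Fan's inequality at the halved index bounds the set whose supremum is the quasi-norm, so that
  the quasi-norm of a difference really is an upper bound of it.\<close>

lemma weak_L1_norm_diff:
  fixes X Y :: "'a::complex_hilbert \<Rightarrow> 'a"
  assumes inf: "\<not> (\<exists>F :: 'a set. finite F \<and> cspan F = UNIV)"
    and X: "X \<in> weak_L1" and Y: "Y \<in> weak_L1"
  shows "(real k + 1) * sing_val (\<lambda>x. X x - Y x) k \<le> weak_L1_norm (\<lambda>x. X x - Y x)"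
proof -
  define D where "D = (\<lambda>x. X x - Y x)"
  have cpt: "compact_op X" "compact_op Y" "compact_op D"
    using X Y by (auto simp: weak_L1_def D_def intro: compact_op_diff)
  obtain KX KY where K: "\<And>k. (real k + 1) * sing_val X k \<le> KX" "\<And>k. (real k + 1) * sing_val Y k \<le> KY"
    using X Y unfolding weak_L1_def bdd_above_def by auto
  have "(real k + 1) * sing_val D k \<le> 2 * (KX + KY)" for k
  proof -
    define m where "m = k div 2"
    have "sing_val D k \<le> sing_val D (m + m)"
      by (rule decseqD[OF decseq_sing_val[OF inf cpt(3)]]) (simp add: m_def)
    also have "\<dots> \<le> sing_val X m + sing_val Y m"
      by (rule sing_val_add_le[OF inf cpt]) (simp add: D_def norm_triangle_ineq4)
    finally have "(real k + 1) * sing_val D k \<le> (real k + 1) * (sing_val X m + sing_val Y m)"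
      by (intro mult_left_mono) auto
    also have "\<dots> \<le> (2 * (real m + 1)) * (sing_val X m + sing_val Y m)"
      using sing_val_nonneg[OF inf cpt(1)] sing_val_nonneg[OF inf cpt(2)]
      by (intro mult_right_mono add_nonneg_nonneg) (auto simp: m_def)
    also have "\<dots> = 2 * ((real m + 1) * sing_val X m + (real m + 1) * sing_val Y m)"
      by (simp add: algebra_simps)
    finally show ?thesis
      using K(1)[of m] K(2)[of m] by argo
  qed
  hence "bdd_above (range (\<lambda>k. (real k + 1) * sing_val D k))"
    by (intro bdd_aboveI) auto
  thus ?thesis
    unfolding weak_L1_norm_def D_def[symmetric] by (intro cSUP_upper) auto
qed

text \<open>Convergence in the quasi-norm implies convergence in operator norm. This preserves positivity
  and moves every singular value by a small amount, so power sums are lower semicontinuous.\<close>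

lemma closure_Catal_subset_PM:
  fixes t :: "'h::complex_hilbert \<Rightarrow> 'h \<Rightarrow> 'k::complex_hilbert" and e :: "nat \<Rightarrow> 'h"
  assumes inf: "\<not> (\<exists>F :: 'h set. finite F \<and> cspan F = UNIV)" and t: "hilbert_tensor t"
    and A: "diagonal A e a" and a: "\<And>i. a i \<ge> 0" "a \<longlonglongrightarrow> 0"
  shows "weak_L1_closure (Catal t A) \<subseteq> PM A"
proof
  fix B assume "B \<in> weak_L1_closure (Catal t A)"
  hence BL: "B \<in> weak_L1"
    and near: "\<And>r. r > 0 \<Longrightarrow> \<exists>B'\<in>Catal t A. weak_L1_norm (\<lambda>x. B x - B' x) < r"
    unfolding weak_L1_closure_def by auto
  have cpt: "compact_op B"
    using BL by (simp add: weak_L1_def)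
  have approx: "\<exists>B'\<in>Catal t A. \<forall>x. norm (B x - B' x) \<le> r * norm x" if r: "r > 0" for r
  proof -
    obtain B' where B': "B' \<in> Catal t A" "weak_L1_norm (\<lambda>x. B x - B' x) < r"
      using near[OF r] by blast
    have B'L: "B' \<in> weak_L1"
      using B'(1) by (simp add: Catal_def)
    hence "compact_op (\<lambda>x. B x - B' x)"
      using cpt by (intro compact_op_diff) (auto simp: weak_L1_def)
    hence "norm (B x - B' x) \<le> sing_val (\<lambda>x. B x - B' x) 0 * norm x" for x
      by (rule norm_le_sing_val_0[OF inf])
    moreover have "sing_val (\<lambda>x. B x - B' x) 0 \<le> r"
      using weak_L1_norm_diff[OF inf BL B'L, of 0] B'(2) by simp
    ultimately have "norm (B x - B' x) \<le> r * norm x" for x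
      by (meson mult_right_mono norm_ge_zero order.trans)
    thus ?thesis
      using B'(1) by blast
  qed
  have "cinner x (B x) \<in> \<real>\<^sub>\<ge>\<^sub>0" for x
  proof -
    have "cinner x (B x) \<in> closure \<real>\<^sub>\<ge>\<^sub>0"
      unfolding closure_approachable
    proof (intro allI impI)
      fix \<epsilon> :: real assume \<epsilon>: "\<epsilon> > 0"
      define r where "r = \<epsilon> / ((norm x)\<^sup>2 + 1)"
      have n: "(norm x)\<^sup>2 + 1 > 0"
        by (simp add: add_nonneg_pos)
      have r: "r > 0"
        using \<epsilon> n by (simp add: r_def)
      obtain B' where B': "B' \<in> Catal t A" "\<And>x. norm (B x - B' x) \<le> r * norm x"
        using approx[OF r] by blast
      have "dist (cinner x (B' x)) (cinner x (B x)) = cmod (cinner x (B x - B' x))"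
        by (simp add: cinner_diff_right dist_norm norm_minus_commute)
      also have "\<dots> \<le> norm x * (r * norm x)"
        by (rule order.trans[OF Cauchy_Schwarz_cinner mult_left_mono[OF B'(2)]]) simp
      also have "\<dots> = r * (norm x)\<^sup>2"
        by (simp add: power2_eq_square)
      also have "\<dots> < r * ((norm x)\<^sup>2 + 1)"
        using r by simp
      also have "\<dots> = \<epsilon>"
        using n by (simp add: r_def)
      finally have "dist (cinner x (B' x)) (cinner x (B x)) < \<epsilon>" .
      moreover have "cinner x (B' x) \<in> \<real>\<^sub>\<ge>\<^sub>0"
        using B'(1) by (simp add: Catal_def positive_op_def)
      ultimately show "\<exists>y\<in>\<real>\<^sub>\<ge>\<^sub>0. dist y (cinner x (B x)) < \<epsilon>"
        by blast
    qed
    thus ?thesis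
      by (simp add: closure_closed closed_nonneg_Reals_complex)
  qed
  hence pos: "positive_op B"
    using compact_opD(1)[OF cpt] by (simp add: positive_op_def)
  define b where "b = sing_val B"
  have b0: "b k \<ge> 0" for k
    unfolding b_def by (rule sing_val_nonneg[OF inf cpt])
  have "Bseq a"
    using a(2) by (intro convergent_imp_Bseq) (auto simp: convergent_def)
  then obtain K where K: "\<And>i. a i \<le> K"
    by (metis BseqE abs_le_D1 real_norm_def)
  have "op_trace (op_powr B p) \<le> op_trace (op_powr A p)" if p: "p > 1" for p
  proof -
    define S where "S = (\<Sum>\<^sub>\<infinity>i. ennreal (a i powr p))"
    have "(\<Sum>\<^sub>\<infinity>k. ennreal (b k powr p)) \<le> S"
    proof (rule infsum_le_ennreal)
      fix F :: "nat set" assume F: "finite F"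
      have bound: "(\<Sum>k\<in>F. ennreal (max 0 (b k - r) powr p)) \<le> S" if r: "r > 0" for r
      proof -
        obtain B' where B': "B' \<in> Catal t A" "\<And>x. norm (B x - B' x) \<le> r * norm x"
          using approx[OF r] by blast
        have cpt': "compact_op B'"
          using B'(1) by (simp add: Catal_def weak_L1_def)
        have le: "max 0 (b k - r) \<le> sing_val B' k" for k
        proof -
          have "b k \<le> sing_val B' k + r"
            unfolding b_def
          proof (rule sing_val_perturbation[OF inf cpt' cpt])
            show "norm (B x) \<le> norm (B' x) + r * norm x" for x
              using B'(2)[of x] norm_triangle_ineq2[of "B x" "B' x"] by linarith
          qed
          thus ?thesis
            using sing_val_nonneg[OF inf cpt'] by simp
        qed
        have "(\<Sum>k\<in>F. ennreal (max 0 (b k - r) powr p)) \<le> (\<Sum>k\<in>F. ennreal (sing_val B' k powr p))"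
          using le p by (intro sum_mono ennreal_leI powr_mono2) auto
        also have "\<dots> \<le> (\<Sum>\<^sub>\<infinity>k. ennreal (sing_val B' k powr p))"
          by (intro sum_le_infsum_ennreal F) auto
        also have "\<dots> \<le> S"
          unfolding S_def by (rule Catal_power_sums[OF inf t A a B'(1) p])
        finally show ?thesis .
      qed
      have "(\<lambda>n. \<Sum>k\<in>F. ennreal (max 0 (b k - 1 / real (Suc n)) powr p))
          \<longlonglongrightarrow> (\<Sum>k\<in>F. ennreal (max 0 (b k - 0) powr p))"
        using p LIMSEQ_Suc[OF lim_1_over_n]
        by (intro tendsto_sum tendsto_ennrealI tendsto_powr' tendsto_intros) auto
      hence "(\<Sum>k\<in>F. ennreal (max 0 (b k - 0) powr p)) \<le> S"
        by (rule LIMSEQ_le_const2) (use bound in auto)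
      thus "(\<Sum>k\<in>F. ennreal (b k powr p)) \<le> S"
        using b0 by simp
    qed
    thus ?thesis
      using p by (simp add: op_trace_powr[OF inf cpt pos] op_trace_powr_diagonal[OF A a(1) K] b_def S_def)
  qed
  thus "B \<in> PM A"
    using pos BL by (simp add: PM_def)
qed



section \<open>Integral comparison estimates\<close>

lemma powr_neg_diff_bounds:
  fixes u v s :: real
  assumes "0 < u" and "u < v" and "s > 0"
  shows "s * (v - u) * v powr - (s + 1) \<le> u powr - s - v powr - s"
    and "u powr - s - v powr - s \<le> s * (v - u) * u powr - (s + 1)"
proof -
  have "\<exists>z. z > u \<and> z < v \<and> v powr - s - u powr - s = (v - u) * (- s * z powr (- s - 1))"
    using assms by (intro MVT2) (auto intro!: derivative_eq_intros simp: powr_diff)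
  then obtain z where z: "u < z" "z < v" "v powr - s - u powr - s = (v - u) * (- s * z powr (- s - 1))"
    by blast
  define Z where "Z = z powr - (s + 1)"
  have "Z = z powr (- s - 1)"
    by (simp add: Z_def)
  hence "u powr - s - v powr - s = s * (v - u) * Z"
    using z(3) by (simp add: algebra_simps)
  hence eq: "u powr - s - v powr - s = s * (v - u) * z powr - (s + 1)"
    by (simp only: Z_def)
  have "v powr - (s + 1) \<le> z powr - (s + 1)" "z powr - (s + 1) \<le> u powr - (s + 1)"
    using z assms by (auto intro!: powr_mono2')
  thus "s * (v - u) * v powr - (s + 1) \<le> u powr - s - v powr - s"
    and "u powr - s - v powr - s \<le> s * (v - u) * u powr - (s + 1)"
    unfolding eq using assms by (auto intro!: mult_left_mono)
qed

lemma sum_block_powr_le: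
  assumes "M \<le> N" and "M > 0" and s: "s > 0"
  shows "(\<Sum>k\<in>{M<..N}. real k powr - (s + 1)) \<le> (real M powr - s - real N powr - s) / s"
  using assms(1)
proof (induction N rule: dec_induct)
  case (step N)
  have N: "real N > 0"
    using step assms(2) by simp
  have "s * real (Suc N) powr - (s + 1) \<le> real N powr - s - real (Suc N) powr - s"
    using powr_neg_diff_bounds(1)[of "real N" "real (Suc N)" s] N s by simp
  hence "real (Suc N) powr - (s + 1) \<le> (real N powr - s - real (Suc N) powr - s) / s"
    using s by (simp add: field_simps)
  moreover have "{M<..Suc N} = insert (Suc N) {M<..N}"
    using step.hyps by auto
  ultimately show ?case
    using step.IH by (simp add: diff_divide_distrib)
qed simp

lemma sum_arithmetic_powr_ge:
  assumes s: "s > 0"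
  shows "(\<Sum>k<n. (9 * real k + 1) powr - (s + 1)) \<ge> (1 - (9 * real n + 1) powr - s) / (9 * s)"
proof (induction n)
  case (Suc n)
  have "(9 * real n + 1) powr - s - (9 * real (Suc n) + 1) powr - s \<le> s * 9 * (9 * real n + 1) powr - (s + 1)"
    using powr_neg_diff_bounds(2)[of "9 * real n + 1" "9 * real (Suc n) + 1" s] s by simp
  hence "((9 * real n + 1) powr - s - (9 * real (Suc n) + 1) powr - s) / (9 * s)
      \<le> (9 * real n + 1) powr - (s + 1)"
    using s by (simp add: field_simps)
  thus ?case
    using Suc by (simp add: diff_divide_distrib)
qed simp

lemma powr_one_over: "x > 0 \<Longrightarrow> (1 / x) powr p = x powr - p" for x p :: real
  by (simp add: powr_divide powr_minus_divide)

lemma ln_one_plus_ge: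
  fixes z :: real
  assumes "z > 0" shows "z / (1 + z) \<le> ln (1 + z)"
proof -
  have "ln (1 / (1 + z)) \<le> 1 / (1 + z) - 1"
    using assms by (intro ln_le_minus_one) auto
  thus ?thesis
    using assms by (simp add: ln_div field_simps)
qed

lemma sum_arithmetic_le:
  fixes q :: real
  assumes q: "q > 0"
  shows "(\<Sum>k<n. 1 / (q * real k + 1)) \<le> 1 + ln (q * real n + 1) / q"
proof -
  have "(\<Sum>k\<le>n. 1 / (q * real k + 1)) \<le> 1 + ln (q * real n + 1) / q"
  proof (induction n)
    case (Suc n)
    define z where "z = q / (q * real n + 1)"
    have pos: "q * real n + 1 > 0"
      using q by (simp add: add_nonneg_pos)
    hence z: "z > 0"
      using q by (simp add: z_def)
    have "1 + z = (q * real (Suc n) + 1) / (q * real n + 1)"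
      using pos by (simp add: z_def field_simps)
    moreover from this have "z / (1 + z) = q / (q * real (Suc n) + 1)"
      using pos by (simp add: z_def)
    moreover have "q * real (Suc n) + 1 > 0"
      using q by (simp add: add_nonneg_pos)
    ultimately have "q / (q * real (Suc n) + 1) \<le> ln (q * real (Suc n) + 1) - ln (q * real n + 1)"
      using ln_one_plus_ge[OF z] pos by (simp add: ln_div)
    hence "1 / (q * real (Suc n) + 1) \<le> (ln (q * real (Suc n) + 1) - ln (q * real n + 1)) / q"
      using q by (simp add: field_simps)
    thus ?case
      using Suc by (simp add: diff_divide_distrib)
  qed simp
  moreover have "(\<Sum>k<n. 1 / (q * real k + 1)) \<le> (\<Sum>k\<le>n. 1 / (q * real k + 1))"
    using q by (intro sum_mono2) auto
  ultimately show ?thesis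
    by linarith
qed

lemma sum_block_harmonic_ge:
  assumes "M \<le> N"
  shows "(\<Sum>k\<in>{M<..N}. 1 / real k) \<ge> ln (real N + 1) - ln (real M + 1)"
  using assms
proof (induction N rule: dec_induct)
  case (step N)
  have "ln (1 + 1 / real (Suc N)) \<le> 1 / real (Suc N)"
    by (intro ln_add_one_self_le_self) simp
  moreover have "1 + 1 / real (Suc N) = (real (Suc N) + 1) / (real N + 1)"
    by (simp add: field_simps)
  ultimately have "ln (real (Suc N) + 1) - ln (real N + 1) \<le> 1 / real (Suc N)"
    by (simp add: ln_div)
  moreover have "{M<..Suc N} = insert (Suc N) {M<..N}"
    using step.hyps by auto
  ultimately show ?case
    using step.IH by simp
qed simp


section \<open>Sparse blocks of the harmonic sequence\<close>

lemma quartic_bound: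
  fixes x :: real
  assumes "0 \<le> x" shows "x ^ 3 - x ^ 4 \<le> 27 / 256"
proof -
  \<comment> \<open>The maximum is attained at \<open>x = 3 / 4\<close>, which is therefore a double root.\<close>
  have "27 / 256 - (x ^ 3 - x ^ 4) = (x - 3 / 4)\<^sup>2 * (x\<^sup>2 + x / 2 + 3 / 16)"
    by (simp add: field_simps power2_eq_square power3_eq_cube power4_eq_xxxx)
  moreover have "\<dots> \<ge> 0"
    using assms by (intro mult_nonneg_nonneg add_nonneg_nonneg) auto
  ultimately show ?thesis
    by linarith
qed

text \<open>Along a sequence with \<open>x (Suc j) = x j ^ 10000\<close> at most one term is bounded away from both
  \<open>0\<close> and \<open>1\<close>. The terms after it decay faster than geometrically, and the terms before it satisfy
  \<open>1 - x j \<le> - ln (x j)\<close>, which grows geometrically.\<close>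

lemma sparse_tail:
  fixes x :: "nat \<Rightarrow> real"
  assumes "\<And>j. 0 < x j" and "\<And>j. x (Suc j) = x j ^ 10000" and "x 0 \<le> 1 / 10"
  shows "(\<Sum>j<n. x j ^ 3 - x j ^ 4) \<le> x 0 / 90"
  using assms
proof (induction n arbitrary: x)
  case 0
  show ?case
    using 0(1)[of 0] by simp
next
  case (Suc n)
  have x0: "0 < x 0" "x 0 \<le> 1 / 10"
    using Suc.prems by auto
  have "x (Suc 0) \<le> x 0 ^ 2"
    unfolding Suc.prems(2) using x0 by (intro power_decreasing) auto
  also have "\<dots> \<le> x 0 / 10"
    using x0 by (simp add: power2_eq_square)
  finally have x1: "x (Suc 0) \<le> x 0 / 10" .
  have "(\<Sum>j<n. x (Suc j) ^ 3 - x (Suc j) ^ 4) \<le> x (Suc 0) / 90"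
  proof (rule Suc.IH[of "\<lambda>j. x (Suc j)"])
    show "0 < x (Suc j)" for j
      by (rule Suc.prems(1))
    show "x (Suc (Suc j)) = x (Suc j) ^ 10000" for j
      by (rule Suc.prems(2))
    show "x (Suc 0) \<le> 1 / 10"
      using x1 x0 by linarith
  qed
  moreover have "x 0 ^ 3 - x 0 ^ 4 \<le> x 0 * (1 / 10)\<^sup>2"
  proof -
    have "x 0 ^ 3 = x 0 * (x 0)\<^sup>2"
      by (simp add: power2_eq_square power3_eq_cube)
    also have "\<dots> \<le> x 0 * (1 / 10)\<^sup>2"
      using x0 by (intro mult_left_mono power_mono) auto
    finally show ?thesis
      using zero_le_power[of "x 0" 4] x0 by linarith
  qed
  ultimately show ?case
    using x1 by (simp add: sum.lessThan_Suc_shift power2_eq_square del: sum.lessThan_Suc)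
qed

lemma sparse_head:
  fixes x :: "nat \<Rightarrow> real"
  assumes x: "\<And>j. 0 < x j" "\<And>j. x j < 1" and rec: "\<And>j. x (Suc j) = x j ^ 10000"
    and big: "\<And>j. j < m \<Longrightarrow> x j > 1 / 10"
  shows "(\<Sum>j<m. x j ^ 3 - x j ^ 4) \<le> 27 / 256 + 9 / 9999"
proof (cases m)
  case (Suc m')
  have L: "(\<Sum>j<k. - ln (x j)) = (- ln (x k) + ln (x 0)) / 9999" for k
  proof (induction k)
    case (Suc k)
    have "ln (x (Suc k)) = 10000 * ln (x k)"
      using x(1)[of k] by (simp add: rec ln_realpow)
    thus ?case
      using Suc by (simp add: field_simps)
  qed simp
  have "(\<Sum>j<m'. x j ^ 3 - x j ^ 4) \<le> (\<Sum>j<m'. - ln (x j))"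
  proof (rule sum_mono)
    fix j
    have "x j ^ 3 - x j ^ 4 = x j ^ 3 * (1 - x j)"
      by (simp add: algebra_simps power3_eq_cube power4_eq_xxxx)
    also have "\<dots> \<le> 1 * (1 - x j)"
      using x[of j] by (intro mult_right_mono power_le_one) auto
    also have "\<dots> \<le> - ln (x j)"
      using ln_le_minus_one[OF x(1)[of j]] by simp
    finally show "x j ^ 3 - x j ^ 4 \<le> - ln (x j)" .
  qed
  also have "\<dots> \<le> 9 / 9999"
  proof -
    have "ln (1 / x m') \<le> 1 / x m' - 1"
      using x by (intro ln_le_minus_one) simp
    also have "\<dots> \<le> 9"
      using big[of m'] Suc by (simp add: field_simps)
    finally have "- ln (x m') \<le> 9"
      using x(1)[of m'] by (simp add: ln_div)
    moreover have "ln (x 0) \<le> 0"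
      using x[of 0] by simp
    ultimately show ?thesis
      unfolding L by (intro divide_right_mono) auto
  qed
  finally show ?thesis
    using quartic_bound[of "x m'"] x(1)[of m'] by (simp add: Suc)
qed simp

lemma sparse_sum_le:
  fixes x :: "nat \<Rightarrow> real"
  assumes x: "\<And>j. 0 < x j" "\<And>j. x j < 1" and rec: "\<And>j. x (Suc j) = x j ^ 10000"
  shows "(\<Sum>j<n. x j ^ 3 - x j ^ 4) \<le> 1 / 9"
proof (cases "\<exists>m<n. x m \<le> 1 / 10")
  case True
  then obtain m where m: "m < n" "x m \<le> 1 / 10" "\<And>j. j < m \<Longrightarrow> x j > 1 / 10"
    using exists_least_iff[of "\<lambda>m. m < n \<and> x m \<le> 1 / 10"] by (metis less_trans not_le)
  have "(\<Sum>j<m + k. x j ^ 3 - x j ^ 4)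
      = (\<Sum>j<m. x j ^ 3 - x j ^ 4) + (\<Sum>j<k. x (m + j) ^ 3 - x (m + j) ^ 4)" for k
    by (induction k) simp_all
  from this[of "n - m"] have "(\<Sum>j<n. x j ^ 3 - x j ^ 4)
      = (\<Sum>j<m. x j ^ 3 - x j ^ 4) + (\<Sum>j<n - m. x (m + j) ^ 3 - x (m + j) ^ 4)"
    using m(1) by simp
  also have "(\<Sum>j<n - m. x (m + j) ^ 3 - x (m + j) ^ 4) \<le> x (m + 0) / 90"
    using m(2) x by (intro sparse_tail[of "\<lambda>j. x (m + j)"]) (auto simp: rec)
  finally show ?thesis
    using sparse_head[of x m, OF x rec m(3)] m(2) by simp
next
  case False
  thus ?thesis
    using sparse_head[of x n, OF x rec] by force
qed

text \<open>A block \<open>{M ^ 3<..M ^ 4}\<close> covers the last quarter of \<open>{1..M ^ 4}\<close> on the logarithmic scale. With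
  \<open>s = p - 1\<close> and \<open>x = M powr - s\<close>, its contribution to \<open>\<Sum>k. k powr - p\<close> is at most
  \<open>(x ^ 3 - x ^ 4) / s\<close>. The tower of exponents makes different blocks matter for different \<open>s\<close>.\<close>

definition block_base :: "nat \<Rightarrow> nat" where
  "block_base j = 2 ^ (10000 ^ j)"

definition block :: "nat \<Rightarrow> nat set" where
  "block j = {block_base j ^ 3 <.. block_base j ^ 4}"

definition sparse_harmonic :: "nat \<Rightarrow> real" where
  "sparse_harmonic m = (if \<exists>j. Suc m \<in> block j then 1 / real (Suc m) else 0)"

lemma block_base_ge_2: "block_base j \<ge> 2"
  unfolding block_base_def using power_increasing[of 1 "10000 ^ j" "2::nat"] by simp

lemma block_base_gt: "block_base j > j"
proof -
  have "j < 2 ^ j"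
    by (rule less_exp)
  also have "j < (10000::nat) ^ j"
    using less_exp[of j] power_mono[of "2::nat" 10000 j] by linarith
  hence "(2::nat) ^ j \<le> block_base j"
    unfolding block_base_def by (intro power_increasing) auto
  finally show ?thesis .
qed

lemma block_base_Suc: "block_base (Suc j) = block_base j ^ 10000"
  by (simp add: block_base_def power_mult mult.commute flip: power_mult)

lemma sparse_harmonic_bounds:
  "0 \<le> sparse_harmonic m" "sparse_harmonic m \<le> 1 / (real m + 1)"
  by (auto simp: sparse_harmonic_def add.commute)

text \<open>The bound is the integral \<open>\<integral> (9 x + 1) powr - (s + 1)\<close> over \<open>{0..}\<close>, so it is met by the
  sequence \<open>1 / (9 m + 1)\<close> in the next lemma.\<close>

lemma sparse_harmonic_power_sum_le:
  assumes s: "s > 0"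
  shows "(\<Sum>\<^sub>\<infinity>m. ennreal (sparse_harmonic m powr (s + 1))) \<le> ennreal (1 / (9 * s))"
proof (rule infsum_le_ennreal)
  fix F :: "nat set" assume F: "finite F"
  then obtain n where n: "F \<subseteq> {..n}"
    using finite_nat_iff_bounded_le by blast
  define x where "x j = real (block_base j) powr - s" for j
  have x: "0 < x j" "x j < 1" for j
    using block_base_ge_2[of j] s by (auto simp: x_def powr_less_one)
  have pow: "real (block_base j ^ k) powr - s = x j ^ k" for j k
    using block_base_ge_2[of j] by (simp add: x_def powr_powr mult.commute flip: powr_realpow)
  have rec: "x (Suc j) = x j ^ 10000" for j
    using pow[of j 10000] by (simp add: x_def block_base_Suc)
  have single: "sparse_harmonic m powr (s + 1)
      \<le> (\<Sum>j\<le>n. if Suc m \<in> block j then real (Suc m) powr - (s + 1) else 0)" if "m \<in> F" for m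
  proof (cases "\<exists>j. Suc m \<in> block j")
    case True
    then obtain j where j: "Suc m \<in> block j"
      by blast
    \<comment> \<open>Only the blocks with index at most \<open>n\<close> can meet \<open>F\<close>, which makes the sum over blocks finite.\<close>
    have "j < block_base j"
      by (rule block_base_gt)
    also have "\<dots> \<le> block_base j ^ 3"
      using block_base_ge_2[of j] by (intro self_le_power) auto
    also have "\<dots> < Suc m"
      using j by (simp add: block_def)
    finally have "j \<le> n"
      using n that by auto
    have "sparse_harmonic m powr (s + 1) = real (Suc m) powr - (s + 1)"
      using True powr_one_over[of "real (Suc m)" "s + 1"] by (simp only: sparse_harmonic_def if_True)
    also have "\<dots> = (\<Sum>j\<in>{j}. if Suc m \<in> block j then real (Suc m) powr - (s + 1) else 0)"
      using j by simp
    also have "\<dots> \<le> (\<Sum>j\<le>n. if Suc m \<in> block j then real (Suc m) powr - (s + 1) else 0)"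
      using \<open>j \<le> n\<close> by (intro sum_mono2) auto
    finally show ?thesis .
  next
    case False
    thus ?thesis
      by (simp add: sparse_harmonic_def sum_nonneg)
  qed
  have blk: "(\<Sum>m\<in>F. if Suc m \<in> block j then real (Suc m) powr - (s + 1) else 0) \<le> (x j ^ 3 - x j ^ 4) / s"
    for j
  proof -
    have "(\<Sum>m\<in>F. if Suc m \<in> block j then real (Suc m) powr - (s + 1) else 0)
        = (\<Sum>m\<in>{m\<in>F. Suc m \<in> block j}. real (Suc m) powr - (s + 1))"
      using F by (simp only: sum.inter_filter)
    also have "\<dots> = (\<Sum>k\<in>Suc ` {m\<in>F. Suc m \<in> block j}. real k powr - (s + 1))"
      by (simp add: sum.reindex)
    also have "\<dots> \<le> (\<Sum>k\<in>block j. real k powr - (s + 1))"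
      by (intro sum_mono2) (auto simp: block_def)
    also have "\<dots> \<le> (real (block_base j ^ 3) powr - s - real (block_base j ^ 4) powr - s) / s"
      unfolding block_def using block_base_ge_2[of j] s
      by (intro sum_block_powr_le power_increasing) auto
    finally show ?thesis
      by (simp only: pow)
  qed
  have "(\<Sum>m\<in>F. sparse_harmonic m powr (s + 1))
      \<le> (\<Sum>m\<in>F. \<Sum>j\<le>n. if Suc m \<in> block j then real (Suc m) powr - (s + 1) else 0)"
    by (intro sum_mono single)
  also have "\<dots> = (\<Sum>j\<le>n. \<Sum>m\<in>F. if Suc m \<in> block j then real (Suc m) powr - (s + 1) else 0)"
    by (rule sum.swap)
  also have "\<dots> \<le> (\<Sum>j\<le>n. (x j ^ 3 - x j ^ 4) / s)"
    by (intro sum_mono blk)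
  also have "\<dots> = (\<Sum>j<Suc n. x j ^ 3 - x j ^ 4) / s"
    by (simp add: lessThan_Suc_atMost sum_divide_distrib del: sum.lessThan_Suc)
  also have "\<dots> \<le> 1 / 9 / s"
    using s by (intro divide_right_mono sparse_sum_le x rec) auto
  finally have "(\<Sum>m\<in>F. sparse_harmonic m powr (s + 1)) \<le> 1 / (9 * s)"
    by simp
  thus "(\<Sum>m\<in>F. ennreal (sparse_harmonic m powr (s + 1))) \<le> ennreal (1 / (9 * s))"
    by (simp add: ennreal_leI)
qed

lemma arithmetic_power_sum_ge:
  assumes s: "s > 0"
  shows "ennreal (1 / (9 * s)) \<le> (\<Sum>\<^sub>\<infinity>m. ennreal ((1 / (9 * real m + 1)) powr (s + 1)))"
proof -
  define S where "S = (\<Sum>\<^sub>\<infinity>m. ennreal ((1 / (9 * real m + 1)) powr (s + 1)))"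
  have "ennreal ((1 - (9 * real n + 1) powr - s) / (9 * s)) \<le> S" for n
  proof -
    have "ennreal ((1 - (9 * real n + 1) powr - s) / (9 * s))
        \<le> ennreal (\<Sum>k<n. (9 * real k + 1) powr - (s + 1))"
      by (intro ennreal_leI sum_arithmetic_powr_ge s)
    also have "\<dots> = (\<Sum>k<n. ennreal ((1 / (9 * real k + 1)) powr (s + 1)))"
      by (simp add: powr_one_over flip: sum_ennreal)
    also have "\<dots> \<le> S"
      unfolding S_def by (intro sum_le_infsum_ennreal) auto
    finally show ?thesis .
  qed
  moreover have "(\<lambda>n. ennreal ((1 - (9 * real n + 1) powr - s) / (9 * s))) \<longlonglongrightarrow> ennreal ((1 - 0) / (9 * s))"
  proof (intro tendsto_ennrealI tendsto_divide tendsto_diff tendsto_const)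
    have "filterlim (\<lambda>n. 9 * real n + 1) at_top sequentially"
      by real_asymp
    thus "(\<lambda>n. (9 * real n + 1) powr - s) \<longlonglongrightarrow> 0"
      using s by (intro tendsto_neg_powr) simp
  qed (use s in simp)
  ultimately have "ennreal ((1 - 0) / (9 * s)) \<le> S"
    by (intro LIMSEQ_le_const2) auto
  thus ?thesis
    by (simp add: S_def)
qed


section \<open>The separating pair of operators\<close>

lemma diagonal_harmonic_weak_L1:
  fixes e :: "nat \<Rightarrow> 'a::complex_hilbert"
  assumes inf: "\<not> (\<exists>F :: 'a set. finite F \<and> cspan F = UNIV)"
    and T: "diagonal T e w" and w: "\<And>i. 0 \<le> w i" "\<And>i. w i \<le> 1 / (real i + 1)"
  shows "w \<longlonglongrightarrow> 0" and "T \<in> weak_L1" and "sing_val T n \<le> 1 / (real n + 1)"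
proof -
  show w0: "w \<longlonglongrightarrow> 0"
  proof (rule tendsto_sandwich[of "\<lambda>_. 0"])
    show "(\<lambda>i. 1 / (real i + 1)) \<longlonglongrightarrow> 0"
      by real_asymp
  qed (use w in auto)
  have cpt: "compact_op T"
    by (rule diagonal_compact[OF T]) (use tendsto_0_finite_ge[OF w0] w(1) in simp)
  have le: "sing_val T n \<le> 1 / (real n + 1)" for n
  proof (rule sing_val_le[OF inf cpt])
    fix x assume x: "\<And>i. i < n \<Longrightarrow> cinner (e i) x = 0"
    show "norm (T x) \<le> 1 / (real n + 1) * norm x"
    proof (rule diagonal_norm_le[OF T])
      fix i assume "cinner (e i) x \<noteq> 0"
      hence "n \<le> i"
        using x not_less by blast
      hence "1 / (real i + 1) \<le> 1 / (real n + 1)"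
        by (intro divide_left_mono) auto
      thus "\<bar>w i\<bar> \<le> 1 / (real n + 1)"
        using w[of i] by simp
    qed simp
  qed
  thus "sing_val T n \<le> 1 / (real n + 1)" .
  have "(real k + 1) * sing_val T k \<le> 1" for k
    using le[of k] by (simp add: field_simps)
  thus "T \<in> weak_L1"
    using cpt unfolding weak_L1_def by (auto intro!: bdd_aboveI[where M = 1])
qed

lemma sum_even_ge_half:
  fixes s :: "nat \<Rightarrow> real"
  assumes "decseq s"
  shows "(\<Sum>k<2 * K. s k) \<le> 2 * (\<Sum>k<K. s (2 * k))"
proof (induction K)
  case (Suc K)
  have "s (Suc (2 * K)) \<le> s (2 * K)"
    using assms by (auto simp: decseq_def)
  thus ?case
    using Suc by simp
qed simp

text \<open>A block ending at \<open>N\<close> contains a quarter of the logarithmic length of \<open>{1..N}\<close>. Subtracting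
  \<open>1 / N\<close> from the coefficients costs at most \<open>1\<close> on the block, and it removes every singular value
  with an index of at least \<open>N\<close>, so the excess sums compare the block with the first \<open>N\<close> singular
  values.\<close>

lemma sparse_harmonic_sing_val_sum_ge:
  fixes e :: "nat \<Rightarrow> 'a::complex_hilbert"
  assumes inf: "\<not> (\<exists>F :: 'a set. finite F \<and> cspan F = UNIV)"
    and B: "diagonal B e sparse_harmonic"
  shows "(\<Sum>k<block_base l ^ 4. sing_val B k) \<ge> ln (real (block_base l ^ 4)) / 4 - 2"
proof -
  define N where "N = block_base l ^ 4"
  define M where "M = block_base l ^ 3"
  have M: "M > 0" "M \<le> N"
    using block_base_ge_2[of l] by (auto simp: M_def N_def intro: power_increasing)
  hence N: "N > 0"
    by simp
  note L1 = diagonal_harmonic_weak_L1[OF inf B sparse_harmonic_bounds]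
  have cpt: "compact_op B"
    using L1(2) by (simp add: weak_L1_def)
  have nn: "sing_val B k \<ge> 0" for k
    by (rule sing_val_nonneg[OF inf cpt])
  define \<phi> where "\<phi> x = ennreal (max 0 (x - 1 / real N))" for x :: real
  define G where "G = {m. Suc m \<in> block l}"
  have SG: "Suc ` G = {M<..N}"
    unfolding G_def block_def M_def N_def by (auto simp: image_iff) (metis Suc_pred gr0I less_nat_zero_code)
  hence G: "finite G" "card G \<le> N"
    using finite_imageD[of Suc G] card_image[of Suc G] by auto
  have "(\<Sum>m\<in>G. sparse_harmonic m) = (\<Sum>k\<in>Suc ` G. 1 / real k)"
    unfolding sum.reindex[OF inj_Suc[of G, unfolded inj_on_def[symmetric]]]
    by (intro sum.cong) (auto simp: G_def sparse_harmonic_def)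
  also have "\<dots> \<ge> ln (real N + 1) - ln (real M + 1)"
    unfolding SG by (rule sum_block_harmonic_ge[OF M(2)])
  also have "ln (real N + 1) - ln (real M + 1) \<ge> ln (real N) / 4 - 1"
  proof -
    have "ln (real M + 1) \<le> ln (2 * real M)"
      using M by simp
    also have "\<dots> = ln 2 + 3 * ln (real (block_base l))"
      using block_base_ge_2[of l] M by (simp add: ln_mult M_def ln_realpow)
    finally have "ln (real M + 1) \<le> 1 + 3 * ln (real (block_base l))"
      using ln_2_less_1 by linarith
    moreover have "ln (real N) = 4 * ln (real (block_base l))"
      using block_base_ge_2[of l] by (simp add: N_def ln_realpow)
    moreover have "ln (real N) \<le> ln (real N + 1)"
      using N by simp
    ultimately show ?thesis
      by linarith
  qed
  finally have "ln (real N) / 4 - 1 \<le> (\<Sum>m\<in>G. sparse_harmonic m)" .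
  moreover have "(\<Sum>m\<in>G. sparse_harmonic m) - 1 \<le> (\<Sum>m\<in>G. max 0 (sparse_harmonic m - 1 / real N))"
  proof -
    have "real (card G) / real N \<le> 1"
      using G N by simp
    hence "(\<Sum>m\<in>G. sparse_harmonic m) - 1 \<le> (\<Sum>m\<in>G. sparse_harmonic m - 1 / real N)"
      by (simp add: sum_subtractf)
    also have "\<dots> \<le> (\<Sum>m\<in>G. max 0 (sparse_harmonic m - 1 / real N))"
      by (intro sum_mono) simp
    finally show ?thesis .
  qed
  moreover have "(\<Sum>m\<in>G. max 0 (sparse_harmonic m - 1 / real N)) \<le> (\<Sum>k<N. sing_val B k)"
  proof -
    have "ennreal (\<Sum>m\<in>G. max 0 (sparse_harmonic m - 1 / real N)) = (\<Sum>m\<in>G. \<phi> (sparse_harmonic m))"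
      by (simp add: \<phi>_def)
    also have "\<dots> \<le> (\<Sum>\<^sub>\<infinity>m. \<phi> (sparse_harmonic m))"
      by (intro sum_le_infsum_ennreal G) simp
    also have "\<dots> = (\<Sum>\<^sub>\<infinity>k. \<phi> (sing_val B k))"
      by (rule infsum_sing_val_diagonal[where \<phi> = \<phi>, OF inf B, symmetric])
         (use tendsto_0_finite_ge[OF L1(1)] in \<open>auto simp: \<phi>_def sparse_harmonic_bounds\<close>)
    also have "\<dots> = (\<Sum>\<^sub>\<infinity>k\<in>{..<N}. \<phi> (sing_val B k))"
    proof (rule infsum_cong_neutral)
      fix k assume "k \<in> UNIV - {..<N}"
      hence "1 / (real k + 1) \<le> 1 / real N"
        using N by (intro divide_left_mono) auto
      thus "\<phi> (sing_val B k) = 0"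
        using L1(3)[of k] by (simp add: \<phi>_def)
    qed auto
    also have "\<dots> = ennreal (\<Sum>k<N. max 0 (sing_val B k - 1 / real N))"
      by (simp add: \<phi>_def)
    also have "\<dots> \<le> ennreal (\<Sum>k<N. sing_val B k)"
      using nn by (intro ennreal_leI sum_mono) simp
    finally show ?thesis
      using nn by (simp add: sum_nonneg)
  qed
  ultimately show ?thesis
    unfolding N_def by linarith
qed

text \<open>Over the range \<open>{1..N}\<close> the operator with eigenvalues \<open>1 / (9 i + 1)\<close> has logarithmic mass
  \<open>ln N / 9\<close>, and tensoring with a summable sequence \<open>c\<close> multiplies it by the sum of \<open>c\<close>.\<close>

lemma arithmetic_excess_le:
  fixes c :: "nat \<Rightarrow> real"
  assumes c: "decseq c" "\<And>j. c j \<ge> 0" and N: "N > 0" and Z: "c 0 \<le> real Z" "Z > 0"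
  shows "(\<Sum>\<^sub>\<infinity>(i, j). ennreal (max 0 (1 / (9 * real i + 1) * c j - 1 / real N)))
    \<le> ennreal (1 + (ln (real N) + ln (10 * real Z)) / 9) * (\<Sum>\<^sub>\<infinity>j. ennreal (c j))"
proof -
  define D where "D = 1 + (ln (real N) + ln (10 * real Z)) / 9"
  \<comment> \<open>From the index \<open>n\<close> on, no product exceeds the threshold \<open>1 / N\<close>.\<close>
  define n where "n = N * Z"
  have n: "n > 0"
    using N Z by (simp add: n_def)
  have "1 + ln (9 * real n + 1) / 9 \<le> D"
  proof -
    have "ln (9 * real n + 1) \<le> ln (10 * real n)"
      using n by simp
    also have "\<dots> = ln (real N) + ln (10 * real Z)"
      using N Z by (simp add: n_def ln_mult)
    finally show ?thesis
      by (simp add: D_def)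
  qed
  hence D: "(\<Sum>i<n. 1 / (9 * real i + 1)) \<le> D"
    using sum_arithmetic_le[of 9 n] by simp
  have row: "(\<Sum>\<^sub>\<infinity>i. ennreal (max 0 (1 / (9 * real i + 1) * c j - 1 / real N))) \<le> ennreal D * ennreal (c j)"
    for j
  proof -
    have "(\<Sum>\<^sub>\<infinity>i. ennreal (max 0 (1 / (9 * real i + 1) * c j - 1 / real N)))
        = (\<Sum>\<^sub>\<infinity>i\<in>{..<n}. ennreal (max 0 (1 / (9 * real i + 1) * c j - 1 / real N)))"
    proof (rule infsum_cong_neutral)
      fix i assume "i \<in> UNIV - {..<n}"
      hence "real N * real Z \<le> real i"
        by (simp add: n_def flip: of_nat_mult)
      moreover have "c j \<le> real Z"
        using decseqD[OF c(1), of 0 j] Z(1) by simp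
      hence "real N * c j \<le> real N * real Z"
        by (intro mult_left_mono) auto
      ultimately have "real N * c j \<le> 9 * real i + 1"
        by linarith
      hence "1 / (9 * real i + 1) * c j \<le> 1 / real N"
        using N by (simp add: field_simps)
      thus "ennreal (max 0 (1 / (9 * real i + 1) * c j - 1 / real N)) = 0"
        by simp
    qed auto
    also have "\<dots> = ennreal (\<Sum>i<n. max 0 (1 / (9 * real i + 1) * c j - 1 / real N))"
      by simp
    also have "\<dots> \<le> ennreal (\<Sum>i<n. 1 / (9 * real i + 1) * c j)"
      using c by (intro ennreal_leI sum_mono) auto
    also have "\<dots> \<le> ennreal (D * c j)"
      unfolding sum_distrib_right[symmetric] by (intro ennreal_leI mult_right_mono D c)
    also have "\<dots> = ennreal D * ennreal (c j)"
      using c by (simp add: ennreal_mult'')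
    finally show ?thesis .
  qed
  have "(\<Sum>\<^sub>\<infinity>(i, j). ennreal (max 0 (1 / (9 * real i + 1) * c j - 1 / real N)))
      = (\<Sum>\<^sub>\<infinity>j. \<Sum>\<^sub>\<infinity>i. ennreal (max 0 (1 / (9 * real i + 1) * c j - 1 / real N)))"
    using infsum_Times_ennreal[of "\<lambda>i j. ennreal (max 0 (1 / (9 * real i + 1) * c j - 1 / real N))" UNIV UNIV]
    by (subst infsum_swap_ennreal) simp
  also have "\<dots> \<le> (\<Sum>\<^sub>\<infinity>j. ennreal D * ennreal (c j))"
    by (intro infsum_mono row nonneg_summable_on_complete) auto
  also have "\<dots> = ennreal D * (\<Sum>\<^sub>\<infinity>j. ennreal (c j))"
    by (rule infsum_cmult_ennreal)
  finally show ?thesis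
    by (simp add: D_def)
qed

text \<open>Suppose \<open>B'\<close> belongs to \<open>Catal t A\<close> and is within \<open>1 / 100\<close> of \<open>B\<close>. Ky Fan's inequality bounds its
  singular values below by every second singular value of \<open>B\<close>, up to \<open>1 / (100 (k + 1))\<close>, so up to
  the end \<open>N\<close> of a block they have the mass \<open>(1 / 8 - 1 / 100) ln N\<close>. Excess over the threshold
  \<open>1 / N\<close> compares this mass, multiplied by nearly all of the trace \<open>S\<close> of the catalyst, with
  \<open>S ln N / 9\<close>, up to bounded terms. This fails for large \<open>N\<close>.\<close>

lemma sparse_harmonic_not_in_closure:
  fixes t :: "'h::complex_hilbert \<Rightarrow> 'h \<Rightarrow> 'k::complex_hilbert" and e :: "nat \<Rightarrow> 'h"
  assumes inf: "\<not> (\<exists>F :: 'h set. finite F \<and> cspan F = UNIV)" and t: "hilbert_tensor t"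
    and A: "diagonal A e (\<lambda>i. 1 / (9 * real i + 1))" and B: "diagonal B e sparse_harmonic"
  shows "B \<notin> weak_L1_closure (Catal t A)"
proof
  assume "B \<in> weak_L1_closure (Catal t A)"
  then obtain B' where B': "B' \<in> Catal t A" "weak_L1_norm (\<lambda>x. B x - B' x) < 1 / 100"
    unfolding weak_L1_closure_def by (auto dest: spec[of _ "1 / 100 :: real"])
  note LB = diagonal_harmonic_weak_L1[OF inf B sparse_harmonic_bounds]
  have LA: "(\<lambda>i. 1 / (9 * real i + 1)) \<longlonglongrightarrow> 0"
    by real_asymp
  have L': "B' \<in> weak_L1"
    using B'(1) by (simp add: Catal_def)
  have cpt: "compact_op B" "compact_op B'"
    using LB(2) L' by (auto simp: weak_L1_def)
  define b where "b = sing_val B'"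
  have b0: "b k \<ge> 0" for k
    unfolding b_def by (rule sing_val_nonneg[OF inf cpt(2)])
  have b: "sing_val B (2 * k) - 1 / 100 * (1 / (1 * real k + 1)) \<le> b k" for k
  proof -
    have "sing_val B (k + k) \<le> sing_val B' k + sing_val (\<lambda>x. B x - B' x) k"
    proof (rule sing_val_add_le[OF inf cpt(2) compact_op_diff[OF cpt] cpt(1)])
      show "norm (B x) \<le> norm (B' x) + norm (B x - B' x)" for x
        using norm_triangle_ineq[of "B' x" "B x - B' x"] by simp
    qed
    moreover have "(real k + 1) * sing_val (\<lambda>x. B x - B' x) k \<le> 1 / 100"
      using weak_L1_norm_diff[OF inf LB(2) L', of k] B'(2) by linarith
    hence "sing_val (\<lambda>x. B x - B' x) k \<le> 1 / 100 * (1 / (1 * real k + 1))"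
      by (simp add: field_simps)
    ultimately show ?thesis
      by (simp add: b_def mult_2)
  qed
  obtain c :: "nat \<Rightarrow> real" where c: "decseq c" "\<And>j. c j \<ge> 0" "c 0 > 0"
    and fin: "(\<Sum>\<^sub>\<infinity>j. ennreal (c j)) < \<infinity>"
    and le: "\<And>r. r > 0 \<Longrightarrow> (\<Sum>\<^sub>\<infinity>(i, j). ennreal (max 0 (sing_val B' i * c j - r)))
            \<le> (\<Sum>\<^sub>\<infinity>(i, j). ennreal (max 0 (1 / (9 * real i + 1) * c j - r)))"
    by (rule Catal_inequalities[OF inf t A _ LA B'(1)]) auto
  define S where "S = enn2real (\<Sum>\<^sub>\<infinity>j. ennreal (c j))"
  have S: "(\<Sum>\<^sub>\<infinity>j. ennreal (c j)) = ennreal S"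
    using fin by (simp add: S_def)
  have "ennreal (c 0) \<le> (\<Sum>\<^sub>\<infinity>j. ennreal (c j))"
    using sum_le_infsum_ennreal[of "{0}" UNIV "\<lambda>j. ennreal (c j)"] by simp
  hence Spos: "S > 0"
    unfolding S using c(3) by (simp add: ennreal_le_iff2)
  \<comment> \<open>The finitely many catalyst eigenvalues below \<open>J\<close> suffice since
    \<open>97 / 100 * (1 / 8 - 1 / 100) > 1 / 9\<close>.\<close>
  obtain J where J: "(\<Sum>j<J. c j) > 97 / 100 * S"
  proof (rule ccontr)
    assume "\<not> thesis"
    hence all: "(\<Sum>j<J. c j) \<le> 97 / 100 * S" for J
      using that not_less by blast
    have "(\<Sum>\<^sub>\<infinity>j. ennreal (c j)) \<le> ennreal (97 / 100 * S)"
    proof (rule infsum_le_ennreal)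
      fix F :: "nat set" assume "finite F"
      then obtain J where "F \<subseteq> {..<J}"
        using finite_nat_iff_bounded by blast
      hence "(\<Sum>j\<in>F. c j) \<le> (\<Sum>j<J. c j)"
        using c by (intro sum_mono2) auto
      thus "(\<Sum>j\<in>F. ennreal (c j)) \<le> ennreal (97 / 100 * S)"
        using all[of J] c by (simp add: ennreal_leI)
    qed
    thus False
      using Spos by (simp add: S)
  qed
  define \<sigma> where "\<sigma> = (\<Sum>j<J. c j)"
  define Z where "Z = nat \<lceil>c 0\<rceil>"
  have Z: "c 0 \<le> real Z" "Z > 0"
    using c(3) by (auto simp: Z_def of_nat_ceiling)
  \<comment> \<open>Here \<open>23 / 200 = 1 / 8 - 1 / 100\<close>.\<close>
  have main: "\<sigma> * (23 / 200 * ln (real (block_base l ^ 4)) - 2) - real J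
      \<le> S * (1 + (ln (real (block_base l ^ 4)) + ln (10 * real Z)) / 9)" for l
  proof -
    define N where "N = block_base l ^ 4"
    define K where "K = N div 2"
    define L where "L = ln (real N)"
    have evenN: "2 * K = N"
      by (simp add: K_def N_def block_base_def)
    have N: "N > 0"
      using block_base_ge_2[of l] by (simp add: N_def)
    have K: "K > 0"
      using N evenN by (cases K) auto
    have "(\<Sum>k<K. 1 / (1 * real k + 1)) \<le> 1 + L"
    proof -
      have "real K + 1 \<le> real N"
        using evenN K by linarith
      hence "ln (1 * real K + 1) \<le> L"
        unfolding L_def by simp
      thus ?thesis
        using sum_arithmetic_le[of 1 K] by simp
    qed
    moreover have "L / 4 - 2 \<le> 2 * (\<Sum>k<K. sing_val B (2 * k))"
      using sparse_harmonic_sing_val_sum_ge[OF inf B, of l]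
        sum_even_ge_half[OF decseq_sing_val[OF inf cpt(1)], of K] evenN
      by (simp add: L_def N_def)
    moreover have "(\<Sum>k<K. sing_val B (2 * k)) - 1 / 100 * (\<Sum>k<K. 1 / (1 * real k + 1)) \<le> (\<Sum>k<K. b k)"
      unfolding sum_distrib_left sum_subtractf[symmetric] by (intro sum_mono b)
    ultimately have sb: "23 / 200 * L - 2 \<le> (\<Sum>k<K. b k)"
      by argo
    have "\<sigma> * (23 / 200 * L - 2) - real J \<le> \<sigma> * (\<Sum>k<K. b k) - real J * (real K / real N)"
    proof (intro diff_mono mult_left_mono sb)
      show "0 \<le> \<sigma>"
        using c by (simp add: \<sigma>_def sum_nonneg)
      have "real K / real N \<le> 1"
        using evenN N by simp
      thus "real J * (real K / real N) \<le> real J"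
        using mult_left_mono[of "real K / real N" 1 "real J"] by simp
    qed
    also have "\<dots> = (\<Sum>(i, j)\<in>{..<K} \<times> {..<J}. b i * c j - 1 / real N)"
      by (simp add: \<sigma>_def sum_subtractf sum_product mult.commute sum.cartesian_product[symmetric]
          sum_distrib_left sum_distrib_right sum.swap[of _ "{..<J}"])
    also have "\<dots> \<le> (\<Sum>(i, j)\<in>{..<K} \<times> {..<J}. max 0 (b i * c j - 1 / real N))"
      by (intro sum_mono) auto
    finally have "ennreal (\<sigma> * (23 / 200 * L - 2) - real J)
        \<le> ennreal (\<Sum>(i, j)\<in>{..<K} \<times> {..<J}. max 0 (b i * c j - 1 / real N))"
      by (rule ennreal_leI)
    also have "\<dots> = (\<Sum>(i, j)\<in>{..<K} \<times> {..<J}. ennreal (max 0 (b i * c j - 1 / real N)))"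
      by (subst sum_ennreal[symmetric]) (auto simp: case_prod_unfold)
    also have "\<dots> \<le> (\<Sum>\<^sub>\<infinity>(i, j). ennreal (max 0 (b i * c j - 1 / real N)))"
      by (intro sum_le_infsum_ennreal) auto
    also have "\<dots> \<le> (\<Sum>\<^sub>\<infinity>(i, j). ennreal (max 0 (1 / (9 * real i + 1) * c j - 1 / real N)))"
      unfolding b_def using N by (intro le) simp
    also have "\<dots> \<le> ennreal (1 + (L + ln (10 * real Z)) / 9) * ennreal S"
      unfolding S[symmetric] L_def by (rule arithmetic_excess_le[OF c(1,2) N Z])
    also have "\<dots> = ennreal (S * (1 + (L + ln (10 * real Z)) / 9))"
      using ennreal_mult''[of S] Spos by (simp only: mult.commute[of S] less_imp_le)
    finally have "\<sigma> * (23 / 200 * L - 2) - real J \<le> S * (1 + (L + ln (10 * real Z)) / 9)"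
    proof (subst (asm) ennreal_le_iff)
      have "ln (10 * real Z) \<ge> 0" "L \<ge> 0"
        using Z N by (auto simp: L_def)
      thus "0 \<le> S * (1 + (L + ln (10 * real Z)) / 9)"
        using Spos by (intro mult_nonneg_nonneg) auto
    qed
    thus ?thesis
      by (simp add: L_def N_def)
  qed
  define C where "C = S * (1 + ln (10 * real Z) / 9) + 2 * \<sigma> + real J"
  have gap: "\<sigma> * (23 / 200) - S / 9 > 0"
    using J Spos unfolding \<sigma>_def[symmetric] by argo
  obtain l :: nat where l: "C / (\<sigma> * (23 / 200) - S / 9) < real l"
    using reals_Archimedean2 by blast
  have "real l \<le> ln (real (block_base l ^ 4))"
  proof -
    have "(10000::nat) ^ l > l"
      using less_exp[of l] power_mono[of "2::nat" 10000 l] by linarith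
    hence "real l \<le> real (10000 ^ l)"
      by (simp only: of_nat_le_iff)
    also have "\<dots> \<le> 4 * (real (10000 ^ l) * ln 2)"
      using ln2_ge_two_thirds mult_left_mono[of "2/3" "ln 2" "real (10000 ^ l)"] by simp
    also have "\<dots> = ln (real (block_base l ^ 4))"
      by (simp add: block_base_def ln_realpow)
    finally show ?thesis .
  qed
  hence "C / (\<sigma> * (23 / 200) - S / 9) < ln (real (block_base l ^ 4))"
    using l by linarith
  hence "C < (\<sigma> * (23 / 200) - S / 9) * ln (real (block_base l ^ 4))"
    using gap by (simp add: divide_less_eq mult.commute)
  thus False
    using main[of l] by (simp add: C_def algebra_simps add_divide_distrib)
qed

lemma exists_orthonormal_sequence:
  assumes inf: "\<not> (\<exists>F :: 'a::complex_hilbert set. finite F \<and> cspan F = UNIV)"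
  shows "\<exists>e :: nat \<Rightarrow> 'a. orthonormal e"
proof -
  have "(\<lambda>x::'a. 0::'a) ` cball 0 1 = {0}"
    by (simp add: image_constant_conv)
  hence "compact_op (\<lambda>x::'a. 0::'a)"
    by (simp add: compact_op_def bounded_clinear_def)
  thus ?thesis
    using greedy_singular_vectors[OF inf] by metis
qed

theorem theorem5:
  fixes t :: "'h::complex_hilbert \<Rightarrow> 'h \<Rightarrow> 'k::complex_hilbert"
  assumes separable: "\<exists>D :: 'h set. countable D \<and> closure D = UNIV"
    and infinite_dimensional: "\<not> (\<exists>F :: 'h set. finite F \<and> cspan F = UNIV)"
    and tensor: "hilbert_tensor t"
  shows "\<exists>A :: 'h \<Rightarrow> 'h. positive_op A \<and> A \<in> weak_L1 \<and>
           weak_L1_closure (Catal t A) \<subset> PM A"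
proof -
  obtain e :: "nat \<Rightarrow> 'h" where e: "orthonormal e"
    using exists_orthonormal_sequence[OF infinite_dimensional] by blast
  define a :: "nat \<Rightarrow> real" where "a = (\<lambda>i. 1 / (9 * real i + 1))"
  have a: "0 \<le> a i" "a i \<le> 1 / (real i + 1)" "a i \<le> 1" for i
    by (auto simp: a_def field_simps)
  have b: "sparse_harmonic i \<le> 1" for i
    by (rule order.trans[OF sparse_harmonic_bounds(2)]) simp
  obtain A where A: "diagonal A e a"
    using diagonal_exists[OF e, of a 1] a by auto
  obtain B where B: "diagonal B e sparse_harmonic"
    using diagonal_exists[OF e, of sparse_harmonic 1] b sparse_harmonic_bounds(1) by auto
  note LA = diagonal_harmonic_weak_L1[OF infinite_dimensional A a(1,2)]
  note LB = diagonal_harmonic_weak_L1[OF infinite_dimensional B sparse_harmonic_bounds]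
  have "op_trace (op_powr B p) \<le> op_trace (op_powr A p)" if p: "p > 1" for p
  proof -
    define s where "s = p - 1"
    have s: "s > 0" "p = s + 1"
      using p by (auto simp: s_def)
    have "(\<Sum>\<^sub>\<infinity>m. ennreal (sparse_harmonic m powr p)) \<le> (\<Sum>\<^sub>\<infinity>m. ennreal (a m powr p))"
      unfolding s(2) a_def
      by (rule order.trans[OF sparse_harmonic_power_sum_le[OF s(1)] arithmetic_power_sum_ge[OF s(1)]])
    thus ?thesis
      using op_trace_powr_diagonal[OF A a(1,3), of p] p
        op_trace_powr_diagonal[OF B sparse_harmonic_bounds(1) b, of p] by simp
  qed
  hence "B \<in> PM A"
    using diagonal_positive[OF B sparse_harmonic_bounds(1)] LB(2) by (simp add: PM_def)
  moreover have "B \<notin> weak_L1_closure (Catal t A)"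
    by (rule sparse_harmonic_not_in_closure[OF infinite_dimensional tensor A[unfolded a_def] B])
  moreover have "weak_L1_closure (Catal t A) \<subseteq> PM A"
    by (rule closure_Catal_subset_PM[OF infinite_dimensional tensor A a(1) LA(1)])
  ultimately have "weak_L1_closure (Catal t A) \<subset> PM A"
    by blast
  thus ?thesis
    using diagonal_positive[OF A a(1)] LA(2) by blast
qed

end
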